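(* Let $p$ be a prime and let $\sigma:\bar{\mathbb F}_p^\times\to\mathbb Q/\mathbb Z$ be an injective group homomorphism. The following formulas define a representation $\pi_\sigma$ of the integral BC-algebra $\mathcal H_{\mathbb Z}$ as additive endomorphisms of $\mathbb W_0(\bar{\mathbb F}_p)$: $$\pi_\sigma(x)\xi=\tilde\sigma^{-1}(r(x))\,\xi,\qquad \pi_\sigma(\mu_n^* )=F_n,\qquad \pi_\sigma(\tilde\mu_n)=V_n$$ for all $\xi\in\mathbb W_0(\bar{\mathbb F}_p)$, $x\in\mathbb Z[\mathbb Q/\mathbb Z]$ and $n\in\mathbb N$.
   Context: $\mathbb N$ is the set of positive integers. For a commutative unital ring $A$, let $\underline{\mathrm{End}}_A$ be the category of pairs $(E,f)$ with $E$ a finite projective $A$-module and $f\in\mathrm{End}_A(E)$. Direct sum and tensor product make $K_0(\underline{\mathrm{End}}_A)$ a commutative ring; the pairs $(E,0)$ generate an ideal $K_0(A)$, and $\mathbb W_0(A):=K_0(\underline{\mathrm{End}}_A)/K_0(A)$. For $n\in\mathbb N$, $F_n(E,f)=(E,f^n)$ (a ring endomorphism of $\mathbb W_0(A)$), and $V_n$ is the additive map $V_n(E,f)=(E^{\oplus n},\Phi)$ with $(\Phi\xi)_1=f\xi_n$ and $(\Phi\xi)_j=\xi_{j-1}$ for $2\le j\le n$. $(\mathbb Q/\mathbb Z)^{(p)}\subset\mathbb Q/\mathbb Z$ is the subgroup of fractions with denominator prime to $p$ (the image of any injective group homomorphism $\sigma:\bar{\mathbb F}_p^\times\to\mathbb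 Q/\mathbb Z$). The generators of $\mathbb Z[\mathbb Q/\mathbb Z]$ are $e(\gamma)$, $\gamma\in\mathbb Q/\mathbb Z$. The ring isomorphism $\tilde\sigma:\mathbb W_0(\bar{\mathbb F}_p)\to\mathbb Z[(\mathbb Q/\mathbb Z)^{(p)}]$ sends the class of $(E,f)$ to $\sum_\alpha e(\sigma(\alpha))$, sum over the non-zero eigenvalues $\alpha$ of $f$ counted with algebraic multiplicity. The map $r:\mathbb Z[\mathbb Q/\mathbb Z]\to\mathbb Z[(\mathbb Q/\mathbb Z)^{(p)}]$ is the ring homomorphism induced by the projection $\mathbb Q/\mathbb Z=(\mathbb Q/\mathbb Z)^{(p)}\times\mathbb Q_p/\mathbb Z_p\to(\mathbb Q/\mathbb Z)^{(p)}$. For $n\in\mathbb N$ let $\sigma_n(e(\gamma))=e(n\gamma)$ (ring endomorphism of $\mathbb Z[\mathbb Q/\mathbb Z]$) and $\tilde\rho_n(e(\gamma))=\sum_{n\gamma'=\gamma}e(\gamma')$ (additive map). The integral BC-algebra $\mathcal H_{\mathbb Z}$ is the ring generated by $\mathbb Z[\mathbb Q/\mathbb Z]$ and elements $\tilde\mu_n,\mu_n^*$ ($n\in\mathbb N$) subject to the relations, for $x\in\mathbb Z[\mathbb Q/\mathbb Z]$ and $n,m\in\mathbb N$: $\tilde\mu_n x\mu_n^*=\tilde\rho_n(x)$, $\mu_n^*x=\sigma_n(x)\mu_n^*$, $x\tilde\mu_n=\tilde\mu_n\sigma_n(x)$, $\tilde\mu_{nm}=\tilde\mu_n\tilde\mu_m$,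 $\mu_{nm}^*=\mu_n^*\mu_m^*$, $\mu_n^*\tilde\mu_n=n$, and $\tilde\mu_n\mu_m^*=\mu_m^*\tilde\mu_n$ if $\gcd(n,m)=1$. *)

theory Defs
  imports
    "HOL-Library.Function_Algebras"
    "HOL-Library.Poly_Mapping"
    "HOL-Library.Nat_Bijection"
    "HOL-Computational_Algebra.Computational_Algebra"
    "Jordan_Normal_Form.Char_Poly"
begin

section \<open>The category of endomorphisms of finite projective modules\<close>

text \<open>
  All modules are realised inside \<^typ>\<open>nat \<Rightarrow> 'a\<close>; up to isomorphism every finite projective module
  over the ring \<^typ>\<open>'a\<close> is a direct summand of a free module on a finite subset of \<^typ>\<open>nat\<close>.
\<close>

definition fscale :: "'a::comm_ring_1 \<Rightarrow> (nat \<Rightarrow> 'a) \<Rightarrow> nat \<Rightarrow> 'a" where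
  "fscale c v = (\<lambda>i. c * v i)"

interpretation fmod: Modules.module fscale
  by standard (auto simp: fscale_def fun_eq_iff algebra_simps)

definition free_on :: "nat set \<Rightarrow> (nat \<Rightarrow> 'a::comm_ring_1) set" where
  "free_on I = {v. \<forall>i. i \<notin> I \<longrightarrow> v i = 0}"

definition finite_projective :: "(nat \<Rightarrow> 'a::comm_ring_1) set \<Rightarrow> bool" where
  "finite_projective E \<longleftrightarrow> (\<exists>I F. finite I \<and> fmod.subspace E \<and> fmod.subspace F \<and>
     {x + y | x y. x \<in> E \<and> y \<in> F} = free_on I \<and> E \<inter> F = {0})"

definition mod_hom ::
    "(nat \<Rightarrow> 'a::comm_ring_1) set \<Rightarrow> (nat \<Rightarrow> 'a) set \<Rightarrow> ((nat \<Rightarrow> 'a) \<Rightarrow> nat \<Rightarrow> 'a) \<Rightarrow> bool" where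
  "mod_hom E E' f \<longleftrightarrow> f ` E \<subseteq> E' \<and> (\<forall>x\<in>E. \<forall>y\<in>E. f (x + y) = f x + f y) \<and>
     (\<forall>c. \<forall>x\<in>E. f (fscale c x) = fscale c (f x))"

text \<open>The values of \<open>f\<close> outside \<open>E\<close> are irrelevant: two pairs whose endomorphisms agree on \<open>E\<close> are
  isomorphic, hence have the same class below.\<close>

typedef (overloaded) 'a endo =
  "{(E :: (nat \<Rightarrow> 'a::comm_ring_1) set, f). finite_projective E \<and> mod_hom E E f}"
proof -
  have "finite_projective {0 :: nat \<Rightarrow> 'a}"
    unfolding finite_projective_def
    by (intro exI[of _ "{}"] exI[of _ "{0}"]) (auto simp: free_on_def)
  moreover have "mod_hom {0} {0} (\<lambda>x::nat \<Rightarrow> 'a. x)"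
    by (auto simp: mod_hom_def)
  ultimately show ?thesis by blast
qed

setup_lifting type_definition_endo

definition endo_mod :: "'a::comm_ring_1 endo \<Rightarrow> (nat \<Rightarrow> 'a) set" where
  "endo_mod X = fst (Rep_endo X)"

definition endo_map :: "'a::comm_ring_1 endo \<Rightarrow> (nat \<Rightarrow> 'a) \<Rightarrow> nat \<Rightarrow> 'a" where
  "endo_map X = snd (Rep_endo X)"


lemma endo_mod_map:
  "finite_projective (endo_mod X)" "mod_hom (endo_mod X) (endo_mod X) (endo_map X)"
  using Rep_endo[of X] by (auto simp: endo_mod_def endo_map_def)

definition short_exact :: "'a::comm_ring_1 endo \<Rightarrow> 'a endo \<Rightarrow> 'a endo \<Rightarrow> bool" where
  "short_exact X Y Z \<longleftrightarrow> (\<exists>i q. 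
     mod_hom (endo_mod X) (endo_mod Y) i \<and> mod_hom (endo_mod Y) (endo_mod Z) q \<and>
     (\<forall>x\<in>endo_mod X. i (endo_map X x) = endo_map Y (i x)) \<and>
     (\<forall>y\<in>endo_mod Y. q (endo_map Y y) = endo_map Z (q y)) \<and>
     inj_on i (endo_mod X) \<and> q ` endo_mod Y = endo_mod Z \<and>
     i ` endo_mod X = {y \<in> endo_mod Y. q y = 0})"

lemma mod_homD:
  assumes "mod_hom E E' f"
  shows "x \<in> E \<Longrightarrow> f x \<in> E'" "x \<in> E \<Longrightarrow> y \<in> E \<Longrightarrow> f (x + y) = f x + f y"
    "x \<in> E \<Longrightarrow> f (fscale c x) = fscale c (f x)"
  using assms by (auto simp: mod_hom_def)

lemma finite_projective_subspace: "finite_projective E \<Longrightarrow> fmod.subspace E"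
  by (auto simp: finite_projective_def)

lemma finite_projectiveE:
  assumes "finite_projective (E :: (nat \<Rightarrow> 'a::comm_ring_1) set)"
  obtains I P where "finite I" "E \<subseteq> free_on I" "mod_hom UNIV E P" "\<And>x. x \<in> E \<Longrightarrow> P x = x"
proof -
  obtain I F where I: "finite I" "fmod.subspace E" "fmod.subspace F"
     "{x + y | x y. x \<in> E \<and> y \<in> F} = free_on I" "E \<inter> F = {0}"
    using assms unfolding finite_projective_def by (elim exE conjE) (rule that)
  define R :: "(nat \<Rightarrow> 'a) \<Rightarrow> nat \<Rightarrow> 'a" where "R v = (\<lambda>i. if i \<in> I then v i else 0)" for v
  have "\<exists>x\<in>E. R v - x \<in> F" for v
  proof -
    have "R v \<in> {x + y | x y. x \<in> E \<and> y \<in> F}" unfolding I(4) by (auto simp: R_def free_on_def)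
    then obtain x y where "R v = x + y" "x \<in> E" "y \<in> F" by blast
    thus ?thesis by (intro bexI[of _ x]) auto
  qed
  then obtain P where P: "P v \<in> E" "R v - P v \<in> F" for v by metis
  have uniq: "P v = x" if "x \<in> E" "R v - x \<in> F" for v x
  proof -
    have "P v - x \<in> E" using that P(1) I(2) by (auto intro: fmod.subspace_diff)
    moreover have "(R v - x) - (R v - P v) \<in> F" using that P(2) I(3) by (metis fmod.subspace_diff)
    hence "P v - x \<in> F" by simp
    ultimately have "P v - x = 0" using I(5) by blast
    thus ?thesis by simp
  qed
  have sub: "E \<subseteq> free_on I"
  proof
    fix x assume "x \<in> E"
    hence "x + 0 \<in> {x + y | x y. x \<in> E \<and> y \<in> F}" using fmod.subspace_0[OF I(3)] by blast
    thus "x \<in> free_on I" using I(4) by simp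
  qed
  have "mod_hom UNIV E P"
    unfolding mod_hom_def
  proof (intro conjI ballI allI)
    fix v w
    have "R (v + w) - (P v + P w) = (R v - P v) + (R w - P w)"
      by (auto simp: R_def fun_eq_iff)
    moreover have "(R v - P v) + (R w - P w) \<in> F" using P(2) fmod.subspace_add[OF I(3)] by blast
    ultimately have "R (v + w) - (P v + P w) \<in> F" by (simp only:)
    thus "P (v + w) = P v + P w"
      using P(1) by (intro uniq fmod.subspace_add[OF I(2)])
  next
    fix v c
    have "R (fscale c v) - fscale c (P v) = fscale c (R v - P v)"
      by (auto simp: R_def fscale_def fun_eq_iff algebra_simps)
    moreover have "fscale c (R v - P v) \<in> F" using P(2) fmod.subspace_scale[OF I(3)] by blast
    ultimately have "R (fscale c v) - fscale c (P v) \<in> F" by (simp only:)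
    thus "P (fscale c v) = fscale c (P v)"
      using P(1) by (intro uniq fmod.subspace_scale[OF I(2)])
  qed (use P in auto)
  moreover have "P x = x" if "x \<in> E" for x
  proof (rule uniq)
    have "R x = x" using that sub by (auto simp: R_def free_on_def fun_eq_iff)
    thus "R x - x \<in> F" using fmod.subspace_0[OF I(3)] by simp
  qed fact
  ultimately show ?thesis using that I sub by blast
qed

lemma finite_projectiveI:
  assumes "finite I" "E \<subseteq> free_on I" and P: "mod_hom UNIV E P" "\<And>x. x \<in> E \<Longrightarrow> P x = x"
  shows "finite_projective E"
proof -
  have P0: "P 0 = 0" using mod_homD(3)[OF P(1), of 0 0] by simp
  have sE: "fmod.subspace E"
  proof (rule fmod.subspaceI)
    show "0 \<in> E" using mod_homD(1)[OF P(1), of 0] P0 by simp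
    show "x + y \<in> E" if "x \<in> E" "y \<in> E" for x y
      using mod_homD(1)[OF P(1), of "x + y"] mod_homD(2)[OF P(1), of x y] P(2) that by simp
    show "fscale c x \<in> E" if "x \<in> E" for x c
      using mod_homD(1)[OF P(1), of "fscale c x"] mod_homD(3)[OF P(1), of x c] P(2) that by simp
  qed
  have sI: "fmod.subspace (free_on I)"
    by (rule fmod.subspaceI) (auto simp: free_on_def fscale_def)
  define F where "F = {v \<in> free_on I. P v = 0}"
  have sF: "fmod.subspace F"
    using sI P0 mod_homD(2,3)[OF P(1)]
    by (auto simp: F_def intro!: fmod.subspaceI
        intro: fmod.subspace_add fmod.subspace_scale fmod.subspace_0)
  have "v \<in> {x + y | x y. x \<in> E \<and> y \<in> F}" if "v \<in> free_on I" for v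
  proof -
    have "P (v - P v) + P (P v) = P v"
      using mod_homD(2)[OF P(1), of "v - P v" "P v"] by simp
    moreover have "P (P v) = P v" using P by (auto simp: mod_hom_def)
    ultimately have "P (v - P v) = 0" by simp
    moreover have "P v \<in> E" using P by (auto simp: mod_hom_def)
    ultimately have "v - P v \<in> F" using assms(2) that
      by (auto simp: F_def intro!: fmod.subspace_diff[OF sI])
    moreover have "v = P v + (v - P v)" by simp
    ultimately show ?thesis using \<open>P v \<in> E\<close> by blast
  qed
  moreover have "x + y \<in> free_on I" if "x \<in> E" "y \<in> F" for x y
    using that assms(2) by (auto simp: F_def intro!: fmod.subspace_add[OF sI])
  ultimately have "{x + y | x y. x \<in> E \<and> y \<in> F} = free_on I" by blast
  moreover have "E \<inter> F = {0}"
    using P(2) P0 fmod.subspace_0[OF sE] fmod.subspace_0[OF sF] by (auto simp: F_def)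
  ultimately show ?thesis unfolding finite_projective_def using assms(1) sE sF by blast
qed

lemma mod_hom_funpow: "mod_hom E E f \<Longrightarrow> mod_hom E E (f ^^ n)"
  by (induction n) (auto simp: mod_hom_def image_subset_iff)

lift_definition endo_power :: "nat \<Rightarrow> 'a::comm_ring_1 endo \<Rightarrow> 'a endo"
  is "\<lambda>n (E, f). (E, f ^^ n)"
  by (auto intro: mod_hom_funpow)

text \<open>
  \<open>E\<^sup>n\<close> is realised inside \<^typ>\<open>nat \<Rightarrow> 'a\<close> through the pairing function: the component
  \<open>\<xi>\<^sub>j\<close> of \<open>\<xi>\<close> is \<open>block j \<xi>\<close>, where components are numbered \<open>0, \<dots>, n - 1\<close>.
\<close>

definition block :: "nat \<Rightarrow> (nat \<Rightarrow> 'a) \<Rightarrow> nat \<Rightarrow> 'a" where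
  "block j v = (\<lambda>i. v (prod_encode (j, i)))"

definition from_blocks :: "(nat \<Rightarrow> nat \<Rightarrow> 'a) \<Rightarrow> nat \<Rightarrow> 'a" where
  "from_blocks w = (\<lambda>k. case prod_decode k of (j, i) \<Rightarrow> w j i)"

lemma block_from_blocks [simp]: "block j (from_blocks w) = w j"
  by (simp add: block_def from_blocks_def)

lemma blocks_eqI: "(\<And>j. block j v = block j w) \<Longrightarrow> v = w"
  by (metis (no_types, lifting) block_def ext prod_decode_inverse surj_pair)

lemma block_linear [simp]:
  "block j (v + w) = block j v + block j w" "block j (fscale c v) = fscale c (block j v)"
  "block j 0 = 0"
  by (auto simp: block_def fscale_def)

definition dirsum_mod :: "nat \<Rightarrow> (nat \<Rightarrow> 'a::comm_ring_1) set \<Rightarrow> (nat \<Rightarrow> 'a) set" where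
  "dirsum_mod n E = {\<xi>. (\<forall>j<n. block j \<xi> \<in> E) \<and> (\<forall>j\<ge>n. block j \<xi> = 0)}"

definition shift_map ::
    "nat \<Rightarrow> ((nat \<Rightarrow> 'a::comm_ring_1) \<Rightarrow> nat \<Rightarrow> 'a) \<Rightarrow> (nat \<Rightarrow> 'a) \<Rightarrow> nat \<Rightarrow> 'a" where
  "shift_map n f \<xi> = from_blocks (\<lambda>j.
     if j \<ge> n then 0 else if j = 0 then f (block (n - 1) \<xi>) else block (j - 1) \<xi>)"

lemma free_on_blocks:
  assumes "\<And>j. j \<in> J \<Longrightarrow> block j v \<in> free_on I" "\<And>j. j \<notin> J \<Longrightarrow> block j v = 0"
  shows "v \<in> free_on (prod_encode ` (J \<times> I))"
proof -
  have "v k = 0" if "k \<notin> prod_encode ` (J \<times> I)" for k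
  proof -
    obtain j i where k: "k = prod_encode (j, i)" by (metis prod_decode_inverse surj_pair)
    hence ji: "j \<notin> J \<or> i \<notin> I" using that by auto
    have "v k = block j v i" by (simp add: k block_def)
    also have "\<dots> = 0" using ji assms[of j] by (cases "j \<in> J") (auto simp: free_on_def)
    finally show ?thesis .
  qed
  thus ?thesis by (auto simp: free_on_def)
qed

lemma finite_projective_dirsum:
  fixes E :: "(nat \<Rightarrow> 'a::comm_ring_1) set"
  assumes E: "finite_projective E"
  shows "finite_projective (dirsum_mod n E)"
proof -
  obtain I P where I: "finite I" "E \<subseteq> free_on I" "mod_hom UNIV E P" "\<And>x. x \<in> E \<Longrightarrow> P x = x"
    using finite_projectiveE[OF E] by metis
  show ?thesis
  proof (rule finite_projectiveI)
    show "finite (prod_encode ` ({..<n} \<times> I))" using I(1) by auto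
    show "dirsum_mod n E \<subseteq> free_on (prod_encode ` ({..<n} \<times> I))"
      using I(2) by (auto intro!: free_on_blocks simp: dirsum_mod_def)
    let ?P = "\<lambda>v. from_blocks (\<lambda>j. if j < n then P (block j v) else 0)"
    show "mod_hom UNIV (dirsum_mod n E) ?P"
      unfolding mod_hom_def
    proof (intro conjI ballI allI)
      show "range ?P \<subseteq> dirsum_mod n E" using I(3) by (auto simp: dirsum_mod_def mod_hom_def)
    qed (rule blocks_eqI, simp add: mod_homD(2,3)[OF I(3)])+
    show "?P x = x" if "x \<in> dirsum_mod n E" for x
      by (rule blocks_eqI) (use that I(4) in \<open>auto simp: dirsum_mod_def\<close>)
  qed
qed

lemma mod_hom_shift:
  assumes f: "mod_hom E E f"
  shows "mod_hom (dirsum_mod n E) (dirsum_mod n E) (shift_map n f)"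
  unfolding mod_hom_def
proof (intro conjI ballI allI)
  show "shift_map n f ` dirsum_mod n E \<subseteq> dirsum_mod n E"
    using mod_homD(1)[OF f] by (auto simp: shift_map_def dirsum_mod_def)
next
  fix x y assume xy: "x \<in> dirsum_mod n E" "y \<in> dirsum_mod n E"
  show "shift_map n f (x + y) = shift_map n f x + shift_map n f y"
  proof (rule blocks_eqI)
    fix j
    show "block j (shift_map n f (x + y)) = block j (shift_map n f x + shift_map n f y)"
      using xy mod_homD(2)[OF f, of "block (n - 1) x" "block (n - 1) y"]
      by (cases "j < n") (auto simp: shift_map_def dirsum_mod_def)
  qed
next
  fix c x assume x: "x \<in> dirsum_mod n E"
  show "shift_map n f (fscale c x) = fscale c (shift_map n f x)"
  proof (rule blocks_eqI)
    fix j
    show "block j (shift_map n f (fscale c x)) = block j (fscale c (shift_map n f x))"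
      using x mod_homD(3)[OF f, of "block (n - 1) x" c]
      by (cases "j < n") (auto simp: shift_map_def dirsum_mod_def, simp add: fscale_def)
  qed
qed

lift_definition endo_shift :: "nat \<Rightarrow> 'a::comm_ring_1 endo \<Rightarrow> 'a endo"
  is "\<lambda>n (E, f). (dirsum_mod n E, shift_map n f)"
  by (auto intro: finite_projective_dirsum mod_hom_shift)

text \<open>
  The tensor product of submodules of \<open>A\<^sup>I\<close> and \<open>A\<^sup>J\<close> that are direct summands is the submodule of
  \<open>A\<^bsup>I \<times> J\<^esup>\<close> spanned by the pure tensors \<open>(x \<otimes> y)\<^sub>i\<^sub>j = x\<^sub>i y\<^sub>j\<close>. The map \<open>f \<otimes> g\<close> is described by its
  action on an arbitrary \<open>t\<close> in that span: apply \<open>g\<close> to all rows, then \<open>f\<close> to all columns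
  (see the lemma \<open>tensor_map_pure\<close>).
\<close>

definition pure_tensor :: "(nat \<Rightarrow> 'a::comm_ring_1) \<Rightarrow> (nat \<Rightarrow> 'a) \<Rightarrow> nat \<Rightarrow> 'a" where
  "pure_tensor x y = from_blocks (\<lambda>i j. x i * y j)"

definition tensor_mod ::
    "(nat \<Rightarrow> 'a::comm_ring_1) set \<Rightarrow> (nat \<Rightarrow> 'a) set \<Rightarrow> (nat \<Rightarrow> 'a) set" where
  "tensor_mod E E' = fmod.span {pure_tensor x y | x y. x \<in> E \<and> y \<in> E'}"

definition tensor_map ::
    "((nat \<Rightarrow> 'a::comm_ring_1) \<Rightarrow> nat \<Rightarrow> 'a) \<Rightarrow> ((nat \<Rightarrow> 'a) \<Rightarrow> nat \<Rightarrow> 'a) \<Rightarrow> (nat \<Rightarrow> 'a) \<Rightarrow> nat \<Rightarrow> 'a"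
  where "tensor_map f g t = from_blocks (\<lambda>i j. f (\<lambda>i'. g (block i' t) j) i)"

lemma block_pure_tensor: "block i (pure_tensor x y) = fscale (x i) y"
  by (simp add: pure_tensor_def fscale_def)

lemma tensor_map_pure:
  assumes "mod_hom E E1 f" "mod_hom E' E2 g" "x \<in> E" "y \<in> E'"
  shows "tensor_map f g (pure_tensor x y) = pure_tensor (f x) (g y)"
proof (rule blocks_eqI, rule ext)
  fix i j
  have "(\<lambda>i'. g (block i' (pure_tensor x y)) j) = fscale (g y j) x"
    using mod_homD(3)[OF assms(2,4)] by (auto simp: block_pure_tensor fscale_def mult.commute)
  thus "block i (tensor_map f g (pure_tensor x y)) j = block i (pure_tensor (f x) (g y)) j"
    using mod_homD(3)[OF assms(1,3)]
    by (simp add: tensor_map_def block_pure_tensor) (simp add: fscale_def mult.commute)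
qed

lemma tensor_mod_sections:
  assumes E: "fmod.subspace E" and E': "fmod.subspace E'" and g: "mod_hom E' E2 g"
    and t: "t \<in> tensor_mod E E'"
  shows "block i t \<in> E'" "(\<lambda>i'. g (block i' t) j) \<in> E"
proof -
  let ?Q = "\<lambda>t. (\<forall>i. block i t \<in> E') \<and> (\<forall>j. (\<lambda>i'. g (block i' t) j) \<in> E)"
  have g0: "g 0 = 0" using mod_homD(3)[OF g fmod.subspace_0[OF E'], of 0] by simp
  have "?Q t"
    using t unfolding tensor_mod_def
  proof (induction rule: fmod.span_induct_alt)
    case base
    have "(\<lambda>i'. 0::'a) \<in> E" using fmod.subspace_0[OF E] by (simp add: zero_fun_def)
    thus ?case using fmod.subspace_0[OF E'] g0 by (simp add: zero_fun_def block_def)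
  next
    case (step c p u)
    then obtain x y where p: "p = pure_tensor x y" "x \<in> E" "y \<in> E'" by auto
    have "(\<lambda>i'. g (block i' (fscale c p + u)) j) = fscale (c * g y j) x + (\<lambda>i'. g (block i' u) j)" for j
    proof
      fix i'
      have "block i' (fscale c p + u) = fscale (c * x i') y + block i' u"
        by (simp add: p(1) block_pure_tensor)
      moreover have "fscale (c * x i') y \<in> E'" "block i' u \<in> E'"
        using p E' step by (auto intro: fmod.subspace_scale)
      ultimately have "g (block i' (fscale c p + u)) = fscale (c * x i') (g y) + g (block i' u)"
        using mod_homD(2,3)[OF g] p(3) by simp
      thus "g (block i' (fscale c p + u)) j = (fscale (c * g y j) x + (\<lambda>i'. g (block i' u) j)) i'"
        by (simp add: fscale_def algebra_simps)
    qed
    moreover have "block i (fscale c p + u) \<in> E'" for i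
      using p E' step by (auto simp: block_pure_tensor intro!: fmod.subspace_add fmod.subspace_scale)
    moreover have "fscale (c * g y j) x + (\<lambda>i'. g (block i' u) j) \<in> E" for j
      using fmod.subspace_add[OF E fmod.subspace_scale[OF E p(2)]] step by blast
    ultimately have "?Q (fscale c p + u)" by (simp only: simp_thms)
    thus ?case .
  qed
  thus "block i t \<in> E'" "(\<lambda>i'. g (block i' t) j) \<in> E" by auto
qed

lemma tensor_map_hom:
  assumes E: "fmod.subspace E" and E': "fmod.subspace E'"
    and f: "mod_hom E E1 f" and g: "mod_hom E' E2 g"
  shows "mod_hom (tensor_mod E E') (tensor_mod E1 E2) (tensor_map f g)"
proof -
  note sec = tensor_mod_sections[OF E E' g]
  have add: "tensor_map f g (s + t) = tensor_map f g s + tensor_map f g t"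
    if st: "s \<in> tensor_mod E E'" "t \<in> tensor_mod E E'" for s t
  proof (rule blocks_eqI, rule ext)
    fix i j
    have "(\<lambda>i'. g (block i' (s + t)) j) = (\<lambda>i'. g (block i' s) j) + (\<lambda>i'. g (block i' t) j)"
      using mod_homD(2)[OF g sec(1)[OF st(1)] sec(1)[OF st(2)]] by (auto simp: fun_eq_iff)
    thus "block i (tensor_map f g (s + t)) j = block i (tensor_map f g s + tensor_map f g t) j"
      using mod_homD(2)[OF f sec(2)[OF st(1)] sec(2)[OF st(2)]] by (simp add: tensor_map_def)
  qed
  have scale: "tensor_map f g (fscale c t) = fscale c (tensor_map f g t)"
    if t: "t \<in> tensor_mod E E'" for c t
  proof (rule blocks_eqI, rule ext)
    fix i j
    have "(\<lambda>i'. g (block i' (fscale c t)) j) = fscale c (\<lambda>i'. g (block i' t) j)"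
      using mod_homD(3)[OF g sec(1)[OF t]] by (auto simp: fun_eq_iff fscale_def[of c "g _"] fscale_def[of c "\<lambda>i'. g (block i' t) j"])
    thus "block i (tensor_map f g (fscale c t)) j = block i (fscale c (tensor_map f g t)) j"
      using mod_homD(3)[OF f sec(2)[OF t]] by (simp add: tensor_map_def) (simp add: fscale_def)
  qed
  have "t \<in> tensor_mod E E' \<and> tensor_map f g t \<in> tensor_mod E1 E2"
    if t: "t \<in> tensor_mod E E'" for t
    using t[unfolded tensor_mod_def]
  proof (induction rule: fmod.span_induct_alt)
    case base
    have "tensor_map f g (fscale 0 0) = fscale 0 (tensor_map f g 0)"
      by (rule scale) (simp add: tensor_mod_def fmod.span_zero)
    thus ?case by (simp add: tensor_mod_def fmod.span_zero flip: zero_fun_def)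
  next
    case (step c p u)
    then obtain x y where p: "p = pure_tensor x y" "x \<in> E" "y \<in> E'" by auto
    have pT: "p \<in> tensor_mod E E'" using step(1) by (simp add: tensor_mod_def fmod.span_base)
    hence cp: "fscale c p \<in> tensor_mod E E'" by (simp add: tensor_mod_def fmod.span_scale)
    have u: "u \<in> tensor_mod E E'" "tensor_map f g u \<in> tensor_mod E1 E2" using step by auto
    have eq: "tensor_map f g (fscale c p + u) =
        fscale c (pure_tensor (f x) (g y)) + tensor_map f g u"
      using add[OF cp u(1)] scale[OF pT] tensor_map_pure[OF f g p(2,3)] by (simp add: p(1))
    have "pure_tensor (f x) (g y) \<in> {pure_tensor x y | x y. x \<in> E1 \<and> y \<in> E2}"
      using p mod_homD(1)[OF f] mod_homD(1)[OF g] by blast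
    hence "pure_tensor (f x) (g y) \<in> tensor_mod E1 E2"
      by (simp add: tensor_mod_def fmod.span_base)
    thus ?case using cp u unfolding eq tensor_mod_def
      by (intro conjI fmod.span_add) (assumption | rule fmod.span_scale)+
  qed
  thus ?thesis using add scale by (auto simp: mod_hom_def)
qed

lemma finite_projective_tensor:
  fixes E E' :: "(nat \<Rightarrow> 'a::comm_ring_1) set"
  assumes E: "finite_projective E" and E': "finite_projective E'"
  shows "finite_projective (tensor_mod E E')"
proof -
  obtain I P where I: "finite I" "E \<subseteq> free_on I" "mod_hom UNIV E P" "\<And>x. x \<in> E \<Longrightarrow> P x = x"
    using finite_projectiveE[OF E] by metis
  obtain J Q where J: "finite J" "E' \<subseteq> free_on J" "mod_hom UNIV E' Q" "\<And>x. x \<in> E' \<Longrightarrow> Q x = x"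
    using finite_projectiveE[OF E'] by metis
  define \<delta> :: "nat \<Rightarrow> nat \<Rightarrow> 'a" where "\<delta> k = (\<lambda>l. if l = k then 1 else 0)" for k
  let ?IJ = "prod_encode ` (I \<times> J)"
  have fin: "finite ?IJ" using I(1) J(1) by simp
  define R :: "(nat \<Rightarrow> 'a) \<Rightarrow> nat \<Rightarrow> 'a" where "R v = (\<lambda>k. if k \<in> ?IJ then v k else 0)" for v
  have sum_app: "(\<Sum>k\<in>A. h k) l = (\<Sum>k\<in>A. h k l)"
    for A and h :: "nat \<Rightarrow> nat \<Rightarrow> 'a" and l
    by (induction A rule: infinite_finite_induct) auto
  have R: "R v \<in> tensor_mod UNIV UNIV" for v
  proof -
    have "R v = (\<Sum>k\<in>?IJ. fscale (v k) (\<delta> k))"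
    proof
      fix l
      have "(\<Sum>k\<in>?IJ. fscale (v k) (\<delta> k)) l = (\<Sum>k\<in>?IJ. if l = k then v k else 0)"
        unfolding sum_app by (rule sum.cong) (auto simp: fscale_def \<delta>_def)
      also have "\<dots> = R v l" unfolding R_def by (rule sum.delta'[OF fin])
      finally show "R v l = (\<Sum>k\<in>?IJ. fscale (v k) (\<delta> k)) l" by simp
    qed
    moreover have "\<delta> k \<in> tensor_mod UNIV UNIV" for k
    proof -
      obtain i j where k: "k = prod_encode (i, j)" by (metis prod_decode_inverse surj_pair)
      have "\<delta> k = pure_tensor (\<delta> i) (\<delta> j)"
      proof (rule blocks_eqI, rule ext)
        fix i' j'
        show "block i' (\<delta> k) j' = block i' (pure_tensor (\<delta> i) (\<delta> j)) j'"
          unfolding block_pure_tensor by (simp add: block_def k \<delta>_def fscale_def)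
      qed
      thus ?thesis by (auto simp: tensor_mod_def intro!: fmod.span_base)
    qed
    hence "(\<Sum>k\<in>?IJ. fscale (v k) (\<delta> k)) \<in> tensor_mod UNIV UNIV"
      unfolding tensor_mod_def by (intro fmod.span_sum fmod.span_scale)
    ultimately show ?thesis by (simp only:)
  qed
  have RR: "R (v + w) = R v + R w" "R (fscale c v) = fscale c (R v)" for v w c
    by (auto simp: R_def fscale_def fun_eq_iff)
  have T: "mod_hom (tensor_mod UNIV UNIV) (tensor_mod E E') (tensor_map P Q)"
    using I J by (intro tensor_map_hom) auto
  have sub: "t \<in> free_on ?IJ" if "t \<in> tensor_mod E E'" for t
    using that unfolding tensor_mod_def
  proof (induction rule: fmod.span_induct_alt)
    case (step c p u)
    then obtain x y where p: "p = pure_tensor x y" "x \<in> E" "y \<in> E'" by auto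
    have xy: "x \<in> free_on I" "y \<in> free_on J" using p I J by auto
    have "p \<in> free_on ?IJ"
      unfolding p(1)
    proof (rule free_on_blocks)
      show "block j (pure_tensor x y) \<in> free_on J" for j
        using xy by (simp add: block_pure_tensor) (simp add: free_on_def fscale_def)
      show "block j (pure_tensor x y) = 0" if "j \<notin> I" for j
        using xy that by (simp add: block_pure_tensor free_on_def)
    qed
    thus ?case using step by (auto simp: free_on_def fscale_def)
  qed (auto simp: free_on_def)
  have fixed: "t \<in> tensor_mod UNIV UNIV \<and> tensor_map P Q t = t" if "t \<in> tensor_mod E E'" for t
    using that[unfolded tensor_mod_def]
  proof (induction rule: fmod.span_induct_alt)
    case base
    have "0 \<in> tensor_mod (UNIV :: (nat \<Rightarrow> 'a) set) UNIV"
      by (simp add: tensor_mod_def fmod.span_zero)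
    thus ?case using mod_homD(3)[OF T, of 0 0] by (simp flip: zero_fun_def)
  next
    case (step c p u)
    then obtain x y where p: "p = pure_tensor x y" "x \<in> E" "y \<in> E'" by auto
    have pT: "p \<in> tensor_mod UNIV UNIV"
      by (auto simp: p tensor_mod_def intro!: fmod.span_base)
    hence cp: "fscale c p \<in> tensor_mod UNIV UNIV" by (simp add: tensor_mod_def fmod.span_scale)
    have u: "u \<in> tensor_mod UNIV UNIV" "tensor_map P Q u = u" using step by auto
    have "tensor_map P Q p = p"
      using tensor_map_pure[OF I(3) J(3), of x y] I(4) J(4) p by simp
    hence "tensor_map P Q (fscale c p + u) = fscale c p + u"
      using mod_homD(2)[OF T cp u(1)] mod_homD(3)[OF T pT] u(2) by simp
    moreover have "fscale c p + u \<in> tensor_mod UNIV UNIV"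
      using cp u unfolding tensor_mod_def by (intro fmod.span_add)
    ultimately show ?case by blast
  qed
  show ?thesis
  proof (rule finite_projectiveI[OF fin])
    show "tensor_mod E E' \<subseteq> free_on ?IJ" using sub by blast
    show "mod_hom UNIV (tensor_mod E E') (\<lambda>v. tensor_map P Q (R v))"
      using mod_homD(1,3)[OF T R] mod_homD(2)[OF T R R] by (auto simp: mod_hom_def RR)
    show "tensor_map P Q (R t) = t" if t: "t \<in> tensor_mod E E'" for t
    proof -
      have "R t = t" using sub[OF t] by (auto simp: R_def free_on_def fun_eq_iff)
      thus ?thesis using fixed[OF t] by simp
    qed
  qed
qed

lift_definition endo_tensor :: "'a::comm_ring_1 endo \<Rightarrow> 'a endo \<Rightarrow> 'a endo"
  is "\<lambda>(E, f) (E', f'). (tensor_mod E E', tensor_map f f')"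
  by (auto intro: finite_projective_tensor tensor_map_hom finite_projective_subspace)


section \<open>The rings \<open>K\<^sub>0\<close> and \<open>W\<^sub>0\<close>\<close>

inductive_set subgroup_generated :: "'g::ab_group_add set \<Rightarrow> 'g set" for S where
  zero: "0 \<in> subgroup_generated S"
| base: "x \<in> S \<Longrightarrow> x \<in> subgroup_generated S"
| diff: "x \<in> subgroup_generated S \<Longrightarrow> y \<in> subgroup_generated S \<Longrightarrow> x - y \<in> subgroup_generated S"

lemma subgroup_generated_uminus: "x \<in> subgroup_generated S \<Longrightarrow> - x \<in> subgroup_generated S"
  using subgroup_generated.diff[OF subgroup_generated.zero, of x S] by simp

lemma subgroup_generated_add:
  "x \<in> subgroup_generated S \<Longrightarrow> y \<in> subgroup_generated S \<Longrightarrow> x + y \<in> subgroup_generated S"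
  using subgroup_generated.diff[of x S "- y"] subgroup_generated_uminus[of y S] by simp

lemma equivp_subgroup_generated: "equivp (\<lambda>x y. x - y \<in> subgroup_generated S)"
proof (intro equivpI reflpI sympI transpI)
  show "x - x \<in> subgroup_generated S" for x by (simp add: subgroup_generated.zero)
  show "y - x \<in> subgroup_generated S" if "x - y \<in> subgroup_generated S" for x y
    using subgroup_generated_uminus[OF that] by simp
  show "x - z \<in> subgroup_generated S"
    if "x - y \<in> subgroup_generated S" "y - z \<in> subgroup_generated S" for x y z
    using subgroup_generated_add[OF that] by simp
qed

text \<open>
  \<open>K\<^sub>0\<close> is taken with respect to all short exact sequences of pairs, not only the split ones; in
  particular isomorphic pairs are identified and direct sum becomes addition.
\<close>

definition K0_relators :: "('a::comm_ring_1 endo \<Rightarrow>\<^sub>0 int) set" where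
  "K0_relators = {frag_of Y - frag_of X - frag_of Z | X Y Z. short_exact X Y Z}"

quotient_type (overloaded) 'a K0_End = "'a::comm_ring_1 endo \<Rightarrow>\<^sub>0 int" /
    "\<lambda>x y. x - y \<in> subgroup_generated K0_relators"
  by (rule equivp_subgroup_generated)

text \<open>
  The tensor product is exact in both arguments, hence the product of two classes can be computed
  on arbitrary representatives, as is done here (\<open>rep_K0_End\<close> chooses one). The same applies to the
  other operations on \<open>K\<^sub>0\<close> and \<open>W\<^sub>0\<close> below.
\<close>

instantiation K0_End :: (comm_ring_1) "{ab_group_add, times}"
begin

lift_definition zero_K0_End :: "'a K0_End" is 0 .

lift_definition plus_K0_End :: "'a K0_End \<Rightarrow> 'a K0_End \<Rightarrow> 'a K0_End" is "(+)"
  by (drule (1) subgroup_generated_add) (simp add: algebra_simps)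

lift_definition minus_K0_End :: "'a K0_End \<Rightarrow> 'a K0_End \<Rightarrow> 'a K0_End" is "(-)"
  by (drule (1) subgroup_generated.diff) (simp add: algebra_simps)

lift_definition uminus_K0_End :: "'a K0_End \<Rightarrow> 'a K0_End" is uminus
  by (drule subgroup_generated_uminus) (simp add: algebra_simps)

definition times_K0_End :: "'a K0_End \<Rightarrow> 'a K0_End \<Rightarrow> 'a K0_End" where
  "x * y = abs_K0_End (frag_extend
     (\<lambda>X. frag_extend (\<lambda>Y. frag_of (endo_tensor X Y)) (rep_K0_End y)) (rep_K0_End x))"

instance
  by standard (transfer; simp add: algebra_simps subgroup_generated.zero)+

end

definition K0_class :: "'a::comm_ring_1 endo \<Rightarrow> 'a K0_End" where
  "K0_class X = abs_K0_End (frag_of X)"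

inductive_set K0_ideal :: "'a::comm_ring_1 K0_End set" where
  zero: "0 \<in> K0_ideal"
| base: "(\<And>v. v \<in> endo_mod X \<Longrightarrow> endo_map X v = 0) \<Longrightarrow> K0_class X \<in> K0_ideal"
| diff: "x \<in> K0_ideal \<Longrightarrow> y \<in> K0_ideal \<Longrightarrow> x - y \<in> K0_ideal"
| mult: "x \<in> K0_ideal \<Longrightarrow> a * x \<in> K0_ideal"

lemma subgroup_generated_K0_ideal: "subgroup_generated K0_ideal = K0_ideal"
proof (intro equalityI subsetI)
  show "x \<in> K0_ideal" if "x \<in> subgroup_generated K0_ideal" for x :: "'a K0_End"
    using that by induction (auto intro: K0_ideal.zero K0_ideal.diff)
qed (rule subgroup_generated.base)

lemmas K0_ideal_add = subgroup_generated_add[of _ K0_ideal, unfolded subgroup_generated_K0_ideal]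
lemmas K0_ideal_uminus = subgroup_generated_uminus[of _ K0_ideal, unfolded subgroup_generated_K0_ideal]

quotient_type (overloaded) 'a W0 = "'a::comm_ring_1 K0_End" / "\<lambda>x y. x - y \<in> K0_ideal"
  using equivp_subgroup_generated[of K0_ideal] by (simp add: subgroup_generated_K0_ideal)

instantiation W0 :: (comm_ring_1) "{ab_group_add, times}"
begin

lift_definition zero_W0 :: "'a W0" is 0 .

lift_definition plus_W0 :: "'a W0 \<Rightarrow> 'a W0 \<Rightarrow> 'a W0" is "(+)"
  by (drule (1) K0_ideal_add) (simp add: algebra_simps)

lift_definition minus_W0 :: "'a W0 \<Rightarrow> 'a W0 \<Rightarrow> 'a W0" is "(-)"
  by (drule (1) K0_ideal.diff) (simp add: algebra_simps)

lift_definition uminus_W0 :: "'a W0 \<Rightarrow> 'a W0" is uminus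
  by (drule K0_ideal_uminus) (simp add: algebra_simps)

definition times_W0 :: "'a W0 \<Rightarrow> 'a W0 \<Rightarrow> 'a W0" where
  "x * y = abs_W0 (rep_W0 x * rep_W0 y)"

instance
  by standard (transfer; simp add: algebra_simps K0_ideal.zero)+

end

text \<open>The additive map on \<open>W\<^sub>0\<close> induced by an operation on pairs.\<close>

definition W0_extend :: "('a::comm_ring_1 endo \<Rightarrow> 'a endo) \<Rightarrow> 'a W0 \<Rightarrow> 'a W0" where
  "W0_extend \<phi> x =
     abs_W0 (abs_K0_End (frag_extend (\<lambda>X. frag_of (\<phi> X)) (rep_K0_End (rep_W0 x))))"

definition W0_F :: "nat \<Rightarrow> 'a::comm_ring_1 W0 \<Rightarrow> 'a W0" where
  "W0_F n = W0_extend (endo_power n)"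

definition W0_V :: "nat \<Rightarrow> 'a::comm_ring_1 W0 \<Rightarrow> 'a W0" where
  "W0_V n = W0_extend (endo_shift n)"


section \<open>The group ring of \<open>\<rat>/\<int>\<close>\<close>

quotient_type qmodz = rat / "\<lambda>x y. x - y \<in> \<int>"
proof (intro equivpI reflpI sympI transpI)
  show "y - x \<in> \<int>" if "x - y \<in> \<int>" for x y :: rat
    using Ints_minus[OF that] by simp
  show "x - z \<in> \<int>" if "x - y \<in> \<int>" "y - z \<in> \<int>" for x y z :: rat
    using Ints_add[OF that] by simp
qed auto

instantiation qmodz :: ab_group_add
begin

lift_definition zero_qmodz :: qmodz is 0 .

lift_definition plus_qmodz :: "qmodz \<Rightarrow> qmodz \<Rightarrow> qmodz" is "(+)"
  by (drule (1) Ints_add) (simp add: algebra_simps)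

lift_definition minus_qmodz :: "qmodz \<Rightarrow> qmodz \<Rightarrow> qmodz" is "(-)"
  by (drule (1) Ints_diff) (simp add: algebra_simps)

lift_definition uminus_qmodz :: "qmodz \<Rightarrow> qmodz" is uminus
  by (drule Ints_minus) (simp add: algebra_simps)

instance
  by standard (transfer; simp add: algebra_simps)+

end

lift_definition qmodz_scale :: "nat \<Rightarrow> qmodz \<Rightarrow> qmodz" is "\<lambda>n x. of_nat n * x"
  by (metis Ints_mult Ints_of_nat right_diff_distrib)

text \<open>
  The product of \<^typ>\<open>qmodz \<Rightarrow>\<^sub>0 int\<close> is convolution, so this type is the group ring of \<open>\<rat>/\<int>\<close>.
  The group ring of a subgroup is the subring of the elements supported on it.
\<close>

type_synonym group_ring = "qmodz \<Rightarrow>\<^sub>0 int"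

abbreviation group_elem :: "qmodz \<Rightarrow> group_ring" where
  "group_elem \<gamma> \<equiv> Poly_Mapping.single \<gamma> 1"

definition prime_to :: "nat \<Rightarrow> qmodz set" where
  "prime_to p = {abs_qmodz (of_int a / of_int b) | a b. b > 0 \<and> coprime b (int p)}"

definition primary_part :: "nat \<Rightarrow> qmodz set" where
  "primary_part p = {\<gamma>. \<exists>k. qmodz_scale (p ^ k) \<gamma> = 0}"

text \<open>For prime \<open>p\<close>, \<open>\<rat>/\<int>\<close> is the direct sum of \<open>prime_to p\<close> and \<open>primary_part p\<close>, the latter being
  the copy of \<open>\<rat>\<^sub>p/\<int>\<^sub>p\<close> in \<open>\<rat>/\<int>\<close>.\<close>

definition proj_prime_to :: "nat \<Rightarrow> qmodz \<Rightarrow> qmodz" where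
  "proj_prime_to p \<gamma> = (THE \<gamma>'. \<gamma>' \<in> prime_to p \<and> \<gamma> - \<gamma>' \<in> primary_part p)"

definition restrict_prime_to :: "nat \<Rightarrow> group_ring \<Rightarrow> group_ring" where
  "restrict_prime_to p = frag_extend (\<lambda>\<gamma>. group_elem (proj_prime_to p \<gamma>))"

definition bc_sigma :: "nat \<Rightarrow> group_ring \<Rightarrow> group_ring" where
  "bc_sigma n = frag_extend (\<lambda>\<gamma>. group_elem (qmodz_scale n \<gamma>))"

definition bc_rho :: "nat \<Rightarrow> group_ring \<Rightarrow> group_ring" where
  "bc_rho n = frag_extend (\<lambda>\<gamma>. \<Sum>\<gamma>' \<in> {\<gamma>'. qmodz_scale n \<gamma>' = \<gamma>}. group_elem \<gamma>')"


section \<open>The integral BC-algebra\<close>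

text \<open>
  The ring with the given generators and relations: ring expressions in the generators modulo the
  least congruence containing the ring axioms and the relations. The constructor \<open>BC_Inj\<close> adjoins
  the ring \<open>\<int>[\<rat>/\<int>]\<close>, whose zero and unit also serve as those of the big ring. The generators
  \<open>BC_Mu n\<close> (for \<open>\<mu>\<close>-tilde) and \<open>BC_Mus n\<close> (for \<open>\<mu>\<close>-star) are meant for positive \<open>n\<close> only;
  the superfluous ones with index \<open>0\<close> are set to zero.
\<close>

datatype bc_expr =
  BC_Inj group_ring | BC_Mu nat | BC_Mus nat
| BC_Add bc_expr bc_expr | BC_Neg bc_expr | BC_Mul bc_expr bc_expr

inductive bc_eq :: "bc_expr \<Rightarrow> bc_expr \<Rightarrow> bool" where
  refl: "bc_eq a a"
| sym: "bc_eq a b \<Longrightarrow> bc_eq b a"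
| trans: "bc_eq a b \<Longrightarrow> bc_eq b c \<Longrightarrow> bc_eq a c"
| cong_add: "bc_eq a a' \<Longrightarrow> bc_eq b b' \<Longrightarrow> bc_eq (BC_Add a b) (BC_Add a' b')"
| cong_neg: "bc_eq a a' \<Longrightarrow> bc_eq (BC_Neg a) (BC_Neg a')"
| cong_mul: "bc_eq a a' \<Longrightarrow> bc_eq b b' \<Longrightarrow> bc_eq (BC_Mul a b) (BC_Mul a' b')"
| add_assoc: "bc_eq (BC_Add (BC_Add a b) c) (BC_Add a (BC_Add b c))"
| add_commute: "bc_eq (BC_Add a b) (BC_Add b a)"
| add_zero: "bc_eq (BC_Add (BC_Inj 0) a) a"
| add_neg: "bc_eq (BC_Add (BC_Neg a) a) (BC_Inj 0)"
| mul_assoc: "bc_eq (BC_Mul (BC_Mul a b) c) (BC_Mul a (BC_Mul b c))"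
| mul_one_left: "bc_eq (BC_Mul (BC_Inj 1) a) a"
| mul_one_right: "bc_eq (BC_Mul a (BC_Inj 1)) a"
| distrib_left: "bc_eq (BC_Mul a (BC_Add b c)) (BC_Add (BC_Mul a b) (BC_Mul a c))"
| distrib_right: "bc_eq (BC_Mul (BC_Add a b) c) (BC_Add (BC_Mul a c) (BC_Mul b c))"
| inj_add: "bc_eq (BC_Inj (x + y)) (BC_Add (BC_Inj x) (BC_Inj y))"
| inj_mul: "bc_eq (BC_Inj (x * y)) (BC_Mul (BC_Inj x) (BC_Inj y))"
| mu_0: "bc_eq (BC_Mu 0) (BC_Inj 0)"
| mus_0: "bc_eq (BC_Mus 0) (BC_Inj 0)"
| mu_inj_mus: "n > 0 \<Longrightarrow>
    bc_eq (BC_Mul (BC_Mul (BC_Mu n) (BC_Inj x)) (BC_Mus n)) (BC_Inj (bc_rho n x))"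
| mus_inj: "n > 0 \<Longrightarrow>
    bc_eq (BC_Mul (BC_Mus n) (BC_Inj x)) (BC_Mul (BC_Inj (bc_sigma n x)) (BC_Mus n))"
| inj_mu: "n > 0 \<Longrightarrow>
    bc_eq (BC_Mul (BC_Inj x) (BC_Mu n)) (BC_Mul (BC_Mu n) (BC_Inj (bc_sigma n x)))"
| mu_mult: "n > 0 \<Longrightarrow> m > 0 \<Longrightarrow> bc_eq (BC_Mu (n * m)) (BC_Mul (BC_Mu n) (BC_Mu m))"
| mus_mult: "n > 0 \<Longrightarrow> m > 0 \<Longrightarrow> bc_eq (BC_Mus (n * m)) (BC_Mul (BC_Mus n) (BC_Mus m))"
| mus_mu: "n > 0 \<Longrightarrow> bc_eq (BC_Mul (BC_Mus n) (BC_Mu n)) (BC_Inj (of_nat n))"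
| mu_mus_commute: "n > 0 \<Longrightarrow> m > 0 \<Longrightarrow> gcd n m = 1 \<Longrightarrow>
    bc_eq (BC_Mul (BC_Mu n) (BC_Mus m)) (BC_Mul (BC_Mus m) (BC_Mu n))"

quotient_type bc_algebra = bc_expr / bc_eq
  by (intro equivpI reflpI sympI transpI) (blast intro: bc_eq.refl bc_eq.sym bc_eq.trans)+

instantiation bc_algebra :: "{ring, monoid_mult}"
begin

lift_definition zero_bc_algebra :: bc_algebra is "BC_Inj 0" .

lift_definition one_bc_algebra :: bc_algebra is "BC_Inj 1" .

lift_definition plus_bc_algebra :: "bc_algebra \<Rightarrow> bc_algebra \<Rightarrow> bc_algebra" is BC_Add
  by (rule bc_eq.cong_add)

lift_definition uminus_bc_algebra :: "bc_algebra \<Rightarrow> bc_algebra" is BC_Neg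
  by (rule bc_eq.cong_neg)

lift_definition times_bc_algebra :: "bc_algebra \<Rightarrow> bc_algebra \<Rightarrow> bc_algebra" is BC_Mul
  by (rule bc_eq.cong_mul)

definition minus_bc_algebra :: "bc_algebra \<Rightarrow> bc_algebra \<Rightarrow> bc_algebra" where
  "minus_bc_algebra a b = a + - b"

instance
proof
  fix a b c :: bc_algebra
  show "a + b + c = a + (b + c)" by transfer (rule bc_eq.add_assoc)
  show "a + b = b + a" by transfer (rule bc_eq.add_commute)
  show "0 + a = a" by transfer (rule bc_eq.add_zero)
  show "- a + a = 0" by transfer (rule bc_eq.add_neg)
  show "a - b = a + - b" by (rule minus_bc_algebra_def)
  show "a * b * c = a * (b * c)" by transfer (rule bc_eq.mul_assoc)
  show "1 * a = a" by transfer (rule bc_eq.mul_one_left)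
  show "a * 1 = a" by transfer (rule bc_eq.mul_one_right)
  show "a * (b + c) = a * b + a * c" by transfer (rule bc_eq.distrib_left)
  show "(a + b) * c = a * c + b * c" by transfer (rule bc_eq.distrib_right)
qed

end

lift_definition bc_inj :: "group_ring \<Rightarrow> bc_algebra" is BC_Inj .

lift_definition bc_mu :: "nat \<Rightarrow> bc_algebra" is BC_Mu .

lift_definition bc_mus :: "nat \<Rightarrow> bc_algebra" is BC_Mus .

text \<open>Unital ring homomorphisms to the ring of additive endomorphisms of an abelian group.\<close>

definition bc_representation :: "(bc_algebra \<Rightarrow> 'w::ab_group_add \<Rightarrow> 'w) \<Rightarrow> bool" where
  "bc_representation \<pi> \<longleftrightarrow>
     (\<forall>h. Modules.additive (\<pi> h)) \<and>
     (\<forall>g h. \<pi> (g + h) = (\<lambda>\<xi>. \<pi> g \<xi> + \<pi> h \<xi>)) \<and>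
     (\<forall>g h. \<pi> (g * h) = \<pi> g \<circ> \<pi> h) \<and>
     \<pi> 1 = id"


section \<open>Eigenvalues and the map from \<open>W\<^sub>0\<close> to the group ring\<close>

text \<open>The image of the integers is the prime field of \<^typ>\<open>'k\<close>, so the last clause says that every
  element is algebraic over it.\<close>

definition is_alg_closure_Fp :: "nat \<Rightarrow> 'k::alg_closed_field itself \<Rightarrow> bool" where
  "is_alg_closure_Fp p _ \<longleftrightarrow> CHAR('k) = p \<and>
     (\<forall>x::'k. \<exists>P. P \<noteq> 0 \<and> (\<forall>i. Polynomial.coeff P i \<in> \<int>) \<and> poly P x = 0)"

definition matrix_of_endo :: "'k::field endo \<Rightarrow> 'k mat \<Rightarrow> bool" where
  "matrix_of_endo X M \<longleftrightarrow> (\<exists>d b. M \<in> carrier_mat d d \<and> inj_on b {..<d} \<and>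
     fmod.independent (b ` {..<d}) \<and> fmod.span (b ` {..<d}) = endo_mod X \<and>
     (\<forall>j<d. endo_map X (b j) = (\<Sum>i<d. fscale (M $$ (i, j)) (b i))))"

definition endo_char_poly :: "'k::field endo \<Rightarrow> 'k poly" where
  "endo_char_poly X = (THE q. \<exists>M. matrix_of_endo X M \<and> q = char_poly M)"

definition endo_eigenvalues :: "'k::field endo \<Rightarrow> 'k set" where
  "endo_eigenvalues X = {\<alpha>. \<exists>v\<in>endo_mod X. v \<noteq> 0 \<and> endo_map X v = fscale \<alpha> v}"

definition endo_divisor :: "('k::field \<Rightarrow> qmodz) \<Rightarrow> 'k endo \<Rightarrow> group_ring" where
  "endo_divisor \<sigma> X = (\<Sum>\<alpha> \<in> endo_eigenvalues X - {0}.
     of_nat (Polynomial.order \<alpha> (endo_char_poly X)) * group_elem (\<sigma> \<alpha>))"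

definition sigma_tilde :: "('k::field \<Rightarrow> qmodz) \<Rightarrow> 'k W0 \<Rightarrow> group_ring" where
  "sigma_tilde \<sigma> x = frag_extend (endo_divisor \<sigma>) (rep_K0_End (rep_W0 x))"

end

theory Submission
  imports Defs
begin

text \<open>
  Over an algebraically closed field every pair \<open>(E, f)\<close> has a complete flag of \<open>f\<close>-invariant
  subspaces, so its class in \<open>W\<^sub>0\<close> is the sum of the classes of the rank one pairs given by its non-zero
  eigenvalues. Hence \<open>\<sigma>\<close>-tilde identifies \<open>W\<^sub>0\<close> with the group ring of the image of \<open>\<sigma>\<close>, which is the
  prime-to-\<open>p\<close> part of \<open>\<rat>/\<int>\<close>. Flags of tensor products, powers and shifts show that this
  identification is multiplicative and turns \<open>F\<^sub>n\<close> into \<open>\<sigma>\<^sub>n\<close> and \<open>V\<^sub>n\<close> into \<open>r \<circ> \<rho>\<^sub>n\<close>. For the latter, the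
  multiplicities agree without computing them: the roots of \<open>t\<^sup>n - a\<close> all have the same multiplicity,
  the fibres of \<open>r\<close> over the \<open>n\<close>-th parts of \<open>\<sigma> a\<close> all have the same size, and both families have total
  size \<open>n\<close>. The relations of the BC-algebra are then verified on the basis of the group ring.
\<close>

section \<open>Flags of invariant subspaces\<close>

text \<open>The product, \<open>W0_F\<close> and \<open>W0_V\<close> are computed on representatives
  picked by choice, so none of their laws comes for free. Everything is therefore seen through
  \<open>sigma_tilde\<close>. Divisors are additive on exact sequences and multiplicative on tensor
  products, hence vanish on all that is divided out and do not see the choice. Since
  \<open>sigma_tilde\<close> is injective, an identity in \<open>W0\<close> may be checked between
  images.

  A divisor is defined by eigenvalues and orders of zeros of a characteristic polynomial. Flags
  replace this by a list in which multiplicity is repetition, and a flag can be lifted, mapped,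
  tensored or shifted without bases. Matrices occur only where the list is compared with the
  definition.

  On the group ring the obstacle is that r does not commute with \<rho>_n when p divides n. What
  saves the composition laws is that r \<rho>_n depends on its argument only through r.\<close>

interpretation fvec: vector_space "fscale :: 'k::field \<Rightarrow> (nat \<Rightarrow> 'k) \<Rightarrow> nat \<Rightarrow> 'k"
  by standard (auto simp: fscale_def fun_eq_iff algebra_simps)

definition adjoin :: "(nat \<Rightarrow> 'a::comm_ring_1) \<Rightarrow> (nat \<Rightarrow> 'a) set \<Rightarrow> (nat \<Rightarrow> 'a) set" where
  "adjoin v E = {x + fscale c v | x c. x \<in> E}"

lemma adjoin_subspace:
  assumes "fmod.subspace E" shows "fmod.subspace (adjoin v E)"
proof (rule fmod.subspaceI)
  have "0 = 0 + fscale 0 v" by simp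
  thus "0 \<in> adjoin v E" using fmod.subspace_0[OF assms] unfolding adjoin_def by blast
next
  fix x y assume "x \<in> adjoin v E" "y \<in> adjoin v E"
  then obtain x' c y' d where xy: "x = x' + fscale c v" "y = y' + fscale d v" "x' \<in> E" "y' \<in> E"
    by (auto simp: adjoin_def)
  have "x + y = (x' + y') + fscale (c + d) v" unfolding xy by (simp add: fmod.scale_left_distrib)
  thus "x + y \<in> adjoin v E" using fmod.subspace_add[OF assms xy(3,4)] unfolding adjoin_def by blast
next
  fix x d assume "x \<in> adjoin v E"
  then obtain x' c where xy: "x = x' + fscale c v" "x' \<in> E" by (auto simp: adjoin_def)
  have "fscale d x = fscale d x' + fscale (d * c) v" unfolding xy by (simp add: fmod.scale_right_distrib)
  thus "fscale d x \<in> adjoin v E" using fmod.subspace_scale[OF assms xy(2)] unfolding adjoin_def by blast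
qed

lemma adjoinI: "x \<in> E \<Longrightarrow> x + fscale c v \<in> adjoin v E"
  by (auto simp: adjoin_def)

lemma adjoinE:
  assumes "x \<in> adjoin v E" obtains y c where "x = y + fscale c v" "y \<in> E"
  using assms by (auto simp: adjoin_def)

lemma subset_adjoin: "E \<subseteq> adjoin v E"
proof
  fix x assume "x \<in> E"
  from adjoinI[OF this, of 0 v] show "x \<in> adjoin v E" by simp
qed

lemma mem_adjoin: "fmod.subspace E \<Longrightarrow> v \<in> adjoin v E"
  using adjoinI[OF fmod.subspace_0, of E 1 v] by simp

lemma adjoin_least: "fmod.subspace M \<Longrightarrow> E \<subseteq> M \<Longrightarrow> v \<in> M \<Longrightarrow> adjoin v E \<subseteq> M"
  by (auto simp: adjoin_def intro!: fmod.subspace_add fmod.subspace_scale)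

lemma span_insert_adjoin: "fmod.span (insert v B) = adjoin v (fmod.span B)"
proof (intro equalityI)
  show "fmod.span (insert v B) \<subseteq> adjoin v (fmod.span B)"
    using subset_adjoin[of "fmod.span B" v] fmod.span_superset[of B]
    by (intro fmod.span_minimal adjoin_subspace fmod.subspace_span) (auto intro: mem_adjoin)
  show "adjoin v (fmod.span B) \<subseteq> fmod.span (insert v B)"
    by (intro adjoin_least fmod.subspace_span fmod.span_mono) (auto intro: fmod.span_base)
qed

lemma mod_hom_0: "mod_hom E E' f \<Longrightarrow> fmod.subspace E \<Longrightarrow> f 0 = 0"
  using mod_homD(3)[of E E' f 0 0] fmod.subspace_0 by fastforce

lemma mod_hom_diff:
  assumes "mod_hom E E' f" "fmod.subspace E" "x \<in> E" "y \<in> E"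
  shows "f (x - y) = f x - f y"
  using mod_homD(2)[OF assms(1), of "x - y" y] fmod.subspace_diff[OF assms(2)] assms(3,4)
  by (simp add: algebra_simps)

lemma mod_hom_sum:
  assumes f: "mod_hom E E' f" and E: "fmod.subspace E" and h: "\<And>i. i \<in> I \<Longrightarrow> h i \<in> E"
  shows "f (\<Sum>i\<in>I. fscale (c i) (h i)) = (\<Sum>i\<in>I. fscale (c i) (f (h i)))"
proof (cases "finite I")
  case True
  have "f (\<Sum>i\<in>I. fscale (c i) (h i)) = (\<Sum>i\<in>I. fscale (c i) (f (h i))) \<and>
     (\<Sum>i\<in>I. fscale (c i) (h i)) \<in> E"
    using True h
  proof (induction I rule: finite_induct)
    case (insert x F)
    have x: "h x \<in> E" and F: "(\<Sum>i\<in>F. fscale (c i) (h i)) \<in> E"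
      "f (\<Sum>i\<in>F. fscale (c i) (h i)) = (\<Sum>i\<in>F. fscale (c i) (f (h i)))"
      using insert by blast+
    have cx: "fscale (c x) (h x) \<in> E" by (rule fmod.subspace_scale[OF E x])
    show ?case
      unfolding sum.insert[OF insert.hyps] mod_homD(2)[OF f cx F(1)] mod_homD(3)[OF f x] F(2)
      using fmod.subspace_add[OF E cx F(1)] by blast
  qed (use mod_hom_0[OF f E] fmod.subspace_0[OF E] in simp)
  thus ?thesis ..
qed (use mod_hom_0[OF f E] in simp)

text \<open>The list holds the eigenvalues on the successive quotients, the top quotient first, so a
  repeated entry is a repeated eigenvalue. Linearity of \<open>f\<close> is not built in:
  \<open>endo_map\<close> is arbitrary outside \<open>endo_mod\<close>, and linearity on an ambient
  \<open>M\<close> is supplied separately.\<close>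

inductive flag :: "((nat \<Rightarrow> 'k::field) \<Rightarrow> nat \<Rightarrow> 'k) \<Rightarrow> (nat \<Rightarrow> 'k) set \<Rightarrow> 'k list \<Rightarrow> bool"
  for f where
  Nil: "flag f {0} []"
| Cons: "flag f E as \<Longrightarrow> v \<notin> E \<Longrightarrow> f v - fscale a v \<in> E \<Longrightarrow> flag f (adjoin v E) (a # as)"

lemma flag_subspace: "flag f E as \<Longrightarrow> fmod.subspace E"
  by (induction rule: flag.induct) (auto intro: adjoin_subspace)

text \<open>Invariance is not demanded in \<open>flag.Cons\<close> because it follows: f v lies in E
  + k v by construction, and linearity on \<open>M\<close> does the rest.\<close>

lemma flag_invariant:
  assumes "flag f E as" "mod_hom M M f" "E \<subseteq> M"
  shows "mod_hom E E f"
proof -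
  have "f ` E \<subseteq> E" using assms(1,3)
  proof (induction rule: flag.induct)
    case Nil
    thus ?case using mod_homD(3)[OF assms(2), of 0 0] by (auto simp flip: zero_fun_def)
  next
    case (Cons E as v a)
    note sE = flag_subspace[OF Cons(1)]
    have M: "E \<subseteq> M" "v \<in> M" using Cons.prems subset_adjoin mem_adjoin[OF sE] by blast+
    have vM: "fscale c v \<in> M" for c
    proof -
      have "0 + fscale c v \<in> adjoin v E" by (intro adjoinI fmod.subspace_0 sE)
      thus ?thesis using Cons.prems by auto
    qed
    show ?case
    proof
      fix y assume "y \<in> f ` adjoin v E"
      then obtain x c where y: "y = f (x + fscale c v)" "x \<in> E" by (auto simp: adjoin_def)
      have "y = f x + fscale c (f v)" unfolding y
        using mod_homD(2)[OF assms(2), of x "fscale c v"] mod_homD(3)[OF assms(2) M(2)] vM M(1) y(2)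
        by auto
      also have "\<dots> = (f x + fscale c (f v - fscale a v)) + fscale (c * a) v"
        by (simp add: fmod.scale_right_diff_distrib)
      finally show "y \<in> adjoin v E"
        using Cons.IH[OF M(1)] y(2) Cons(3) sE
        by (auto intro!: adjoinI fmod.subspace_add fmod.subspace_scale)
    qed
  qed
  thus ?thesis using assms(2,3) unfolding mod_hom_def by blast
qed

text \<open>The adjoined vectors form a basis in which \<open>f\<close> is upper triangular. This is
  the bridge from flags to dimensions and matrices.\<close>

lemma flag_basis:
  assumes "flag f E as"
  shows "\<exists>b. inj_on b {..<length as} \<and> fmod.independent (b ` {..<length as}) \<and>
    fmod.span (b ` {..<length as}) = E \<and>
    (\<forall>j<length as. f (b j) - fscale (rev as ! j) (b j) \<in> fmod.span (b ` {..<j}))"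
  using assms
proof (induction rule: flag.induct)
  case Nil
  show ?case by (simp add: fmod.independent_empty)
next
  case (Cons E as v a)
  from Cons.IH obtain b where b: "inj_on b {..<length as}" "fmod.independent (b ` {..<length as})"
    "fmod.span (b ` {..<length as}) = E"
    "\<And>j. j < length as \<Longrightarrow> f (b j) - fscale (rev as ! j) (b j) \<in> fmod.span (b ` {..<j})" by blast
  \<comment> \<open>The head of the list was adjoined last, so its vector gets the largest index;
    this is why the diagonal reads \<open>rev as\<close>.\<close>
  define b' where "b' = b(length as := v)"
  have im: "b' ` {..<j} = b ` {..<j}" if "j \<le> length as" for j
    using that by (auto simp: b'_def)
  have im': "b' ` {..<length (a # as)} = insert v (b ` {..<length as})"
    by (simp add: lessThan_Suc im) (simp add: b'_def)
  have v: "v \<notin> fmod.span (b ` {..<length as})" using b(3) Cons.hyps(2) by simp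
  hence v': "v \<notin> b ` {..<length as}" by (metis fmod.span_base)
  have 1: "inj_on b' {..<length (a # as)}"
    using b(1) v' im[OF order_refl] by (simp add: lessThan_Suc inj_on_fun_updI b'_def)
  have 2: "fmod.independent (b' ` {..<length (a # as)})"
    unfolding im' using b(2) v by (simp add: fvec.independent_insert)
  have 3: "fmod.span (b' ` {..<length (a # as)}) = adjoin v E"
    unfolding im' span_insert_adjoin b(3) ..
  have 4: "f (b' j) - fscale (rev (a # as) ! j) (b' j) \<in> fmod.span (b' ` {..<j})"
    if j: "j < length (a # as)" for j
  proof (cases "j = length as")
    case True
    thus ?thesis using Cons.hyps(3) b(3) by (simp add: im nth_append) (simp add: b'_def)
  next
    case False
    thus ?thesis using j b(4)[of j] by (simp add: im nth_append) (simp add: b'_def)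
  qed
  show ?case by (intro exI[of _ b'] conjI allI impI; (rule 1 2 3 | erule 4))
qed

text \<open>Back substitution in a triangular system, all diagonal entries of f - a being non-zero.
  It supplies the correction that turns a vector into an eigenvector in the next lemma.\<close>

lemma flag_surj:
  assumes "flag f E as" "mod_hom M M f" "E \<subseteq> M" "a \<notin> set as" "y \<in> E"
  shows "\<exists>x\<in>E. f x - fscale a x = y"
  using assms(1,3-)
proof (induction arbitrary: y rule: flag.induct)
  case Nil
  thus ?case using mod_homD(3)[OF assms(2), of 0 0] by (auto simp flip: zero_fun_def)
next
  case (Cons E as v b)
  note sE = flag_subspace[OF Cons.hyps(1)]
  have M: "E \<subseteq> M" "v \<in> M" using Cons.prems subset_adjoin mem_adjoin[OF sE] by blast+
  obtain y' c where y: "y = y' + fscale c v" "y' \<in> E" using Cons.prems(3) by (rule adjoinE)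
  define e where "e = f v - fscale b v"
  have e: "e \<in> E" using Cons.hyps(3) by (simp add: e_def)
  \<comment> \<open>Chosen to match the top coefficient: f - a multiplies the class of
    \<open>v\<close> modulo \<open>E\<close> by b - a.\<close>
  define d where "d = c / (b - a)"
  have d: "d * (b - a) = c" using Cons.prems(2) by (auto simp: d_def)
  have "y' - fscale d e \<in> E" using y(2) e by (intro fmod.subspace_diff[OF sE] fmod.subspace_scale[OF sE])
  moreover have "a \<notin> set as" using Cons.prems by simp
  ultimately obtain x where x: "x \<in> E" "f x - fscale a x = y' - fscale d e"
    using Cons.IH[OF M(1)] by blast
  have vM: "fscale d v \<in> M"
    using adjoinI[OF fmod.subspace_0[OF sE], of d v] Cons.prems(1) by auto
  have "f (x + fscale d v) = f x + fscale d (f v)"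
    using mod_homD(2)[OF assms(2) _ vM, of x] mod_homD(3)[OF assms(2) M(2)] M(1) x(1) by auto
  moreover have "f v = e + fscale b v" by (simp add: e_def)
  moreover have "f x = y' - fscale d e + fscale a x" using x(2) by (simp add: algebra_simps)
  ultimately have "f (x + fscale d v) - fscale a (x + fscale d v) = y' + fscale (d * (b - a)) v"
    by (simp add: fun_eq_iff fscale_def algebra_simps)
  thus ?case using x(1) y(1) d adjoinI by metis
qed

lemma flag_eigenvalues:
  assumes "flag f E as" "mod_hom M M f" "E \<subseteq> M"
  shows "{a. \<exists>v\<in>E. v \<noteq> 0 \<and> f v = fscale a v} = set as"
  using assms(1,3)
proof (induction rule: flag.induct)
  case (Cons E as v b)
  note sE = flag_subspace[OF Cons.hyps(1)]
  have M: "E \<subseteq> M" "v \<in> M" using Cons.prems subset_adjoin mem_adjoin[OF sE] by blast+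
  note IH = Cons.IH[OF M(1)]
  define e where "e = f v - fscale b v"
  have e: "e \<in> E" using Cons.hyps(3) by (simp add: e_def)
  have fv: "f v = e + fscale b v" by (simp add: e_def)
  have fE: "f x \<in> E" if "x \<in> E" for x
    using flag_invariant[OF Cons.hyps(1) assms(2) M(1)] that by (auto dest: mod_homD)
  have vM: "fscale d v \<in> M" for d
    using adjoinI[OF fmod.subspace_0[OF sE], of d v] Cons.prems(1) by auto
  have f_lin: "f (x + fscale d v) = f x + fscale d (f v)" if "x \<in> E" for x d
    using mod_homD(2)[OF assms(2) _ vM, of x] mod_homD(3)[OF assms(2) M(2)] M(1) that by auto
  have "\<exists>w\<in>adjoin v E. w \<noteq> 0 \<and> f w = fscale b w"
  proof (cases "b \<in> set as")
    case True
    thus ?thesis using IH subset_adjoin[of E v] by blast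
  next
    case False
    obtain x where x: "x \<in> E" "f x - fscale b x = e"
      using flag_surj[OF Cons.hyps(1) assms(2) M(1) False e] by blast
    \<comment> \<open>As \<open>b\<close> is not an eigenvalue on \<open>E\<close>, the defect
      \<open>e\<close> of \<open>v\<close> is (f - b) x for some x in E; subtracting x leaves a
      genuine eigenvector.\<close>
    let ?w = "- x + fscale 1 v"
    have mx: "- x \<in> E" using x(1) fmod.subspace_neg[OF sE] by blast
    have "f (- x) = - f x"
      using mod_homD(3)[OF assms(2), of x "-1"] x(1) M(1) by auto
    hence "f ?w = fscale b ?w"
      using f_lin[OF mx, of 1] fv x(2) by (simp add: algebra_simps)
    moreover have "?w \<noteq> 0" using Cons.hyps(2) x(1) by auto
    ultimately show ?thesis using adjoinI[OF mx, of 1 v] by blast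
  qed
  moreover have "a = b \<or> a \<in> set as"
    if w: "w \<in> adjoin v E" "w \<noteq> 0" "f w = fscale a w" for a w
  proof -
    obtain x c where x: "w = x + fscale c v" "x \<in> E" using w(1) by (rule adjoinE)
    have "f x + fscale c (e + fscale b v) = fscale a (x + fscale c v)"
      using w(3) f_lin[OF x(2)] fv x(1) by simp
    \<comment> \<open>Comparison along \<open>v\<close>: if c (a - b) were non-zero,
      \<open>v\<close> would lie in \<open>E\<close>. So a = b, or c = 0 and the eigenvector already
      lies in \<open>E\<close>.\<close>
    hence "fscale (c * (a - b)) v = f x + fscale c e - fscale a x"
      by (auto simp: fun_eq_iff fscale_def algebra_simps)
    moreover have "f x + fscale c e - fscale a x \<in> E"
      using fE[OF x(2)] e x(2) sE
      by (intro fmod.subspace_diff[OF sE] fmod.subspace_add[OF sE] fmod.subspace_scale[OF sE])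
    ultimately have cv: "fscale (c * (a - b)) v \<in> E" by simp
    show ?thesis
    proof (cases "c * (a - b) = 0")
      case False
      have "fscale (inverse (c * (a - b))) (fscale (c * (a - b)) v) \<in> E"
        using cv by (rule fmod.subspace_scale[OF sE])
      also have "fscale (inverse (c * (a - b))) (fscale (c * (a - b)) v) = v"
        by (simp only: fmod.scale_scale left_inverse[OF False] fmod.scale_one)
      finally show ?thesis using Cons.hyps(2) by blast
    next
      case True
      show ?thesis
      proof (cases "a = b")
        case False
        with True have "w = x" using x(1) by simp
        thus ?thesis using w x(2) IH by blast
      qed simp
    qed
  qed
  moreover have "\<exists>w\<in>adjoin v E. w \<noteq> 0 \<and> f w = fscale a w" if "a \<in> set as" for a
    using that IH subset_adjoin[of E v] by blast
  ultimately show ?case unfolding set_eq_iff mem_Collect_eq list.set insert_iff by blast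
qed auto

section \<open>Characteristic polynomial and divisor read off a flag\<close>

text \<open>\<open>endo_char_poly\<close> is a definite description over all bases; it denotes
  something because two matrices of the same pair are conjugate by the base change.\<close>

lemma matrix_of_endo_similar:
  assumes "matrix_of_endo X M" "matrix_of_endo X M'"
  shows "similar_mat M M'"
proof -
  let ?f = "endo_map X"
  obtain d b where b: "M \<in> carrier_mat d d" "inj_on b {..<d}" "fmod.independent (b ` {..<d})"
    "fmod.span (b ` {..<d}) = endo_mod X"
    "\<And>j. j < d \<Longrightarrow> ?f (b j) = (\<Sum>i<d. fscale (M $$ (i, j)) (b i))"
    using assms(1) unfolding matrix_of_endo_def by blast
  obtain d' b' where b': "M' \<in> carrier_mat d' d'" "inj_on b' {..<d'}"
    "fmod.independent (b' ` {..<d'})" "fmod.span (b' ` {..<d'}) = endo_mod X"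
    "\<And>j. j < d' \<Longrightarrow> ?f (b' j) = (\<Sum>i<d'. fscale (M' $$ (i, j)) (b' i))"
    using assms(2) unfolding matrix_of_endo_def by blast
  have "card (b ` {..<d}) = card (b' ` {..<d'})"
    using fvec.dim_span_eq_card_independent[OF b(3)] fvec.dim_span_eq_card_independent[OF b'(3)]
      b(4) b'(4) by simp
  hence dd: "d' = d" using b(2) b'(2) by (simp add: card_image)
  have coords: "\<exists>P \<in> carrier_mat d d. \<forall>j<d. b2 j = (\<Sum>i<d. fscale (P $$ (i, j)) (b1 i))"
    if b1: "inj_on b1 {..<d}" and b2: "\<And>j. j < d \<Longrightarrow> b2 j \<in> fmod.span (b1 ` {..<d})"
    for b1 b2 :: "nat \<Rightarrow> nat \<Rightarrow> 'a"
  proof -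
    have "\<exists>c. b2 j = (\<Sum>i<d. fscale (c i) (b1 i))" if j: "j < d" for j
    proof -
      obtain u where "b2 j = (\<Sum>v\<in>b1 ` {..<d}. fscale (u v) v)"
        using b2[OF j] fmod.span_finite[of "b1 ` {..<d}"] by auto
      thus ?thesis using b1 by (auto simp: sum.reindex)
    qed
    then obtain c where "\<And>j. j < d \<Longrightarrow> b2 j = (\<Sum>i<d. fscale (c j i) (b1 i))" by metis
    thus ?thesis by (intro bexI[of _ "mat d d (\<lambda>(i, j). c j i)"]) auto
  qed
  \<comment> \<open>Matrix identities below are proved by evaluating both sides on independent
    vectors.\<close>
  have indep: "A = B" if A: "A \<in> carrier_mat d d" and B: "B \<in> carrier_mat d d"
    and eq: "\<And>j. j < d \<Longrightarrow> (\<Sum>i<d. fscale (A $$ (i, j)) (b1 i)) = (\<Sum>i<d. fscale (B $$ (i, j)) (b1 i))"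
    and b1: "inj_on b1 {..<d}" "fmod.independent (b1 ` {..<d})" for A B b1
  proof (rule eq_matI)
    fix i j assume "i < dim_row B" "j < dim_col B"
    hence ij: "i < d" "j < d" using B by auto
    have "(\<Sum>i<d. fscale (A $$ (i, j) - B $$ (i, j)) (b1 i)) = 0"
      using eq[OF ij(2)] by (simp add: fmod.scale_left_diff_distrib sum_subtractf)
    hence "(\<Sum>v\<in>b1 ` {..<d}. fscale (A $$ (inv_into {..<d} b1 v, j) - B $$ (inv_into {..<d} b1 v, j)) v) = 0"
      using b1(1) by (simp add: sum.reindex)
    from fmod.independentD[OF b1(2) _ _ this, of "b1 i"]
    show "A $$ (i, j) = B $$ (i, j)" using ij b1(1) by auto
  qed (use A B in auto)
  \<comment> \<open>Change of coordinates: a column A in terms of \<open>b1\<close> becomes C A in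
    terms of \<open>b2\<close>, where C expresses \<open>b1\<close> in \<open>b2\<close>.\<close>
  have prod: "(\<Sum>i<d. fscale (A $$ (i, j)) (b1 i)) = (\<Sum>i<d. fscale ((C * A) $$ (i, j)) (b2 i))"
    if A: "A \<in> carrier_mat d d" and C: "C \<in> carrier_mat d d" and j: "j < d"
      and eq: "\<And>i. i < d \<Longrightarrow> b1 i = (\<Sum>k<d. fscale (C $$ (k, i)) (b2 k))"
    for A C :: "'a mat" and b1 b2 j
  proof -
    have "(\<Sum>i<d. fscale (A $$ (i, j)) (b1 i)) =
        (\<Sum>i<d. \<Sum>k<d. fscale (C $$ (k, i) * A $$ (i, j)) (b2 k))"
      by (rule sum.cong) (auto simp: eq fmod.scale_sum_right mult.commute)
    also have "\<dots> = (\<Sum>k<d. \<Sum>i<d. fscale (C $$ (k, i) * A $$ (i, j)) (b2 k))"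
      by (rule sum.swap)
    also have "\<dots> = (\<Sum>k<d. fscale ((C * A) $$ (k, j)) (b2 k))"
      using A C j by (intro sum.cong) (auto simp: scalar_prod_def fmod.scale_sum_left lessThan_atLeast0)
    finally show ?thesis .
  qed
  have in_span: "b i \<in> endo_mod X" "b' i \<in> endo_mod X" if "i < d" for i
    using that fmod.span_base[of "b i" "b ` {..<d}"] fmod.span_base[of "b' i" "b' ` {..<d'}"]
      b(4) b'(4) dd by auto
  obtain P where P: "P \<in> carrier_mat d d" "\<And>j. j < d \<Longrightarrow> b' j = (\<Sum>i<d. fscale (P $$ (i, j)) (b i))"
    using coords[of b b'] b(2,4) in_span by blast
  obtain Q where Q: "Q \<in> carrier_mat d d" "\<And>j. j < d \<Longrightarrow> b j = (\<Sum>i<d. fscale (Q $$ (i, j)) (b' i))"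
    using coords[of b' b] b'(2,4) in_span dd by blast
  have one: "(\<Sum>i<d. fscale ((1\<^sub>m d :: 'a mat) $$ (i, j)) (b1 i)) = b1 j" if "j < d" for j b1
  proof -
    have "(\<Sum>i<d. fscale ((1\<^sub>m d :: 'a mat) $$ (i, j)) (b1 i)) = (\<Sum>i<d. if i = j then b1 i else 0)"
      using that by (intro sum.cong) auto
    thus ?thesis using that by simp
  qed
  have PQ: "P * Q = 1\<^sub>m d"
  proof (rule indep[OF _ _ _ b(2,3)])
    show "(\<Sum>i<d. fscale ((P * Q) $$ (i, j)) (b i)) = (\<Sum>i<d. fscale ((1\<^sub>m d) $$ (i, j)) (b i))"
      if "j < d" for j unfolding one[OF that] using prod[OF Q(1) P(1) that P(2)] Q(2)[OF that] by metis
  qed (use P Q in auto)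
  have QP: "Q * P = 1\<^sub>m d"
  proof (rule indep[OF _ _ _ b'(2,3)[unfolded dd]])
    show "(\<Sum>i<d. fscale ((Q * P) $$ (i, j)) (b' i)) = (\<Sum>i<d. fscale ((1\<^sub>m d) $$ (i, j)) (b' i))"
      if "j < d" for j unfolding one[OF that] using prod[OF P(1) Q(1) that Q(2)] P(2)[OF that] by metis
  qed (use P Q in auto)
  have sX: "fmod.subspace (endo_mod X)" using endo_mod_map finite_projective_subspace by blast
  have f_sum: "?f (\<Sum>i\<in>I. fscale (c i) (h i)) = (\<Sum>i\<in>I. fscale (c i) (?f (h i)))"
    if "\<And>i. i \<in> I \<Longrightarrow> h i \<in> endo_mod X" for I :: "nat set" and c h
    using mod_hom_sum[OF endo_mod_map(2) sX that] .
  have MP: "M * P = P * M'"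
  proof (rule indep[OF _ _ _ b(2,3)])
    fix j assume j: "j < d"
    have "(\<Sum>i<d. fscale ((M * P) $$ (i, j)) (b i)) = (\<Sum>i<d. fscale (P $$ (i, j)) (?f (b i)))"
      by (rule prod[symmetric]) (use b P j in auto)
    also have "\<dots> = ?f (b' j)" unfolding P(2)[OF j] by (rule f_sum[symmetric]) (use in_span in auto)
    also have "\<dots> = (\<Sum>i<d. fscale (M' $$ (i, j)) (b' i))" using b'(5) j dd by simp
    also have "\<dots> = (\<Sum>i<d. fscale ((P * M') $$ (i, j)) (b i))"
      by (rule prod) (use b' P j dd in auto)
    finally show "(\<Sum>i<d. fscale ((M * P) $$ (i, j)) (b i)) = (\<Sum>i<d. fscale ((P * M') $$ (i, j)) (b i))" .
  qed (use b b' P dd in auto)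
  have "P * M' * Q = M"
    using MP PQ b(1) P(1) Q(1) by (metis assoc_mult_mat right_mult_one_mat)
  hence "similar_mat_wit M M' P Q"
    using PQ QP b(1) b'(1) P(1) Q(1) dd unfolding similar_mat_wit_def Let_def by auto
  thus ?thesis unfolding similar_mat_def by blast
qed

lemma flag_char_poly:
  assumes "flag (endo_map X) (endo_mod X) as"
  shows "endo_char_poly X = (\<Prod>a\<leftarrow>as. [:- a, 1:])"
proof -
  let ?f = "endo_map X" and ?d = "length as"
  obtain b where b: "inj_on b {..<?d}" "fmod.independent (b ` {..<?d})"
    "fmod.span (b ` {..<?d}) = endo_mod X"
    "\<And>j. j < ?d \<Longrightarrow> ?f (b j) - fscale (rev as ! j) (b j) \<in> fmod.span (b ` {..<j})"
    using flag_basis[OF assms] by blast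
  have "\<exists>c. ?f (b j) - fscale (rev as ! j) (b j) = (\<Sum>i<j. fscale (c i) (b i))" if j: "j < ?d" for j
  proof -
    obtain u where "?f (b j) - fscale (rev as ! j) (b j) = (\<Sum>v\<in>b ` {..<j}. fscale (u v) v)"
      using b(4)[OF j] fmod.span_finite[of "b ` {..<j}"] by auto
    moreover have "inj_on b {..<j}" using b(1) by (rule inj_on_subset) (use j in auto)
    ultimately show ?thesis by (auto simp: sum.reindex)
  qed
  then obtain c where c: "\<And>j. j < ?d \<Longrightarrow>
      ?f (b j) - fscale (rev as ! j) (b j) = (\<Sum>i<j. fscale (c j i) (b i))" by metis
  define M where "M = mat ?d ?d (\<lambda>(i, j). if i < j then c j i else if i = j then rev as ! j else 0)"
  have M: "M \<in> carrier_mat ?d ?d" by (simp add: M_def)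
  have "?f (b j) = (\<Sum>i<?d. fscale (M $$ (i, j)) (b i))" if j: "j < ?d" for j
  proof -
    have "{..<?d} = {..<j} \<union> {j} \<union> {j<..<?d}" using j by auto
    hence "(\<Sum>i<?d. fscale (M $$ (i, j)) (b i)) = (\<Sum>i\<in>{..<j} \<union> {j} \<union> {j<..<?d}. fscale (M $$ (i, j)) (b i))"
      by simp
    also have "\<dots> = (\<Sum>i<j. fscale (M $$ (i, j)) (b i)) + fscale (M $$ (j, j)) (b j)
        + (\<Sum>i\<in>{j<..<?d}. fscale (M $$ (i, j)) (b i))"
      by (subst sum.union_disjoint, auto)+
    also have "(\<Sum>i\<in>{j<..<?d}. fscale (M $$ (i, j)) (b i)) = 0"
      by (rule sum.neutral) (auto simp: M_def)
    also have "(\<Sum>i<j. fscale (M $$ (i, j)) (b i)) = (\<Sum>i<j. fscale (c j i) (b i))"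
      by (rule sum.cong) (use j in \<open>auto simp: M_def\<close>)
    also have "fscale (M $$ (j, j)) (b j) = fscale (rev as ! j) (b j)"
      using j by (simp add: M_def)
    also have "(\<Sum>i<j. fscale (c j i) (b i)) = ?f (b j) - fscale (rev as ! j) (b j)"
      using c[OF j] ..
    finally show ?thesis by simp
  qed
  hence mat: "matrix_of_endo X M" using b M unfolding matrix_of_endo_def by blast
  have "endo_char_poly X = char_poly M"
    unfolding endo_char_poly_def
    by (rule the_equality) (use mat char_poly_similar[OF matrix_of_endo_similar] in blast)+
  also have "\<dots> = (\<Prod>a\<leftarrow>diag_mat M. [:- a, 1:])"
    by (rule char_poly_upper_triangular[OF M]) (auto simp: M_def)
  also have "diag_mat M = rev as"
    by (rule nth_equalityI) (auto simp: diag_mat_def M_def)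
  also have "(\<Prod>a\<leftarrow>rev as. [:- a, 1:]) = (\<Prod>a\<leftarrow>as. [:- a, 1:])"
    by (simp add: prod_list.rev flip: rev_map)
  finally show ?thesis .
qed

lemma order_prod_linear:
  fixes a :: "'k::field"
  shows "Polynomial.order a (\<Prod>b\<leftarrow>as. [:- b, 1:]) = count_list as a"
proof (induction as)
  case (Cons b as)
  have "(\<Prod>b\<leftarrow>as. [:- b, 1:]) \<noteq> (0::'k poly)"
    by (induction as) (simp_all only: list.map prod_list.Nil prod_list.Cons mult_eq_0_iff, auto)
  hence "[:- b, 1:] * (\<Prod>b\<leftarrow>as. [:- b, 1:]) \<noteq> (0::'k poly)"
    by (simp only: mult_eq_0_iff) auto
  from order_mult[OF this, of a]
  have "Polynomial.order a (\<Prod>b\<leftarrow>b # as. [:- b, 1:]) = Polynomial.order a [:- b, 1:] + count_list as a"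
    by (simp only: Cons list.map prod_list.Cons)
  moreover have "Polynomial.order a [:- b, 1:] = (if b = a then 1 else 0)"
    using order_power_n_n[of b 1] order_root[of "[:- b, 1:]" a] by (auto intro: order_0I)
  ultimately show ?case by simp
qed simp

lemma sum_count_list:
  fixes g :: "'a \<Rightarrow> 'b::comm_ring_1"
  shows "(\<Sum>a\<in>set as. of_nat (count_list as a) * g a) = (\<Sum>a\<leftarrow>as. g a)"
proof (induction as)
  case (Cons b as)
  have "(\<Sum>a\<in>set (b # as). of_nat (count_list (b # as) a) * g a) =
      (\<Sum>a\<in>set (b # as). of_nat (count_list as a) * g a + (if a = b then g a else 0))"
    by (rule sum.cong) (auto simp: algebra_simps)
  also have "\<dots> = (\<Sum>a\<in>set (b # as). of_nat (count_list as a) * g a) + g b"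
    by (simp add: sum.distrib)
  also have "(\<Sum>a\<in>set (b # as). of_nat (count_list as a) * g a) =
      (\<Sum>a\<in>set as. of_nat (count_list as a) * g a)"
    by (rule sum.mono_neutral_right) (auto simp: count_list_0_iff)
  finally show ?case using Cons by (simp add: add.commute)
qed simp

text \<open>\<open>flag_eigenvalues\<close> gives the index set and \<open>flag_char_poly\<close>
  the orders, so the definition becomes a plain sum over the list. Matrices are no longer used after
  this point.\<close>

lemma endo_divisor_flag:
  assumes "flag (endo_map X) (endo_mod X) as"
  shows "endo_divisor \<sigma> X = (\<Sum>a\<leftarrow>filter (\<lambda>a. a \<noteq> 0) as. group_elem (\<sigma> a))"
proof -
  have "endo_eigenvalues X = set as"
    unfolding endo_eigenvalues_def by (rule flag_eigenvalues[OF assms endo_mod_map(2)]) simp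
  hence "endo_divisor \<sigma> X = (\<Sum>a\<in>set as - {0}. of_nat (count_list as a) * group_elem (\<sigma> a))"
    unfolding endo_divisor_def flag_char_poly[OF assms] order_prod_linear by simp
  also have "\<dots> = (\<Sum>a\<in>set (filter (\<lambda>a. a \<noteq> 0) as).
      of_nat (count_list (filter (\<lambda>a. a \<noteq> 0) as) a) * group_elem (\<sigma> a))"
  proof (rule sum.cong)
    have "count_list (filter (\<lambda>a. a \<noteq> 0) as) a = count_list as a" if "a \<noteq> 0" for a
      using that by (induction as) auto
    thus "of_nat (count_list as a) * group_elem (\<sigma> a) =
        of_nat (count_list (filter (\<lambda>a. a \<noteq> 0) as) a) * group_elem (\<sigma> a)"
      if "a \<in> set (filter (\<lambda>a. a \<noteq> 0) as)" for a using that by simp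
  qed auto
  also have "\<dots> = (\<Sum>a\<leftarrow>filter (\<lambda>a. a \<noteq> 0) as. group_elem (\<sigma> a))"
    by (rule sum_count_list)
  finally show ?thesis .
qed

section \<open>Polynomials in an endomorphism and the existence of flags\<close>

definition poly_map :: "'k::field poly \<Rightarrow> ((nat \<Rightarrow> 'k) \<Rightarrow> nat \<Rightarrow> 'k) \<Rightarrow> (nat \<Rightarrow> 'k) \<Rightarrow> nat \<Rightarrow> 'k" where
  "poly_map P f v = (\<Sum>i\<le>Polynomial.degree P. fscale (Polynomial.coeff P i) ((f ^^ i) v))"

lemma poly_map_bound:
  assumes "Polynomial.degree P \<le> n"
  shows "poly_map P f v = (\<Sum>i\<le>n. fscale (Polynomial.coeff P i) ((f ^^ i) v))"
  unfolding poly_map_def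
  by (rule sum.mono_neutral_left) (use assms in \<open>auto simp: coeff_eq_0\<close>)

text \<open>Multiplication by t - a shifts the coefficients up and subtracts a times the old ones;
  the shift becomes an application of \<open>f\<close>.\<close>

lemma poly_map_linear_factor:
  assumes f: "mod_hom E E f" and E: "fmod.subspace E" and v: "v \<in> E"
  shows "poly_map ([:- a, 1:] * P) f v = f (poly_map P f v) - fscale a (poly_map P f v)"
proof -
  let ?n = "Polynomial.degree P"
  let ?c = "Polynomial.coeff P"
  have pow: "(f ^^ i) v \<in> E" for i using mod_homD(1)[OF mod_hom_funpow[OF f]] v by blast
  have coeff: "Polynomial.coeff ([:- a, 1:] * P) i = (case i of 0 \<Rightarrow> 0 | Suc j \<Rightarrow> ?c j) - a * ?c i" for i
    by (simp add: coeff_pCons split: nat.split)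
  have "Polynomial.degree ([:- a, 1:] * P) \<le> Suc ?n"
    using degree_mult_le[of "[:- a, 1:]" P] by simp
  hence "poly_map ([:- a, 1:] * P) f v =
      (\<Sum>i\<le>Suc ?n. fscale (case i of 0 \<Rightarrow> 0 | Suc j \<Rightarrow> ?c j) ((f ^^ i) v)) -
      (\<Sum>i\<le>Suc ?n. fscale (a * ?c i) ((f ^^ i) v))"
    using poly_map_bound[of "[:- a, 1:] * P" "Suc ?n" f v]
    unfolding coeff fmod.scale_left_diff_distrib sum_subtractf by simp
  also have "(\<Sum>i\<le>Suc ?n. fscale (case i of 0 \<Rightarrow> 0 | Suc j \<Rightarrow> ?c j) ((f ^^ i) v)) =
      (\<Sum>i\<le>?n. fscale (?c i) (f ((f ^^ i) v)))"
    by (subst sum.atMost_Suc_shift) simp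
  also have "\<dots> = f (poly_map P f v)"
    unfolding poly_map_def by (rule mod_hom_sum[OF f E pow, symmetric])
  also have "(\<Sum>i\<le>Suc ?n. fscale (a * ?c i) ((f ^^ i) v)) = fscale a (poly_map P f v)"
    using poly_map_bound[of P "Suc ?n" f v] by (simp add: fmod.scale_sum_right fmod.scale_right_distrib)
  finally show ?thesis .
qed

lemma subspace_free_on: "fmod.subspace (free_on I)"
  by (rule fmod.subspaceI) (auto simp: free_on_def fscale_def)

lemma free_on_span:
  assumes "finite I"
  shows "free_on I = fmod.span ((\<lambda>i j. if j = i then 1 else (0::'a::comm_ring_1)) ` I)"
proof (intro equalityI subsetI)
  fix v :: "nat \<Rightarrow> 'a" assume v: "v \<in> free_on I"
  have "v = (\<Sum>i\<in>I. fscale (v i) (\<lambda>j. if j = i then 1 else 0))"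
  proof
    fix j
    have "(\<Sum>i\<in>I. fscale (v i) (\<lambda>j. if j = i then 1 else 0)) j = (\<Sum>i\<in>I. if j = i then v i else 0)"
      using assms by (induction I rule: finite_induct) (auto simp: fscale_def)
    also have "\<dots> = v j" using assms v by (auto simp: free_on_def)
    finally show "v j = (\<Sum>i\<in>I. fscale (v i) (\<lambda>j. if j = i then 1 else 0)) j" ..
  qed
  also have "\<dots> \<in> fmod.span ((\<lambda>i j. if j = i then 1 else 0) ` I)"
    by (intro fmod.span_sum fmod.span_scale fmod.span_base) auto
  finally show "v \<in> fmod.span ((\<lambda>i j. if j = i then 1 else 0) ` I)" .
next
  fix v :: "nat \<Rightarrow> 'a" assume "v \<in> fmod.span ((\<lambda>i j. if j = i then 1 else 0) ` I)"
  moreover have "fmod.span ((\<lambda>i j. if j = i then 1 else 0) ` I) \<subseteq> (free_on I :: (nat \<Rightarrow> 'a) set)"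
    by (rule fmod.span_minimal[OF _ subspace_free_on]) (auto simp: free_on_def)
  ultimately show "v \<in> free_on I" by blast
qed

lemma independent_free_on_card:
  assumes "finite I" "fmod.independent B" "B \<subseteq> free_on I"
  shows "finite (B :: (nat \<Rightarrow> 'k::field) set) \<and> card B \<le> card I"
proof -
  let ?D = "(\<lambda>i j. if j = i then 1 else (0::'k)) ` I"
  have "finite B \<and> card B \<le> card ?D"
    by (rule fvec.independent_span_bound) (use assms free_on_span[OF assms(1)] in auto)
  thus ?thesis using card_image_le[OF assms(1), of "\<lambda>i j. if j = i then 1 else (0::'k)"] by auto
qed

lemma flag_length_le:
  assumes "flag f E as" "finite I" "E \<subseteq> free_on I"
  shows "length as \<le> card I"
proof -
  obtain b where b: "inj_on b {..<length as}" "fmod.independent (b ` {..<length as})"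
    "fmod.span (b ` {..<length as}) = E"
    using flag_basis[OF assms(1)] by blast
  have "b ` {..<length as} \<subseteq> free_on I" using b(3) assms(3) fmod.span_superset[of "b ` {..<length as}"] by simp
  from independent_free_on_card[OF assms(2) b(2) this] show ?thesis
    using card_image[OF b(1)] by simp
qed

text \<open>The iterates f^i v with i at most \<open>card I\<close> are one more than the dimension
  of \<open>free_on I\<close> allows to be independent.\<close>

lemma annihilating_poly:
  fixes f :: "(nat \<Rightarrow> 'k::field) \<Rightarrow> nat \<Rightarrow> 'k"
  assumes f: "mod_hom E E f" and E: "E \<subseteq> free_on I" "finite I" and v: "v \<in> E"
  shows "\<exists>P. P \<noteq> 0 \<and> poly_map P f v = 0"
proof -
  let ?n = "card I" and ?g = "\<lambda>i. (f ^^ i) v"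
  have pow: "?g i \<in> E" for i using mod_homD(1)[OF mod_hom_funpow[OF f]] v by blast
  have "\<exists>c. (\<exists>i\<le>?n. c i \<noteq> 0) \<and> (\<Sum>i\<le>?n. fscale (c i) (?g i)) = 0"
  proof (cases "inj_on ?g {..?n}")
    case True
    hence "\<not> (finite (?g ` {..?n}) \<and> card (?g ` {..?n}) \<le> card I)" by (simp add: card_image)
    moreover have "?g ` {..?n} \<subseteq> free_on I" using pow E(1) by blast
    ultimately have "fmod.dependent (?g ` {..?n})" using independent_free_on_card[OF E(2)] by blast
    then obtain u w where u: "w \<in> ?g ` {..?n}" "u w \<noteq> 0" "(\<Sum>w\<in>?g ` {..?n}. fscale (u w) w) = 0"
      using fmod.dependent_finite[of "?g ` {..?n}"] by auto
    from u(3) have "(\<Sum>i\<le>?n. fscale (u (?g i)) (?g i)) = 0" using True by (simp add: sum.reindex)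
    with u(1,2) show ?thesis by (intro exI[of _ "\<lambda>i. u (?g i)"]) auto
  next
    case False
    then obtain i j where ij: "i \<le> ?n" "j \<le> ?n" "i \<noteq> j" "?g i = ?g j" by (auto simp: inj_on_def)
    \<comment> \<open>When two iterates coincide, the set of iterates may still be independent, so
      the relation t^i - t^j is written down directly.\<close>
    let ?c = "\<lambda>k. (if k = i then 1 else 0) - (if k = j then 1 else 0) :: 'k"
    have "(\<Sum>k\<le>?n. fscale (?c k) (?g k)) =
        (\<Sum>k\<le>?n. if k = i then ?g k else 0) - (\<Sum>k\<le>?n. if k = j then ?g k else 0)"
      unfolding sum_subtractf[symmetric] by (rule sum.cong) (auto simp: fmod.scale_left_diff_distrib)
    also have "\<dots> = 0" using ij by simp
    finally show ?thesis using ij by (intro exI[of _ ?c]) auto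
  qed
  then obtain c i where c: "i \<le> ?n" "c i \<noteq> 0" "(\<Sum>i\<le>?n. fscale (c i) (?g i)) = 0" by (elim exE conjE)
  define P where "P = Poly (map c [0..<Suc ?n])"
  have coeff: "Polynomial.coeff P k = (if k \<le> ?n then c k else 0)" for k
    by (auto simp: P_def nth_default_def less_Suc_eq_le simp del: upt_Suc)
  have "Polynomial.degree P \<le> ?n" by (rule degree_le) (auto simp: coeff)
  hence "poly_map P f v = 0" using c(3) by (simp add: poly_map_bound[of _ ?n] coeff)
  moreover have "P \<noteq> 0" using c(1,2) coeff[of i] by auto
  ultimately show ?thesis by blast
qed

text \<open>In effect an eigenvector of M / E, found without forming the quotient. Among the
  non-zero P with P(f) w in E for some w in M - E take one of least degree and split off a linear
  factor, P = (t - a) Q; minimality keeps Q(f) w outside \<open>E\<close>.\<close>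

lemma flag_extend:
  fixes f :: "(nat \<Rightarrow> 'k::alg_closed_field) \<Rightarrow> nat \<Rightarrow> 'k"
  assumes f: "mod_hom M M f" and M: "fmod.subspace M" "M \<subseteq> free_on I" "finite I"
    and E: "fmod.subspace E" and "v \<in> M" "v \<notin> E"
  obtains u a where "u \<in> M" "u \<notin> E" "f u - fscale a u \<in> E"
proof -
  define S where "S P \<longleftrightarrow> P \<noteq> 0 \<and> (\<exists>v\<in>M - E. poly_map P f v \<in> E)" for P
  obtain P0 where "P0 \<noteq> 0" "poly_map P0 f v = 0"
    using annihilating_poly[OF f M(2,3) assms(6)] by blast
  hence "S P0" using assms(6,7) fmod.subspace_0[OF E] unfolding S_def by (intro conjI bexI[of _ v]) simp_all
  then obtain P where P: "S P" "\<And>Q. S Q \<Longrightarrow> Polynomial.degree P \<le> Polynomial.degree Q"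
    using arg_min_natI[of S P0 Polynomial.degree] arg_min_nat_le[of S _ Polynomial.degree] by blast
  then obtain w where w: "w \<in> M" "w \<notin> E" "poly_map P f w \<in> E" unfolding S_def by blast
  \<comment> \<open>A non-zero constant would put \<open>w\<close> itself into
    \<open>E\<close>.\<close>
  have "Polynomial.degree P \<noteq> 0"
  proof
    assume "Polynomial.degree P = 0"
    then obtain c where c: "P = [:c:]" by (rule degree_eq_zeroE)
    hence "fscale (inverse c) (fscale c w) \<in> E"
      using w(3) by (intro fmod.subspace_scale[OF E, of "fscale c w"]) (simp add: poly_map_def)
    moreover have "c \<noteq> 0" using P(1) c by (auto simp: S_def)
    ultimately show False using w(2) by simp
  qed
  then obtain a where "poly P a = 0" using alg_closed_imp_poly_has_root[of P] by blast
  then obtain Q where Q: "P = [:- a, 1:] * Q" by (auto simp: poly_eq_0_iff_dvd elim: dvdE)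
  have Q0: "Q \<noteq> 0" using P(1) Q by (auto simp: S_def)
  have deg: "Polynomial.degree Q < Polynomial.degree P"
    unfolding Q by (subst degree_mult_eq) (use Q0 in auto)
  let ?u = "poly_map Q f w"
  have "?u \<in> M"
    unfolding poly_map_def using mod_homD(1)[OF mod_hom_funpow[OF f] w(1)]
    by (intro fmod.subspace_sum[OF M(1)] fmod.subspace_scale[OF M(1)]) auto
  moreover have "?u \<notin> E" using P(2)[of Q] Q0 deg w unfolding S_def by auto
  moreover have "f ?u - fscale a ?u \<in> E"
    using w(3) unfolding Q poly_map_linear_factor[OF f M(1) w(1)] .
  ultimately show ?thesis using that by blast
qed

text \<open>The same subspaces serve: by invariance of \<open>E\<close>, f^n v is congruent to a^n v
  modulo \<open>E\<close>.\<close>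

lemma flag_power:
  assumes "flag f E as" "mod_hom M M f" "E \<subseteq> M"
  shows "flag (f ^^ n) E (map (\<lambda>a. a ^ n) as)"
  using assms(1,3)
proof (induction rule: flag.induct)
  case (Cons E as v a)
  note sE = flag_subspace[OF Cons.hyps(1)]
  have M: "E \<subseteq> M" "v \<in> M" using Cons.prems subset_adjoin mem_adjoin[OF sE] by blast+
  have f: "mod_hom (adjoin v E) (adjoin v E) f" "mod_hom E E f"
    using flag_invariant[OF _ assms(2)] flag.Cons[OF Cons.hyps] Cons.prems Cons.hyps(1) M by blast+
  have "(f ^^ n) v - fscale (a ^ n) v \<in> E" for n
  proof (induction n)
    case (Suc n)
    let ?w = "(f ^^ n) v - fscale (a ^ n) v"
    have "(f ^^ n) v = ?w + fscale (a ^ n) v" by simp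
    moreover have "?w \<in> adjoin v E" "fscale (a ^ n) v \<in> adjoin v E" "v \<in> adjoin v E"
      using Suc subset_adjoin[of E v] mem_adjoin[OF sE] fmod.subspace_scale[OF adjoin_subspace[OF sE]] by blast+
    ultimately have "f ((f ^^ n) v) = f ?w + fscale (a ^ n) (f v)"
      using mod_homD(2)[OF f(1), of ?w "fscale (a ^ n) v"] mod_homD(3)[OF f(1), of v "a ^ n"] by simp
    hence "(f ^^ Suc n) v - fscale (a ^ Suc n) v = f ?w + fscale (a ^ n) (f v - fscale a v)"
      by (simp add: fun_eq_iff fscale_def algebra_simps)
    moreover have "f ?w + fscale (a ^ n) (f v - fscale a v) \<in> E"
      using mod_homD(1)[OF f(2) Suc] Cons.hyps(3) by (intro fmod.subspace_add[OF sE] fmod.subspace_scale[OF sE])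
    ultimately show ?case by (simp only:)
  qed (simp add: fmod.subspace_0[OF sE] flip: zero_fun_def)
  thus ?case using Cons.IH[OF M(1)] Cons.hyps(2) by (simp add: flag.Cons)
qed (simp add: flag.Nil)

text \<open>Lengths of flags are bounded by the rank of an ambient free module, and a flag of
  maximal length must reach the whole module, as \<open>flag_extend\<close> would otherwise add a
  step.\<close>

lemma flag_exists:
  fixes X :: "'k::alg_closed_field endo"
  shows "\<exists>as. flag (endo_map X) (endo_mod X) as"
proof -
  let ?f = "endo_map X" and ?M = "endo_mod X"
  have sM: "fmod.subspace ?M" using endo_mod_map finite_projective_subspace by blast
  obtain I where I: "finite I" "?M \<subseteq> free_on I" using finite_projectiveE[OF endo_mod_map(1)] by metis
  let ?S = "\<lambda>n. \<exists>E as. flag ?f E as \<and> E \<subseteq> ?M \<and> length as = n"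
  have "?S 0" using flag.Nil fmod.subspace_0[OF sM] by fastforce
  moreover have "n \<le> card I" if "?S n" for n using that flag_length_le I by blast
  ultimately obtain n where n: "?S n" "\<And>m. ?S m \<Longrightarrow> m \<le> n"
    using GreatestI_nat[of ?S 0 "card I"] Greatest_le_nat[of ?S _ "card I"] by blast
  then obtain E as where E: "flag ?f E as" "E \<subseteq> ?M" "length as = n" by blast
  have "E = ?M"
  proof (rule ccontr)
    assume "E \<noteq> ?M"
    then obtain v where "v \<in> ?M" "v \<notin> E" using E(2) by blast
    then obtain u a where u: "u \<in> ?M" "u \<notin> E" "?f u - fscale a u \<in> E"
      using flag_extend[OF endo_mod_map(2) sM I(2,1) flag_subspace[OF E(1)]] by metis
    have "?S (Suc n)"
      using E(3) by (intro exI[of _ "adjoin u E"] exI[of _ "a # as"] conjI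
          flag.Cons[OF E(1) u(2,3)] adjoin_least[OF sM E(2) u(1)]) simp
    from n(2)[OF this] show False by simp
  qed
  with E(1) show ?thesis by blast
qed

section \<open>Flags in exact sequences\<close>

text \<open>The preimages under \<open>q\<close> of the members of a flag are stacked on a flag of
  the kernel. \<open>F\<close> is any member of the lower flag so that the induction goes through;
  the case in use is F = q E.\<close>

lemma flag_lift:
  assumes "flag h F cs" "flag f E0 as" "mod_hom E E' q" "fmod.subspace E"
    and "\<And>y. y \<in> E \<Longrightarrow> f y \<in> E" "\<And>y. y \<in> E \<Longrightarrow> q (f y) = h (q y)"
    and "E0 = {y \<in> E. q y = 0}" "F \<subseteq> q ` E"
  shows "flag f {y \<in> E. q y \<in> F} (cs @ as)"
  using assms(1,8)
proof (induction rule: flag.induct)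
  case Nil
  show ?case using assms(2,7) by (simp flip: zero_fun_def)
next
  case (Cons F cs w a)
  note sF = flag_subspace[OF Cons.hyps(1)]
  have F: "F \<subseteq> q ` E" "w \<in> q ` E" using Cons.prems subset_adjoin mem_adjoin[OF sF] by blast+
  then obtain v where v: "v \<in> E" "q v = w" by blast
  have av: "fscale c v \<in> E" for c by (rule fmod.subspace_scale[OF assms(4) v(1)])
  have "q (f v - fscale a v) = h w - fscale a w"
    using mod_hom_diff[OF assms(3,4) assms(5)[OF v(1)] av, of a] mod_homD(3)[OF assms(3) v(1)] assms(6) v by simp
  hence 1: "f v - fscale a v \<in> {y \<in> E. q y \<in> F}"
    using Cons.hyps(3) fmod.subspace_diff[OF assms(4) assms(5)[OF v(1)] av] by simp
  have 2: "v \<notin> {y \<in> E. q y \<in> F}" using v Cons.hyps(2) by simp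
  have "adjoin v {y \<in> E. q y \<in> F} = {y \<in> E. q y \<in> adjoin w F}"
  proof (intro equalityI subsetI)
    fix y assume "y \<in> adjoin v {y \<in> E. q y \<in> F}"
    then obtain x c where y: "y = x + fscale c v" "x \<in> E" "q x \<in> F" by (auto elim: adjoinE)
    have "q y = q x + fscale c w"
      using mod_homD(2)[OF assms(3) y(2) av] mod_homD(3)[OF assms(3) v(1)] y(1) v(2) by simp
    thus "y \<in> {y \<in> E. q y \<in> adjoin w F}"
      using adjoinI[OF y(3)] fmod.subspace_add[OF assms(4) y(2) av] y(1) by simp
  next
    fix y assume "y \<in> {y \<in> E. q y \<in> adjoin w F}"
    hence y: "y \<in> E" "q y \<in> adjoin w F" by auto
    obtain x c where x: "q y = x + fscale c w" "x \<in> F" using y(2) by (rule adjoinE)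
    have "q (y - fscale c v) = x"
      using mod_hom_diff[OF assms(3,4) y(1) av] mod_homD(3)[OF assms(3) v(1)] x(1) v(2) by simp
    hence "y - fscale c v \<in> {y \<in> E. q y \<in> F}"
      using x(2) fmod.subspace_diff[OF assms(4) y(1) av] by simp
    from adjoinI[OF this, of c v] show "y \<in> adjoin v {y \<in> E. q y \<in> F}" by simp
  qed
  with flag.Cons[OF Cons.IH[OF F(1)] 2 1] show ?case by simp
qed

lemma flag_image:
  assumes "flag f E as" "mod_hom M M' i" "inj_on i M" "fmod.subspace M" "E \<subseteq> M"
    and "\<And>x. x \<in> M \<Longrightarrow> f x \<in> M" "\<And>x. x \<in> M \<Longrightarrow> i (f x) = g (i x)"
  shows "flag g (i ` E) as"
  using assms(1,5)
proof (induction rule: flag.induct)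
  case Nil
  have "i ` {0} = {0}" using mod_hom_0[OF assms(2,4)] by simp
  thus ?case using flag.Nil by metis
next
  case (Cons E as v a)
  note sE = flag_subspace[OF Cons.hyps(1)]
  have M: "E \<subseteq> M" "v \<in> M" using Cons.prems subset_adjoin mem_adjoin[OF sE] by blast+
  have av: "fscale c v \<in> M" for c by (rule fmod.subspace_scale[OF assms(4) M(2)])
  have "g (i v) - fscale a (i v) = i (f v - fscale a v)"
    using mod_hom_diff[OF assms(2,4) assms(6)[OF M(2)] av] mod_homD(3)[OF assms(2) M(2)] assms(7)[OF M(2)] by simp
  hence 1: "g (i v) - fscale a (i v) \<in> i ` E" using Cons.hyps(3) by simp
  have 2: "i v \<notin> i ` E" using assms(3) M Cons.hyps(2) by (auto dest: inj_onD)
  have i_lin: "i (x + fscale c v) = i x + fscale c (i v)" if "x \<in> E" for x c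
    using mod_homD(2)[OF assms(2) _ av, of x] mod_homD(3)[OF assms(2) M(2)] that M(1) by auto
  have "adjoin (i v) (i ` E) = i ` adjoin v E"
  proof (intro equalityI subsetI)
    fix y assume "y \<in> adjoin (i v) (i ` E)"
    then obtain x c where "y = i x + fscale c (i v)" "x \<in> E" by (auto elim: adjoinE)
    thus "y \<in> i ` adjoin v E" using i_lin[of x c] adjoinI[of x E c v] by (intro image_eqI[of _ _ "x + fscale c v"]) simp_all
  next
    fix y assume "y \<in> i ` adjoin v E"
    then obtain x c where "y = i (x + fscale c v)" "x \<in> E" by (auto elim!: adjoinE)
    thus "y \<in> adjoin (i v) (i ` E)" using i_lin[of x c] adjoinI[of "i x" "i ` E" c "i v"] by simp
  qed
  with flag.Cons[OF Cons.IH[OF M(1)] 2 1] show ?case by simp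
qed

text \<open>The additivity that makes divisors vanish on \<open>K0_relators\<close>. The eigenvalues
  of the quotient sit on top, hence \<open>cs @ as\<close>.\<close>

lemma flag_short_exact:
  assumes "short_exact X Y Z" "flag (endo_map X) (endo_mod X) as" "flag (endo_map Z) (endo_mod Z) cs"
  shows "flag (endo_map Y) (endo_mod Y) (cs @ as)"
proof -
  obtain i q where iq: "mod_hom (endo_mod X) (endo_mod Y) i" "mod_hom (endo_mod Y) (endo_mod Z) q"
     "\<forall>x\<in>endo_mod X. i (endo_map X x) = endo_map Y (i x)"
     "\<forall>y\<in>endo_mod Y. q (endo_map Y y) = endo_map Z (q y)"
     "inj_on i (endo_mod X)" "q ` endo_mod Y = endo_mod Z"
     "i ` endo_mod X = {y \<in> endo_mod Y. q y = 0}"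
    using assms(1) unfolding short_exact_def by (elim exE conjE) (rule that)
  have s: "fmod.subspace (endo_mod X)" "fmod.subspace (endo_mod Y)"
    using endo_mod_map finite_projective_subspace by blast+
  have "flag (endo_map Y) (i ` endo_mod X) as"
    using flag_image[OF assms(2) iq(1,5) s(1)] iq(3) mod_homD(1)[OF endo_mod_map(2)] by blast
  from flag_lift[OF assms(3) this iq(2) s(2) _ bspec[OF iq(4)] iq(7)]
  have "flag (endo_map Y) {y \<in> endo_mod Y. q y \<in> endo_mod Z} (cs @ as)"
    using iq(6) mod_homD(1)[OF endo_mod_map(2)] by blast
  moreover have "{y \<in> endo_mod Y. q y \<in> endo_mod Z} = endo_mod Y" using iq(6) by blast
  ultimately show ?thesis by simp
qed

section \<open>Tensor products, powers and shifts\<close>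

interpretation fpair: vector_space_pair
  "fscale :: 'k::field \<Rightarrow> (nat \<Rightarrow> 'k) \<Rightarrow> nat \<Rightarrow> 'k" "fscale :: 'k::field \<Rightarrow> (nat \<Rightarrow> 'k) \<Rightarrow> nat \<Rightarrow> 'k" ..

lemma mod_hom_linear:
  assumes "Vector_Spaces.linear fscale fscale g"
  shows "mod_hom UNIV UNIV g"
  using Vector_Spaces.linear.axioms(3)[OF assms]
  by (auto simp: mod_hom_def module_hom_def module_hom_axioms_def)

text \<open>Extension from a basis of \<open>E\<close> enlarged by \<open>v\<close>. The result is
  an endomorphism of the ambient space rather than a functional, so that it can be fed to
  \<open>tensor_map\<close>.\<close>

lemma subspace_separation:
  fixes E :: "(nat \<Rightarrow> 'k::field) set"
  assumes "fmod.subspace E" "v \<notin> E"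
  obtains g where "mod_hom UNIV UNIV g" "\<And>x. x \<in> E \<Longrightarrow> g x = 0" "g v = v"
proof -
  obtain B where B: "B \<subseteq> E" "fmod.independent B" "E \<subseteq> fmod.span B"
    using fvec.basis_exists[of E] by metis
  have spanB: "fmod.span B = E" using B fmod.span_minimal[OF B(1) assms(1)] by blast
  have "fmod.independent (insert v B)"
    using B(2) assms(2) spanB by (simp add: fvec.independent_insert)
  then obtain g where g: "Vector_Spaces.linear fscale fscale g"
      "\<And>x. x \<in> insert v B \<Longrightarrow> g x = (if x = v then v else 0)"
    using fpair.linear_independent_extend[of "insert v B" "\<lambda>x. if x = v then v else 0"] by blast
  note hom = mod_hom_linear[OF g(1)]
  have "v \<notin> B" using assms(2) B(1) by blast
  hence gB: "g x = 0" if "x \<in> B" for x using g(2)[of x] that by auto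
  have "g x = 0" if "x \<in> fmod.span B" for x
    using that
  proof (induction rule: fmod.span_induct_alt)
    case base
    show "g 0 = 0" using mod_hom_0[OF hom] by simp
  next
    case (step c x y)
    have "g (fscale c x + y) = fscale c (g x) + g y"
      using mod_homD(2,3)[OF hom] by simp
    thus "g (fscale c x + y) = 0" using step gB[of x] by (simp flip: zero_fun_def)
  qed
  with hom g(2)[of v] spanB show ?thesis using that by simp
qed

text \<open>Over a field the identity on a basis of \<open>E\<close> extends to a projection onto
  \<open>E\<close>. Thus the members of a flag are modules of legitimate pairs.\<close>

lemma finite_projective_subspace_free_on:
  fixes E :: "(nat \<Rightarrow> 'k::field) set"
  assumes "finite I" "fmod.subspace E" "E \<subseteq> free_on I"
  shows "finite_projective E"
proof -
  obtain B where B: "B \<subseteq> E" "fmod.independent B" "E \<subseteq> fmod.span B"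
    using fvec.basis_exists[of E] by metis
  have spanB: "fmod.span B = E" using B fmod.span_minimal[OF B(1) assms(2)] by blast
  obtain g where g: "Vector_Spaces.linear fscale fscale g" "\<And>x. x \<in> B \<Longrightarrow> g x = x"
      "range g = fmod.span (id ` B)"
    using fpair.linear_independent_extend_subspace[OF B(2), of id] by auto
  note hom = mod_hom_linear[OF g(1)]
  have "g x = x" if "x \<in> fmod.span B" for x
    using that
  proof (induction rule: fmod.span_induct_alt)
    case base
    show "g 0 = 0" using mod_hom_0[OF hom] by simp
  next
    case (step c x y)
    have "g (fscale c x + y) = fscale c (g x) + g y"
      using mod_homD(2,3)[OF hom] by simp
    thus "g (fscale c x + y) = fscale c x + y" using step g(2)[of x] by simp
  qed
  moreover have "mod_hom UNIV E g" using hom g(3) spanB by (auto simp: mod_hom_def)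
  ultimately show ?thesis using finite_projectiveI[OF assms(1,3)] spanB by blast
qed

lemma pure_tensor_linear:
  "pure_tensor (x + x') y = pure_tensor x y + pure_tensor x' y"
  "pure_tensor x (y + y') = pure_tensor x y + pure_tensor x y'"
  "pure_tensor (x - x') y = pure_tensor x y - pure_tensor x' y"
  "pure_tensor x (y - y') = pure_tensor x y - pure_tensor x y'"
  "pure_tensor (fscale c x) y = fscale c (pure_tensor x y)"
  "pure_tensor x (fscale c y) = fscale c (pure_tensor x y)"
  "pure_tensor 0 y = 0" "pure_tensor x 0 = 0"
  by (auto simp: pure_tensor_def from_blocks_def fscale_def fun_eq_iff algebra_simps split: prod.splits)

lemma pure_tensor_in: "x \<in> E \<Longrightarrow> y \<in> E' \<Longrightarrow> pure_tensor x y \<in> tensor_mod E E'"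
  unfolding tensor_mod_def by (rule fmod.span_base) blast

lemma subspace_tensor_mod: "fmod.subspace (tensor_mod E E')"
  unfolding tensor_mod_def by (rule fmod.subspace_span)

lemma tensor_mod_mono: "E \<subseteq> F \<Longrightarrow> E' \<subseteq> F' \<Longrightarrow> tensor_mod E E' \<subseteq> tensor_mod F F'"
  unfolding tensor_mod_def by (rule fmod.span_mono) blast

lemma tensor_mod_zero:
  fixes E' :: "(nat \<Rightarrow> 'a::comm_ring_1) set"
  assumes "0 \<in> E'"
  shows "tensor_mod {0} E' = {0}"
proof -
  have "{pure_tensor x y | x y. x \<in> {0} \<and> y \<in> E'} = {0}"
    using assms by (auto simp: pure_tensor_linear)
  moreover have "fmod.span {0 :: nat \<Rightarrow> 'a} = {0}"
    using fmod.span_minimal[of "{0}" "{0}"] fmod.span_zero fmod.subspace_single_0 by blast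
  ultimately show ?thesis unfolding tensor_mod_def by (simp only:)
qed

text \<open>One step from E to E + k v in the first factor. The quotient of the two tensor products
  is a copy of E', embedded by w \<mapsto> v \<otimes> w, on which the map acts as a times
  \<open>g\<close>; so a flag of E' is lifted member by member.\<close>

lemma flag_tensor_step:
  assumes f: "mod_hom M M f" and g: "mod_hom E' E' g" and M: "E \<subseteq> M" "v \<in> M"
    and E: "fmod.subspace E" "v \<notin> E" "f v - fscale a v \<in> E"
    and E': "fmod.subspace E'"
    and flag: "flag (tensor_map f g) (tensor_mod E E') ps"
    and W: "flag g W bs" "W \<subseteq> E'"
  shows "flag (tensor_map f g) {x + pure_tensor v w | x w. x \<in> tensor_mod E E' \<and> w \<in> W}
    (map ((*) a) bs @ ps)"
  using W
proof (induction rule: flag.induct)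
  case Nil
  have "{x + pure_tensor v w | x w. x \<in> tensor_mod E E' \<and> w \<in> {0}} = tensor_mod E E'"
    by (auto simp: pure_tensor_linear)
  thus ?case using flag by (simp only: list.map append.simps)
next
  case (Cons W bs w b)
  let ?T = "tensor_map f g" and ?U = "\<lambda>W. {x + pure_tensor v w | x w. x \<in> tensor_mod E E' \<and> w \<in> W}"
  note sW = flag_subspace[OF Cons.hyps(1)]
  have W: "W \<subseteq> E'" "w \<in> E'" using Cons.prems subset_adjoin mem_adjoin[OF sW] by blast+
  have 1: "pure_tensor v w \<notin> ?U W"
  proof
    assume "pure_tensor v w \<in> ?U W"
    then obtain x w' where x: "pure_tensor v w = x + pure_tensor v w'" "x \<in> tensor_mod E E'" "w' \<in> W"
      by blast
    \<comment> \<open>The map h \<otimes> id kills E \<otimes> E' and fixes v \<otimes> w; an index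
      at which \<open>v\<close> does not vanish then recovers \<open>w\<close>.\<close>
    obtain h where h: "mod_hom UNIV UNIV h" "\<And>x. x \<in> E \<Longrightarrow> h x = 0" "h v = v"
      using subspace_separation[OF E(1,2)] by metis
    have id: "mod_hom UNIV UNIV (\<lambda>x. x)" "mod_hom E' UNIV (\<lambda>x. x)" by (auto simp: mod_hom_def)
    have "mod_hom E {0} h" using h(1,2) by (auto simp: mod_hom_def)
    from tensor_map_hom[OF E(1) E' this id(2)]
    have hx: "tensor_map h (\<lambda>x. x) x = 0"
      using x(2) tensor_mod_zero[of UNIV] by (auto dest: mod_homD(1))
    have "mod_hom (tensor_mod UNIV UNIV) (tensor_mod UNIV UNIV) (tensor_map h (\<lambda>x. x))"
      by (intro tensor_map_hom h id) simp_all
    from mod_homD(2)[OF this, of x "pure_tensor v w'"]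
    have "tensor_map h (\<lambda>x. x) (pure_tensor v w) = tensor_map h (\<lambda>x. x) (pure_tensor v w')"
      using x(1,2) tensor_mod_mono[of E UNIV E' UNIV] hx by (auto simp: pure_tensor_in)
    hence eq: "pure_tensor v w = pure_tensor v w'"
      using tensor_map_pure[OF h(1) id(1)] h(3) by simp
    have "v \<noteq> 0" using E(1,2) fmod.subspace_0 by blast
    then obtain i where i: "v i \<noteq> 0" by (auto simp: fun_eq_iff)
    have "fscale (v i) w = fscale (v i) w'" using eq by (metis block_pure_tensor)
    with i have "w = w'" by simp
    thus False using Cons.hyps(2) x(3) by blast
  qed
  have gw: "g w \<in> E'" using mod_homD(1)[OF g W(2)] .
  \<comment> \<open>The error splits into (f v - a v) \<otimes> g w, which lies in E \<otimes> E',
    and v \<otimes> a (g w - b w), which lies in v \<otimes> W.\<close>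
  have "?T (pure_tensor v w) - fscale (a * b) (pure_tensor v w) =
      pure_tensor (f v - fscale a v) (g w) + pure_tensor v (fscale a (g w - fscale b w))"
    unfolding tensor_map_pure[OF f g M(2) W(2)]
    by (simp add: pure_tensor_linear fmod.scale_right_diff_distrib)
  moreover have "fscale a (g w - fscale b w) \<in> W"
    by (rule fmod.subspace_scale[OF sW Cons.hyps(3)])
  moreover have "pure_tensor (f v - fscale a v) (g w) \<in> tensor_mod E E'"
    by (rule pure_tensor_in[OF E(3) gw])
  ultimately have 2: "?T (pure_tensor v w) - fscale (a * b) (pure_tensor v w) \<in> ?U W" by blast
  have "adjoin (pure_tensor v w) (?U W) = ?U (adjoin w W)"
  proof (intro equalityI subsetI)
    fix y assume "y \<in> adjoin (pure_tensor v w) (?U W)"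
    then obtain x w' c where y: "y = x + pure_tensor v w' + fscale c (pure_tensor v w)"
        "x \<in> tensor_mod E E'" "w' \<in> W" by (auto elim!: adjoinE)
    have "y = x + pure_tensor v (w' + fscale c w)" using y(1) by (simp add: pure_tensor_linear add.assoc)
    with y(2) adjoinI[OF y(3), of c w] show "y \<in> ?U (adjoin w W)" by blast
  next
    fix y assume "y \<in> ?U (adjoin w W)"
    then obtain x u where y: "y = x + pure_tensor v u" "x \<in> tensor_mod E E'" "u \<in> adjoin w W" by blast
    obtain w' c where u: "u = w' + fscale c w" "w' \<in> W" using y(3) by (rule adjoinE)
    have "y = (x + pure_tensor v w') + fscale c (pure_tensor v w)"
      using y(1) u(1) by (simp add: pure_tensor_linear add.assoc)
    moreover have "x + pure_tensor v w' \<in> ?U W" using y(2) u(2) by blast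
    ultimately show "y \<in> adjoin (pure_tensor v w) (?U W)" by (simp only: adjoinI)
  qed
  with flag.Cons[OF Cons.IH[OF W(1)] 1 2] show ?case by (simp only: list.map append.simps)
qed

text \<open>Identifies the end W = E' of the chain in \<open>flag_tensor_step\<close> with the next
  tensor product.\<close>

lemma tensor_mod_adjoin:
  assumes "fmod.subspace E" "fmod.subspace E'"
  shows "tensor_mod (adjoin v E) E' = {x + pure_tensor v w | x w. x \<in> tensor_mod E E' \<and> w \<in> E'}"
    (is "_ = ?U")
proof (intro equalityI)
  have "fmod.subspace ?U"
  proof (rule fmod.subspaceI)
    have "0 = 0 + pure_tensor v 0" by (simp add: pure_tensor_linear)
    thus "0 \<in> ?U" using fmod.subspace_0[OF assms(2)] fmod.subspace_0[OF subspace_tensor_mod] by blast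
  next
    fix s t assume "s \<in> ?U" "t \<in> ?U"
    then obtain x w y u where st: "s = x + pure_tensor v w" "t = y + pure_tensor v u"
      "x \<in> tensor_mod E E'" "y \<in> tensor_mod E E'" "w \<in> E'" "u \<in> E'" by blast
    have "s + t = (x + y) + pure_tensor v (w + u)" using st(1,2) by (simp add: pure_tensor_linear)
    thus "s + t \<in> ?U"
      using fmod.subspace_add[OF subspace_tensor_mod st(3,4)] fmod.subspace_add[OF assms(2) st(5,6)] by blast
  next
    fix c s assume "s \<in> ?U"
    then obtain x w where s: "s = x + pure_tensor v w" "x \<in> tensor_mod E E'" "w \<in> E'" by blast
    have "fscale c s = fscale c x + pure_tensor v (fscale c w)"
      using s(1) by (simp add: pure_tensor_linear fmod.scale_right_distrib)
    thus "fscale c s \<in> ?U"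
      using fmod.subspace_scale[OF subspace_tensor_mod s(2)] fmod.subspace_scale[OF assms(2) s(3)] by blast
  qed
  moreover have "{pure_tensor x y | x y. x \<in> adjoin v E \<and> y \<in> E'} \<subseteq> ?U"
  proof
    fix t assume "t \<in> {pure_tensor x y | x y. x \<in> adjoin v E \<and> y \<in> E'}"
    then obtain x c y where t: "t = pure_tensor (x + fscale c v) y" "x \<in> E" "y \<in> E'"
      by (auto elim!: adjoinE)
    have "t = pure_tensor x y + pure_tensor v (fscale c y)" using t(1) by (simp add: pure_tensor_linear)
    thus "t \<in> ?U" using pure_tensor_in[OF t(2,3)] fmod.subspace_scale[OF assms(2) t(3)] by blast
  qed
  ultimately show "tensor_mod (adjoin v E) E' \<subseteq> ?U"
    unfolding tensor_mod_def[of "adjoin v E"] by (intro fmod.span_minimal)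
  show "?U \<subseteq> tensor_mod (adjoin v E) E'"
  proof
    fix t assume "t \<in> ?U"
    then obtain x w where t: "t = x + pure_tensor v w" "x \<in> tensor_mod E E'" "w \<in> E'" by blast
    have "x \<in> tensor_mod (adjoin v E) E'" using t(2) tensor_mod_mono[OF subset_adjoin order_refl] by blast
    thus "t \<in> tensor_mod (adjoin v E) E'"
      unfolding t(1) using pure_tensor_in[OF mem_adjoin[OF assms(1)] t(3)]
      by (rule fmod.subspace_add[OF subspace_tensor_mod])
  qed
qed

lemma flag_tensor:
  assumes "flag f E as" "mod_hom M M f" "E \<subseteq> M" "flag g E' bs" "mod_hom E' E' g"
  shows "flag (tensor_map f g) (tensor_mod E E') (concat (map (\<lambda>a. map ((*) a) bs) as))"
  using assms(1,3)
proof (induction rule: flag.induct)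
  case Nil
  show ?case
    using flag.Nil tensor_mod_zero[OF fmod.subspace_0[OF flag_subspace[OF assms(4)]]] by simp
next
  case (Cons E as v a)
  note sE = flag_subspace[OF Cons.hyps(1)]
  have M: "E \<subseteq> M" "v \<in> M" using Cons.prems subset_adjoin mem_adjoin[OF sE] by blast+
  note sE' = flag_subspace[OF assms(4)]
  show ?case unfolding tensor_mod_adjoin[OF sE sE']
    using flag_tensor_step[OF assms(2,5) M sE Cons.hyps(2,3) sE' Cons.IH[OF M(1)] assms(4) order_refl]
    by simp
qed

section \<open>Shifts and the roots of t^n - a\<close>

lemma degree_monom_minus_const:
  fixes a :: "'k::field"
  assumes "n > 0" shows "Polynomial.degree (Polynomial.monom 1 n - [:a:]) = n"
  using assms degree_add_eq_left[of "- [:a:]" "Polynomial.monom 1 n"]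
  unfolding diff_conv_add_uminus by (simp add: degree_monom_eq)

lemma monom_minus_const_roots:
  fixes a :: "'k::alg_closed_field"
  assumes "n > 0"
  shows "\<exists>rs. (\<Prod>r\<leftarrow>rs. [:- r, 1:]) = Polynomial.monom 1 n - [:a:]"
proof -
  let ?p = "Polynomial.monom 1 n - [:a:]"
  note deg = degree_monom_minus_const[OF assms, of a]
  hence "?p \<noteq> 0" using assms by auto
  from alg_closed_imp_factorization[OF this]
  obtain A where A: "?p = Polynomial.smult (Polynomial.lead_coeff ?p) (\<Prod>x\<in>#A. [:- x, 1:])" by blast
  have lc: "Polynomial.lead_coeff ?p = 1" using assms unfolding deg by (simp add: coeff_pCons split: nat.split)
  obtain rs where "mset rs = A" using ex_mset by blast
  hence "(\<Prod>r\<leftarrow>rs. [:- r, 1:]) = (\<Prod>x\<in>#A. [:- x, 1:])"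
    by (metis mset_map prod_mset_prod_list)
  with A lc show ?thesis by (intro exI[of _ rs]) simp
qed

text \<open>A list and not a set, because roots can coincide when the characteristic divides n or
  when a = 0; the order is an arbitrary choice.\<close>

definition root_list :: "nat \<Rightarrow> 'k::alg_closed_field \<Rightarrow> 'k list" where
  "root_list n a = (SOME rs. (\<Prod>r\<leftarrow>rs. [:- r, 1:]) = Polynomial.monom 1 n - [:a:])"

lemma prod_root_list:
  "n > 0 \<Longrightarrow> (\<Prod>r\<leftarrow>root_list n a. [:- r, 1:]) = Polynomial.monom 1 n - [:a:]"
  unfolding root_list_def by (rule someI_ex[OF monom_minus_const_roots])

lemma linear_factors_monic:
  fixes rs :: "'k::field list"
  shows "Polynomial.degree (\<Prod>r\<leftarrow>rs. [:- r, 1:]) = length rs"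
    and "Polynomial.coeff (\<Prod>r\<leftarrow>rs. [:- r, 1:]) (length rs) = 1"
proof -
  have "Polynomial.degree (\<Prod>r\<leftarrow>rs. [:- r, 1:]) = length rs \<and> Polynomial.lead_coeff (\<Prod>r\<leftarrow>rs. [:- r, 1:]) = 1"
  proof (induction rs)
    case (Cons r rs)
    hence nz: "(\<Prod>r\<leftarrow>rs. [:- r, 1:]) \<noteq> 0" by auto
    have "Polynomial.degree ([:- r, 1:] * (\<Prod>r\<leftarrow>rs. [:- r, 1:])) = Suc (length rs)"
      using nz Cons by (subst degree_mult_eq) auto
    moreover have "Polynomial.lead_coeff ([:- r, 1:] * (\<Prod>r\<leftarrow>rs. [:- r, 1:])) = 1"
      using Cons by (subst lead_coeff_mult) auto
    ultimately show ?case by (simp only: list.map prod_list.Cons length_Cons simp_thms)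
  qed auto
  thus "Polynomial.degree (\<Prod>r\<leftarrow>rs. [:- r, 1:]) = length rs"
    "Polynomial.coeff (\<Prod>r\<leftarrow>rs. [:- r, 1:]) (length rs) = 1" by auto
qed

lemma length_root_list:
  fixes a :: "'k::alg_closed_field"
  assumes "n > 0" shows "length (root_list n a) = n"
  using prod_root_list[OF assms, of a] linear_factors_monic(1)[of "root_list n a"]
  by (simp add: degree_monom_minus_const[OF assms])

lemma subspace_dirsum: "fmod.subspace E \<Longrightarrow> fmod.subspace (dirsum_mod n E)"
  by (rule fmod.subspaceI)
    (auto simp: dirsum_mod_def intro: fmod.subspace_0 fmod.subspace_add fmod.subspace_scale)

lemma dirsum_mono: "E \<subseteq> F \<Longrightarrow> dirsum_mod n E \<subseteq> dirsum_mod n F"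
  by (auto simp: dirsum_mod_def)

lemma block_shift_map:
  "block j (shift_map n f x) =
    (if j \<ge> n then 0 else if j = 0 then f (block (n - 1) x) else block (j - 1) x)"
  by (simp add: shift_map_def)

lemma block_diff: "block j (v - w) = block j v - block j w"
  by (auto simp: block_def)

text \<open>On one eigenvector \<open>v\<close> of \<open>f\<close> with eigenvalue \<open>a\<close> the map \<open>shift_map n f\<close> is multiplication by
  \<open>t\<close> on \<open>k[t] / (t\<^sup>n - a)\<close>; the flag consists of the ideals generated by the partial products
  of \<open>t\<^sup>n - a = (t - r\<^sub>1) \<cdots> (t - r\<^sub>n)\<close>.\<close>

lemma flag_shift_step:
  assumes f: "mod_hom M M f" "fmod.subspace M" and M: "E \<subseteq> M" "v \<in> M"
    and E: "fmod.subspace E" "v \<notin> E" "f v - fscale a v \<in> E"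
    and n: "n > 0" and rs: "(\<Prod>r\<leftarrow>rs. [:- r, 1:]) = Polynomial.monom 1 n - [:a:]" "length rs = n"
    and flag: "flag (shift_map n f) (dirsum_mod n E) cs"
  shows "flag (shift_map n f) (dirsum_mod n (adjoin v E)) (rs @ cs)"
proof -
  let ?\<Phi> = "shift_map n f"
  define q where "q i = (\<Prod>r\<leftarrow>take i rs. [:- r, 1:])" for i
  \<comment> \<open>The polynomial \<open>q i\<close> times \<open>v\<close>: block j carries the
    coefficient of t^j.\<close>
  define c where "c i = from_blocks (\<lambda>j. fscale (Polynomial.coeff (q i) j) v)" for i
  have block_c: "block j (c i) = fscale (Polynomial.coeff (q i) j) v" for i j by (simp add: c_def)
  have top: "Polynomial.coeff (q i) i = 1" "\<And>j. i < j \<Longrightarrow> Polynomial.coeff (q i) j = 0"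
    if "i \<le> n" for i
  proof -
    have "Polynomial.degree (q i) = i" "Polynomial.coeff (q i) i = 1"
      using linear_factors_monic[of "take i rs"] that rs(2) by (simp_all add: q_def min_absorb2)
    thus "Polynomial.coeff (q i) i = 1" "\<And>j. i < j \<Longrightarrow> Polynomial.coeff (q i) j = 0"
      by (auto simp: coeff_eq_0)
  qed
  have q_Suc: "Polynomial.coeff (q (Suc i)) j =
      (case j of 0 \<Rightarrow> 0 | Suc k \<Rightarrow> Polynomial.coeff (q i) k) - rs ! i * Polynomial.coeff (q i) j" if "i < n" for i j
  proof -
    have "q (Suc i) = q i * [:- (rs ! i), 1:]"
      using that rs(2) by (simp only: q_def take_Suc_conv_app_nth map_append prod_list.append) simp
    thus ?thesis by (simp add: coeff_pCons split: nat.split)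
  qed
  have q_n: "q n = Polynomial.monom 1 n - [:a:]" using rs by (simp add: q_def)
  have f0: "f 0 = 0" by (rule mod_hom_0[OF f])
  have fcv: "f (fscale d v) = fscale d (f v)" for d by (rule mod_homD(3)[OF f(1) M(2)])
  define D where "D = dirsum_mod n E"
  have sD: "fmod.subspace D" unfolding D_def by (rule subspace_dirsum[OF E(1)])
  have c_in: "c i \<in> dirsum_mod n (adjoin v E)" if "i < n" for i
    using that top(2)[of i] fmod.subspace_scale[OF adjoin_subspace[OF E(1)] mem_adjoin[OF E(1)]]
    by (auto simp: dirsum_mod_def block_c)
  \<comment> \<open>As long as the last block is zero the map only moves blocks up, which is
    multiplication by t; hence t - \<open>rs ! i\<close> takes one partial product to the
    next.\<close>
  have Phi_c: "?\<Phi> (c i) - fscale (rs ! i) (c i) = c (Suc i)" if "Suc i < n" for i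
  proof (rule blocks_eqI)
    fix j
    have *: "block j (c (Suc i)) = fscale ((case j of 0 \<Rightarrow> 0 | Suc k \<Rightarrow> Polynomial.coeff (q i) k) -
        rs ! i * Polynomial.coeff (q i) j) v"
      using that by (simp add: block_c q_Suc)
    show "block j (?\<Phi> (c i) - fscale (rs ! i) (c i)) = block j (c (Suc i))"
      unfolding * unfolding block_diff block_linear block_shift_map block_c
      using that top(2)[of i "n - 1"] top(2)[of i j] top(2)[of i "j - 1"] f0
      by (cases j) (simp_all add: fmod.scale_left_diff_distrib)
  qed
  \<comment> \<open>Here the wrap-around matters: t^n v turns into f v in block 0. As
    \<open>q n\<close> is t^n - a, what remains is f v - a v in block 0.\<close>
  have Phi_last: "?\<Phi> (c (n - 1)) - fscale (rs ! (n - 1)) (c (n - 1)) \<in> D"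
  proof -
    let ?i = "n - 1"
    have i: "?i < n" "Suc ?i = n" using n by auto
    have cf: "(case j of 0 \<Rightarrow> 0 | Suc k \<Rightarrow> Polynomial.coeff (q ?i) k) - rs ! ?i * Polynomial.coeff (q ?i) j =
        (if j = n then 1 else if j = 0 then - a else 0)" for j
      using q_Suc[OF i(1), of j] n unfolding i(2) q_n by (auto simp: coeff_pCons split: nat.splits)
    have blk: "block j (?\<Phi> (c ?i) - fscale (rs ! ?i) (c ?i)) = (if j = 0 then f v - fscale a v else 0)" for j
    proof (cases "j < n")
      case False
      thus ?thesis using top(2)[of ?i j] n unfolding block_diff block_linear block_shift_map block_c by simp
    next
      case True
      show ?thesis
      proof (cases j)
        case 0
        thus ?thesis using n top(1)[of ?i] cf[of 0] unfolding block_diff block_linear block_shift_map block_c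
          by simp
      next
        case (Suc k)
        hence "fscale (Polynomial.coeff (q ?i) k - rs ! ?i * Polynomial.coeff (q ?i) j) v = 0"
          using True cf[of j] by simp
        thus ?thesis using Suc True unfolding block_diff block_linear block_shift_map block_c
          by (simp add: fmod.scale_left_diff_distrib)
      qed
    qed
    show ?thesis using E(3) fmod.subspace_0[OF E(1)] n unfolding D_def dirsum_mod_def mem_Collect_eq blk by auto
  qed
  \<comment> \<open>\<open>U\<close> stands for \<open>D\<close> together with \<open>c i\<close>,
    ..., \<open>c (n - 1)\<close>. The last clause expresses independence modulo \<open>D\<close> in
    the form that shows the next vector to be new: \<open>c i\<close> has \<open>v\<close> in block
    i and zero above.\<close>
  define good where "good i U \<longleftrightarrow> flag ?\<Phi> U (drop i rs @ cs) \<and> D \<subseteq> U \<and> U \<subseteq> dirsum_mod n (adjoin v E) \<and>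
     (\<forall>j. i \<le> j \<longrightarrow> j < n \<longrightarrow> c j \<in> U) \<and> (\<forall>x\<in>U. (\<forall>j\<ge>i. block j x \<in> E) \<longrightarrow> x \<in> D)" for i U
  have "\<exists>U. good i U" if "i \<le> n" for i
    using that
  \<comment> \<open>Downwards from n to 0: \<open>c (n - 1)\<close>, with the longest partial
    product, is an eigenvector modulo \<open>D\<close> and is adjoined at the bottom.\<close>
  proof (induction i rule: inc_induct)
    case base
    have "good n D"
      using flag rs(2) dirsum_mono[OF subset_adjoin] by (auto simp: good_def D_def)
    thus ?case ..
  next
    case (step i)
    then obtain U where U: "good (Suc i) U" by blast
    have i: "i < n" using step by simp
    have flagU: "flag ?\<Phi> U (drop (Suc i) rs @ cs)" and DU: "D \<subseteq> U" "U \<subseteq> dirsum_mod n (adjoin v E)"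
      and cU: "\<And>j. Suc i \<le> j \<Longrightarrow> j < n \<Longrightarrow> c j \<in> U"
      and UD: "\<And>x. x \<in> U \<Longrightarrow> (\<And>j. j \<ge> Suc i \<Longrightarrow> block j x \<in> E) \<Longrightarrow> x \<in> D"
      using U by (auto simp: good_def)
    note sU = flag_subspace[OF flagU]
    have hi: "block j (c i) = 0" if "j > i" for j using top(2)[of i j] i that by (simp add: block_c)
    have ci: "block i (c i) = v" using top(1)[of i] i by (simp add: block_c)
    have 1: "c i \<notin> U"
    proof
      assume "c i \<in> U"
      hence "c i \<in> D" using UD hi fmod.subspace_0[OF E(1)] by simp
      hence "block i (c i) \<in> E" using i by (simp add: D_def dirsum_mod_def)
      thus False using ci E(2) by simp
    qed
    have 2: "?\<Phi> (c i) - fscale (rs ! i) (c i) \<in> U"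
    proof (cases "Suc i < n")
      case True thus ?thesis using Phi_c cU by simp
    next
      case False
      hence "i = n - 1" using i by simp
      thus ?thesis using Phi_last DU(1) by auto
    qed
    have "drop i rs = rs ! i # drop (Suc i) rs" using i rs(2) by (simp add: Cons_nth_drop_Suc)
    hence F: "flag ?\<Phi> (adjoin (c i) U) (drop i rs @ cs)" using flag.Cons[OF flagU 1 2] by simp
    have "x \<in> D" if x: "x \<in> adjoin (c i) U" "\<And>j. j \<ge> i \<Longrightarrow> block j x \<in> E" for x
    proof -
      obtain y d where y: "x = y + fscale d (c i)" "y \<in> U" using x(1) by (rule adjoinE)
      have "block j y \<in> E" if "j \<ge> Suc i" for j
        using x(2)[of j] that hi[of j] unfolding y(1) by (simp add: Suc_le_eq)
      hence yD: "y \<in> D" using UD[OF y(2)] by blast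
      hence yi: "block i y \<in> E" using i by (simp add: D_def dirsum_mod_def)
      have "block i x - block i y \<in> E" by (rule fmod.subspace_diff[OF E(1) x(2)[OF order_refl] yi])
      moreover have "block i x - block i y = fscale d v" unfolding y(1) by (simp add: ci)
      ultimately have dv: "fscale d v \<in> E" by simp
      have "d = 0"
      proof (rule ccontr)
        assume d: "d \<noteq> 0"
        have "fscale (inverse d) (fscale d v) \<in> E" by (rule fmod.subspace_scale[OF E(1) dv])
        thus False using E(2) d by simp
      qed
      thus ?thesis using y(1) yD by simp
    qed
    moreover have "D \<subseteq> adjoin (c i) U" using DU(1) subset_adjoin by blast
    moreover have "adjoin (c i) U \<subseteq> dirsum_mod n (adjoin v E)"
      by (rule adjoin_least[OF subspace_dirsum[OF adjoin_subspace[OF E(1)]] DU(2) c_in[OF i]])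
    moreover have "c j \<in> adjoin (c i) U" if "i \<le> j" "j < n" for j
      using cU[of j] that mem_adjoin[OF sU, of "c i"] subset_adjoin[of U "c i"] by (cases "i = j") auto
    ultimately have "good i (adjoin (c i) U)" using F unfolding good_def by blast
    thus ?case ..
  qed
  from this[of 0] obtain U where U: "good 0 U" by auto
  have sU: "fmod.subspace U" using U flag_subspace unfolding good_def by blast
  \<comment> \<open>Division by monic polynomials: multiples of \<open>c i\<close> are subtracted to
    bring the blocks into \<open>E\<close> from the top down.\<close>
  have "x \<in> U" if "x \<in> dirsum_mod n (adjoin v E)" "\<And>j. j \<ge> i \<Longrightarrow> block j x \<in> E" "i \<le> n" for i x
    using that
  proof (induction i arbitrary: x)
    case 0
    hence "x \<in> D" unfolding D_def dirsum_mod_def by auto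
    thus ?case using U by (auto simp: good_def)
  next
    case (Suc i)
    have i: "i < n" using Suc.prems(3) by simp
    have "block i x \<in> adjoin v E" using Suc.prems(1) i by (simp add: dirsum_mod_def)
    then obtain e d where e: "block i x = e + fscale d v" "e \<in> E" by (rule adjoinE)
    let ?y = "x - fscale d (c i)"
    have cU: "c i \<in> U" using U i by (auto simp: good_def)
    have "?y \<in> U"
    proof (rule Suc.IH)
      show "?y \<in> dirsum_mod n (adjoin v E)"
        using Suc.prems(1) c_in[OF i] subspace_dirsum[OF adjoin_subspace[OF E(1)]]
        by (intro fmod.subspace_diff fmod.subspace_scale)
      show "block j ?y \<in> E" if "j \<ge> i" for j
      proof (cases "j = i")
        case True
        thus ?thesis using e top(1)[of i] i by (simp add: block_diff block_c)
      next
        case False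
        thus ?thesis using Suc.prems(2)[of j] top(2)[of i j] i that by (simp add: block_diff block_c)
      qed
    qed (use i in simp)
    from fmod.subspace_add[OF sU this fmod.subspace_scale[OF sU cU, of d]] show ?case by simp
  qed
  from this[of _ n] have "dirsum_mod n (adjoin v E) \<subseteq> U"
    using fmod.subspace_0[OF E(1)] by (auto simp: dirsum_mod_def)
  hence "U = dirsum_mod n (adjoin v E)" using U by (auto simp: good_def)
  thus ?thesis using U by (simp add: good_def)
qed

lemma flag_shift:
  assumes "flag f E as" "mod_hom M M f" "fmod.subspace M" "E \<subseteq> M" "n > 0"
  shows "flag (shift_map n f) (dirsum_mod n E) (concat (map (root_list n) as))"
  using assms(1,4)
proof (induction rule: flag.induct)
  case Nil
  have "dirsum_mod n {0} = ({0} :: (nat \<Rightarrow> 'a) set)"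
  proof (intro equalityI subsetI)
    fix x :: "nat \<Rightarrow> 'a" assume "x \<in> dirsum_mod n {0}"
    hence "block j x = block j 0" for j by (cases "j < n") (auto simp: dirsum_mod_def)
    thus "x \<in> {0}" using blocks_eqI by blast
  qed (auto simp: dirsum_mod_def)
  thus ?case using flag.Nil by (simp only: list.map concat.simps)
next
  case (Cons E as v a)
  note sE = flag_subspace[OF Cons.hyps(1)]
  have M: "E \<subseteq> M" "v \<in> M" using Cons.prems subset_adjoin mem_adjoin[OF sE] by blast+
  show ?case
    using flag_shift_step[OF assms(2,3) M sE Cons.hyps(2,3) assms(5)
        prod_root_list[OF assms(5)] length_root_list[OF assms(5)] Cons.IH[OF M(1)]] by simp
qed

section \<open>The divisor of an endomorphism and the structure of \<open>W\<^sub>0\<close>\<close>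

lemma endo_tensor_simps:
  "endo_mod (endo_tensor X Y) = tensor_mod (endo_mod X) (endo_mod Y)"
  "endo_map (endo_tensor X Y) = tensor_map (endo_map X) (endo_map Y)"
  by (simp_all add: endo_mod_def endo_map_def endo_tensor.rep_eq case_prod_beta)

lemma endo_power_simps:
  "endo_mod (endo_power n X) = endo_mod X" "endo_map (endo_power n X) = endo_map X ^^ n"
  by (simp_all add: endo_mod_def endo_map_def endo_power.rep_eq case_prod_beta)

lemma endo_shift_simps:
  "endo_mod (endo_shift n X) = dirsum_mod n (endo_mod X)"
  "endo_map (endo_shift n X) = shift_map n (endo_map X)"
  by (simp_all add: endo_mod_def endo_map_def endo_shift.rep_eq case_prod_beta)

lemma subspace_endo_mod: "fmod.subspace (endo_mod X)"
  using endo_mod_map(1) finite_projective_subspace by blast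

text \<open>The value 0 at a = 0 drops zero eigenvalues without filtering lists, hides the
  meaningless value of \<sigma> at 0 and makes \<open>point\<close> multiplicative on the whole
  field.\<close>

definition point :: "('k::field \<Rightarrow> qmodz) \<Rightarrow> 'k \<Rightarrow> group_ring" where
  "point \<sigma> a = (if a = 0 then 0 else group_elem (\<sigma> a))"

lemma endo_divisor_point:
  assumes "flag (endo_map X) (endo_mod X) as"
  shows "endo_divisor \<sigma> X = (\<Sum>a\<leftarrow>as. point \<sigma> a)"
proof -
  have "(\<Sum>a\<leftarrow>filter (\<lambda>a. a \<noteq> 0) as. group_elem (\<sigma> a)) = (\<Sum>a\<leftarrow>as. point \<sigma> a)"
    by (induction as) (auto simp: point_def)
  thus ?thesis using endo_divisor_flag[OF assms] by simp
qed

lemma sum_list_concat_map: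
  "(\<Sum>x\<leftarrow>concat (map g xs). f x) = (\<Sum>y\<leftarrow>xs. \<Sum>x\<leftarrow>g y. f x)" for f :: "'a \<Rightarrow> 'b::comm_monoid_add"
  by (induction xs) simp_all

lemma endo_divisor_tensor:
  fixes X Y :: "'k::alg_closed_field endo"
  assumes \<sigma>: "\<And>a b. a \<noteq> 0 \<Longrightarrow> b \<noteq> 0 \<Longrightarrow> \<sigma> (a * b) = \<sigma> a + \<sigma> b"
  shows "endo_divisor \<sigma> (endo_tensor X Y) = endo_divisor \<sigma> X * endo_divisor \<sigma> Y"
proof -
  obtain as bs where as: "flag (endo_map X) (endo_mod X) as" and bs: "flag (endo_map Y) (endo_mod Y) bs"
    using flag_exists by metis
  have mult: "point \<sigma> (a * b) = point \<sigma> a * point \<sigma> b" for a b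
    by (auto simp: point_def \<sigma> mult_single)
  have "flag (endo_map (endo_tensor X Y)) (endo_mod (endo_tensor X Y))
      (concat (map (\<lambda>a. map ((*) a) bs) as))"
    unfolding endo_tensor_simps
    by (rule flag_tensor[OF as endo_mod_map(2) order_refl bs endo_mod_map(2)])
  from endo_divisor_point[OF this]
  have "endo_divisor \<sigma> (endo_tensor X Y) = (\<Sum>a\<leftarrow>as. \<Sum>b\<leftarrow>bs. point \<sigma> a * point \<sigma> b)"
    by (simp add: sum_list_concat_map o_def mult)
  also have "\<dots> = (\<Sum>a\<leftarrow>as. point \<sigma> a) * (\<Sum>b\<leftarrow>bs. point \<sigma> b)"
    by (simp add: sum_list_const_mult sum_list_mult_const)
  finally show ?thesis by (simp add: endo_divisor_point[OF as] endo_divisor_point[OF bs])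
qed

lemma endo_divisor_zero_map:
  assumes "\<And>v. v \<in> endo_mod X \<Longrightarrow> endo_map X v = 0"
  shows "endo_divisor \<sigma> X = 0"
proof -
  have "endo_eigenvalues X - {0} = {}"
    using assms by (auto simp: endo_eigenvalues_def)
  thus ?thesis unfolding endo_divisor_def by (simp only: sum.empty)
qed

section \<open>The divisor on \<open>K0_End\<close> and on \<open>W0\<close>\<close>

definition frag_divisor :: "('k::field \<Rightarrow> qmodz) \<Rightarrow> ('k endo \<Rightarrow>\<^sub>0 int) \<Rightarrow> group_ring" where
  "frag_divisor \<sigma> = frag_extend (endo_divisor \<sigma>)"

lemma frag_divisor_simps [simp]:
  "frag_divisor \<sigma> 0 = 0" "frag_divisor \<sigma> (a - b) = frag_divisor \<sigma> a - frag_divisor \<sigma> b"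
  "frag_divisor \<sigma> (a + b) = frag_divisor \<sigma> a + frag_divisor \<sigma> b"
  "frag_divisor \<sigma> (frag_of X) = endo_divisor \<sigma> X"
  by (simp_all add: frag_divisor_def frag_extend_diff frag_extend_add)

text \<open>By \<open>flag_short_exact\<close> flags of the two ends concatenate to a flag of the
  middle term, so each relator has divisor zero.\<close>

lemma frag_divisor_relators:
  fixes z :: "'k::alg_closed_field endo \<Rightarrow>\<^sub>0 int"
  assumes "z \<in> subgroup_generated K0_relators"
  shows "frag_divisor \<sigma> z = 0"
  using assms
proof induction
  case (base z)
  then obtain X Y Z where z: "z = frag_of Y - frag_of X - frag_of Z" "short_exact X Y Z"
    by (auto simp: K0_relators_def)
  obtain as cs where as: "flag (endo_map X) (endo_mod X) as" and cs: "flag (endo_map Z) (endo_mod Z) cs"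
    using flag_exists by metis
  show ?case
    using endo_divisor_point[OF flag_short_exact[OF z(2) as cs], of \<sigma>]
      endo_divisor_point[OF as, of \<sigma>] endo_divisor_point[OF cs, of \<sigma>]
    by (simp add: z(1))
qed simp_all

lemma abs_rep_K0_End [simp]: "abs_K0_End (rep_K0_End x) = x"
  by (rule Quotient3_abs_rep[OF Quotient3_K0_End])

lemma abs_rep_W0 [simp]: "abs_W0 (rep_W0 x) = x"
  by (rule Quotient3_abs_rep[OF Quotient3_W0])

lemma frag_divisor_rep_abs:
  fixes z :: "'k::alg_closed_field endo \<Rightarrow>\<^sub>0 int"
  shows "frag_divisor \<sigma> (rep_K0_End (abs_K0_End z)) = frag_divisor \<sigma> z"
proof -
  have "rep_K0_End (abs_K0_End z) - z \<in> subgroup_generated K0_relators"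
    using K0_End.abs_eq_iff[of "rep_K0_End (abs_K0_End z)" z] by simp
  from frag_divisor_relators[OF this, of \<sigma>] show ?thesis by simp
qed

definition K0_divisor :: "('k::field \<Rightarrow> qmodz) \<Rightarrow> 'k K0_End \<Rightarrow> group_ring" where
  "K0_divisor \<sigma> x = frag_divisor \<sigma> (rep_K0_End x)"

lemma K0_divisor_abs [simp]: "K0_divisor \<sigma> (abs_K0_End z) = frag_divisor \<sigma> z"
  for z :: "'k::alg_closed_field endo \<Rightarrow>\<^sub>0 int"
  by (simp add: K0_divisor_def frag_divisor_rep_abs)

lemma K0_divisor_simps [simp]:
  fixes x y :: "'k::alg_closed_field K0_End"
  shows "K0_divisor \<sigma> 0 = 0" "K0_divisor \<sigma> (x - y) = K0_divisor \<sigma> x - K0_divisor \<sigma> y"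
    "K0_divisor \<sigma> (x + y) = K0_divisor \<sigma> x + K0_divisor \<sigma> y"
proof -
  show "K0_divisor \<sigma> 0 = 0" by (simp add: zero_K0_End.abs_eq)
  have xy: "x = abs_K0_End (rep_K0_End x)" "y = abs_K0_End (rep_K0_End y)" by simp_all
  show "K0_divisor \<sigma> (x - y) = K0_divisor \<sigma> x - K0_divisor \<sigma> y"
    by (subst (1 2) xy(1), subst (1 2) xy(2)) (simp only: minus_K0_End.abs_eq K0_divisor_abs frag_divisor_simps)
  show "K0_divisor \<sigma> (x + y) = K0_divisor \<sigma> x + K0_divisor \<sigma> y"
    by (subst (1 2) xy(1), subst (1 2) xy(2)) (simp only: plus_K0_End.abs_eq K0_divisor_abs frag_divisor_simps)
qed

text \<open>Shaped after \<open>times_K0_End\<close>: bilinearity in the formal sums reduces the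
  product of classes to single pairs.\<close>

lemma frag_extend_bilinear:
  assumes "\<And>i j. frag_divisor \<sigma> (h i j) = u i * v j"
  shows "frag_divisor \<sigma> (frag_extend (\<lambda>i. frag_extend (h i) y) x) = frag_extend u x * frag_extend v y"
proof -
  have inner: "frag_divisor \<sigma> (frag_extend (h i) y) = u i * frag_extend v y" for i
    using subset_UNIV
    by (induction y rule: frag_induction) (auto simp: assms frag_extend_diff algebra_simps)
  show ?thesis
    using subset_UNIV
    by (induction x rule: frag_induction) (auto simp: inner frag_extend_diff algebra_simps)
qed

lemma K0_divisor_mult:
  fixes x y :: "'k::alg_closed_field K0_End"
  assumes "\<And>a b. a \<noteq> 0 \<Longrightarrow> b \<noteq> 0 \<Longrightarrow> \<sigma> (a * b) = \<sigma> a + \<sigma> b"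
  shows "K0_divisor \<sigma> (x * y) = K0_divisor \<sigma> x * K0_divisor \<sigma> y"
  unfolding times_K0_End_def K0_divisor_abs
  by (subst frag_extend_bilinear[of _ _ "endo_divisor \<sigma>" "endo_divisor \<sigma>"])
    (simp_all add: endo_divisor_tensor[OF assms] K0_divisor_def frag_divisor_def)

text \<open>A zero map has no non-zero eigenvalue; closure of the ideal under multiplication is
  where multiplicativity of the divisor enters.\<close>

lemma K0_divisor_ideal:
  fixes x :: "'k::alg_closed_field K0_End"
  assumes "\<And>a b. a \<noteq> 0 \<Longrightarrow> b \<noteq> 0 \<Longrightarrow> \<sigma> (a * b) = \<sigma> a + \<sigma> b" "x \<in> K0_ideal"
  shows "K0_divisor \<sigma> x = 0"
  using assms(2)
  by induction (simp_all add: K0_class_def K0_divisor_mult[OF assms(1)] endo_divisor_zero_map)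

definition W0_class :: "('k::comm_ring_1 endo \<Rightarrow>\<^sub>0 int) \<Rightarrow> 'k W0" where
  "W0_class z = abs_W0 (abs_K0_End z)"

lemma W0_class_simps [simp]:
  "W0_class 0 = 0" "W0_class (a - b) = W0_class a - W0_class b" "W0_class (a + b) = W0_class a + W0_class b"
  by (simp_all add: W0_class_def zero_W0.abs_eq zero_K0_End.abs_eq minus_W0.abs_eq minus_K0_End.abs_eq
      plus_W0.abs_eq plus_K0_End.abs_eq)

lemma W0_class_rep [simp]: "W0_class (rep_K0_End (rep_W0 x)) = x"
  by (simp add: W0_class_def)

lemma W0_extend_eq: "W0_extend \<phi> x = W0_class (frag_extend (\<lambda>X. frag_of (\<phi> X)) (rep_K0_End (rep_W0 x)))"
  by (simp add: W0_extend_def W0_class_def)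

lemma W0_class_short_exact:
  assumes "short_exact X Y Z"
  shows "W0_class (frag_of Y) = W0_class (frag_of X) + W0_class (frag_of Z)"
proof -
  have "frag_of Y - frag_of X - frag_of Z \<in> K0_relators"
    using assms unfolding K0_relators_def by blast
  hence "frag_of Y - (frag_of X + frag_of Z) \<in> subgroup_generated K0_relators"
    by (simp add: diff_diff_eq subgroup_generated.base)
  hence "abs_K0_End (frag_of Y) = abs_K0_End (frag_of X + frag_of Z)"
    by (simp add: K0_End.abs_eq_iff)
  hence "W0_class (frag_of Y) = W0_class (frag_of X + frag_of Z)" by (simp add: W0_class_def)
  thus ?thesis by simp
qed

lemma W0_class_zero_map:
  assumes "\<And>v. v \<in> endo_mod X \<Longrightarrow> endo_map X v = 0"
  shows "W0_class (frag_of X) = 0"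
proof -
  have "K0_class X - 0 \<in> K0_ideal" using K0_ideal.base[OF assms] by simp
  thus ?thesis unfolding W0_class_def zero_W0.abs_eq K0_class_def W0.abs_eq_iff .
qed

context
  fixes \<sigma> :: "'k::alg_closed_field \<Rightarrow> qmodz"
  assumes \<sigma>: "\<And>a b. a \<noteq> 0 \<Longrightarrow> b \<noteq> 0 \<Longrightarrow> \<sigma> (a * b) = \<sigma> a + \<sigma> b"
begin

text \<open>Independence of the two nested choices in \<open>sigma_tilde\<close>, a representative
  in \<open>K0_End\<close> and then a formal sum.\<close>

lemma sigma_tilde_class: "sigma_tilde \<sigma> (W0_class z) = frag_divisor \<sigma> z"
proof -
  let ?x = "abs_K0_End z"
  have "rep_W0 (abs_W0 ?x) - ?x \<in> K0_ideal"
    using W0.abs_eq_iff[of "rep_W0 (abs_W0 ?x)" ?x] by simp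
  from K0_divisor_ideal[OF \<sigma> this] have "K0_divisor \<sigma> (rep_W0 (abs_W0 ?x)) = K0_divisor \<sigma> ?x" by simp
  thus ?thesis by (simp add: W0_class_def sigma_tilde_def K0_divisor_def frag_divisor_rep_abs flip: frag_divisor_def)
qed

lemma sigma_tilde_rep: "frag_divisor \<sigma> (rep_K0_End (rep_W0 x)) = sigma_tilde \<sigma> x"
  by (simp add: sigma_tilde_def frag_divisor_def)

lemma sigma_tilde_add: "sigma_tilde \<sigma> (x + y) = sigma_tilde \<sigma> x + sigma_tilde \<sigma> y"
  using sigma_tilde_class[of "rep_K0_End (rep_W0 x) + rep_K0_End (rep_W0 y)"]
  by (simp add: sigma_tilde_rep)

lemma sigma_tilde_diff: "sigma_tilde \<sigma> (x - y) = sigma_tilde \<sigma> x - sigma_tilde \<sigma> y"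
  using sigma_tilde_class[of "rep_K0_End (rep_W0 x) - rep_K0_End (rep_W0 y)"]
  by (simp add: sigma_tilde_rep)

lemma sigma_tilde_mult: "sigma_tilde \<sigma> (x * y) = sigma_tilde \<sigma> x * sigma_tilde \<sigma> y"
proof -
  have xy: "x * y = W0_class (rep_K0_End (rep_W0 x * rep_W0 y))"
    by (simp add: times_W0_def W0_class_def)
  have "sigma_tilde \<sigma> (x * y) = K0_divisor \<sigma> (rep_W0 x * rep_W0 y)"
    by (simp only: xy sigma_tilde_class K0_divisor_def)
  also have "\<dots> = K0_divisor \<sigma> (rep_W0 x) * K0_divisor \<sigma> (rep_W0 y)"
    by (rule K0_divisor_mult[OF \<sigma>])
  finally show ?thesis by (simp add: K0_divisor_def sigma_tilde_rep)
qed

text \<open>\<open>W0_extend\<close> acts on one chosen formal sum, and divisors do not see that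
  choice; so the effect of \<phi> on the divisors of single pairs determines the image.\<close>

lemma sigma_tilde_extend:
  assumes "\<And>X. endo_divisor \<sigma> (\<phi> X) = \<psi> (endo_divisor \<sigma> X)" "Modules.additive \<psi>"
  shows "sigma_tilde \<sigma> (W0_extend \<phi> x) = \<psi> (sigma_tilde \<sigma> x)"
proof -
  have "frag_divisor \<sigma> (frag_extend (\<lambda>X. frag_of (\<phi> X)) z) = \<psi> (frag_divisor \<sigma> z)" for z
    using subset_UNIV
    by (induction z rule: frag_induction)
      (auto simp: assms(1) frag_extend_diff additive.zero[OF assms(2)] additive.diff[OF assms(2)])
  thus ?thesis unfolding W0_extend_eq sigma_tilde_class by (simp add: sigma_tilde_rep)
qed

end

section \<open>Rank one pairs and the inverse of \<open>sigma_tilde\<close>\<close>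

lift_definition rank_one :: "'k::field \<Rightarrow> 'k endo" is "\<lambda>a. (free_on {0}, fscale a)"
proof -
  fix a :: 'k
  have "finite_projective (free_on {0} :: (nat \<Rightarrow> 'k) set)"
    by (rule finite_projective_subspace_free_on[OF _ subspace_free_on order_refl]) simp
  moreover have "mod_hom (free_on {0}) (free_on {0}) (fscale a)"
    by (auto simp: mod_hom_def free_on_def fscale_def fun_eq_iff algebra_simps)
  ultimately show "(free_on {0}, fscale a) \<in> {(E, f). finite_projective E \<and> mod_hom E E f}" by simp
qed

lemma rank_one_simps: "endo_mod (rank_one a) = free_on {0}" "endo_map (rank_one a) = fscale a"
  by (simp_all add: endo_mod_def endo_map_def rank_one.rep_eq)

lemma flag_rank_one: "flag (endo_map (rank_one a)) (endo_mod (rank_one a)) [a]"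
proof -
  define d where "d = (\<lambda>i::nat. if i = 0 then 1 else 0 :: 'a)"
  have "adjoin d {0} = free_on {0}"
  proof (intro equalityI subsetI)
    fix x assume "x \<in> adjoin d {0}"
    thus "x \<in> free_on {0}" by (auto elim!: adjoinE simp: free_on_def d_def fscale_def)
  next
    fix x :: "nat \<Rightarrow> 'a" assume "x \<in> free_on {0}"
    hence "x = 0 + fscale (x 0) d" by (auto simp: fun_eq_iff free_on_def d_def fscale_def)
    thus "x \<in> adjoin d {0}" using adjoinI[of 0 "{0}" "x 0" d] by simp
  qed
  moreover have "d \<notin> {0}" by (auto simp: d_def fun_eq_iff)
  ultimately show ?thesis
    using flag.Cons[OF flag.Nil, of d "fscale a" a] by (simp add: rank_one_simps)
qed

lemma endo_divisor_rank_one: "endo_divisor \<sigma> (rank_one a) = point \<sigma> a"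
  using endo_divisor_point[OF flag_rank_one, of \<sigma> a] by simp

lemma W0_class_rank_one_0: "W0_class (frag_of (rank_one 0)) = 0"
  by (rule W0_class_zero_map) (simp add: rank_one_simps)

lemma Abs_endo_simps:
  assumes "finite_projective E" "mod_hom E E f"
  shows "endo_mod (Abs_endo (E, f)) = E" "endo_map (Abs_endo (E, f)) = f"
  using assms by (simp_all add: endo_mod_def endo_map_def Abs_endo_inverse)

text \<open>A flag step read as an exact sequence from E through E + k v to k, the last with
  multiplication by \<open>a\<close>.\<close>

lemma short_exact_adjoin:
  assumes f: "mod_hom M M f" and I: "finite I" "M \<subseteq> free_on I"
    and E: "flag f E as" "v \<notin> E" "f v - fscale a v \<in> E" and M: "adjoin v E \<subseteq> M"
  shows "short_exact (Abs_endo (E, f)) (Abs_endo (adjoin v E, f)) (rank_one a)"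
proof -
  note sE = flag_subspace[OF E(1)]
  have fl: "flag f (adjoin v E) (a # as)" using E by (rule flag.Cons)
  have EM: "E \<subseteq> M" using M subset_adjoin by blast
  have fp: "finite_projective E" "finite_projective (adjoin v E)"
    using finite_projective_subspace_free_on[OF I(1) sE]
      finite_projective_subspace_free_on[OF I(1) adjoin_subspace[OF sE]] EM M I(2) by blast+
  have hom: "mod_hom E E f" "mod_hom (adjoin v E) (adjoin v E) f"
    using flag_invariant[OF E(1) f EM] flag_invariant[OF fl f M] .
  obtain g where g: "mod_hom UNIV UNIV g" "\<And>x. x \<in> E \<Longrightarrow> g x = 0" "g v = v"
    using subspace_separation[OF sE E(2)] by metis
  have "v \<noteq> 0" using fmod.subspace_0[OF sE] E(2) by blast
  then obtain i0 where i0: "v i0 \<noteq> 0" by (auto simp: fun_eq_iff)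
  define d where "d = (\<lambda>i::nat. if i = 0 then 1 else 0 :: 'a)"
  \<comment> \<open>The coefficient of \<open>v\<close>: since \<open>g\<close> kills
    \<open>E\<close> and fixes \<open>v\<close>, dividing by the non-zero entry \<open>v i0\<close>
    turns its value into a scalar.\<close>
  define q where "q y = fscale (g y i0 / v i0) d" for y
  have q: "q (x + fscale c v) = fscale c d" if "x \<in> E" for x c
    using mod_homD(2,3)[OF g(1)] g(2)[OF that] g(3) i0 by (simp add: q_def) (simp add: fscale_def)
  have q_hom: "mod_hom (adjoin v E) (free_on {0}) q"
    using mod_homD(2,3)[OF g(1)]
    by (auto simp: mod_hom_def q_def free_on_def d_def fscale_def fun_eq_iff algebra_simps add_divide_distrib)
  have q_eq: "q (f y) = fscale a (q y)" if y: "y \<in> adjoin v E" for y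
  proof -
    obtain x c where x: "y = x + fscale c v" "x \<in> E" using y by (rule adjoinE)
    have "fscale c v \<in> adjoin v E"
      by (rule fmod.subspace_scale[OF adjoin_subspace[OF sE] mem_adjoin[OF sE]])
    hence "f y = f x + fscale c (f v)"
      using mod_homD(2)[OF hom(2), of x "fscale c v"] mod_homD(3)[OF hom(2) mem_adjoin[OF sE], of c]
        x subset_adjoin[of E v] by auto
    hence "f y = (f x + fscale c (f v - fscale a v)) + fscale (c * a) v"
      by (simp add: fmod.scale_right_diff_distrib)
    moreover have "f x + fscale c (f v - fscale a v) \<in> E"
      using mod_homD(1)[OF hom(1) x(2)] fmod.subspace_scale[OF sE E(3)] by (rule fmod.subspace_add[OF sE])
    ultimately have "q (f y) = fscale (c * a) d" using q by simp
    thus ?thesis using q[OF x(2), of c] x(1) by (simp add: mult.commute)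
  qed
  have d0: "fscale c d = 0 \<longleftrightarrow> c = 0" for c by (auto simp: fscale_def d_def fun_eq_iff)
  have ker: "E = {y \<in> adjoin v E. q y = 0}"
  proof (intro equalityI subsetI)
    fix x assume "x \<in> E"
    thus "x \<in> {y \<in> adjoin v E. q y = 0}" using q[of x 0] subset_adjoin[of E v] by auto
  next
    fix y assume "y \<in> {y \<in> adjoin v E. q y = 0}"
    then obtain x c where x: "y = x + fscale c v" "x \<in> E" "q y = 0" by (auto elim: adjoinE)
    hence "c = 0" using q[OF x(2), of c] d0[of c] by simp
    thus "y \<in> E" using x by simp
  qed
  have surj: "q ` adjoin v E = free_on {0}"
  proof (intro equalityI subsetI)
    fix z :: "nat \<Rightarrow> 'a" assume z: "z \<in> free_on {0}"
    have "z = q (0 + fscale (z 0) v)"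
      unfolding q[OF fmod.subspace_0[OF sE]] using z by (auto simp: fun_eq_iff free_on_def d_def fscale_def)
    thus "z \<in> q ` adjoin v E" using adjoinI[OF fmod.subspace_0[OF sE]] by blast
  qed (use mod_homD(1)[OF q_hom] in blast)
  have id: "mod_hom E (adjoin v E) (\<lambda>x. x)" using subset_adjoin[of E v] by (auto simp: mod_hom_def)
  show ?thesis
    unfolding short_exact_def Abs_endo_simps[OF fp(1) hom(1)] Abs_endo_simps[OF fp(2) hom(2)] rank_one_simps
    by (rule exI[of _ "\<lambda>x. x"], rule exI[of _ q]) (simp add: id q_hom q_eq surj flip: ker)
qed

lemma W0_class_flag:
  fixes X :: "'k::field endo"
  assumes "flag (endo_map X) E as" "E \<subseteq> endo_mod X"
  shows "W0_class (frag_of (Abs_endo (E, endo_map X))) = (\<Sum>a\<leftarrow>as. W0_class (frag_of (rank_one a)))"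
  using assms
proof (induction rule: flag.induct)
  case Nil
  have *: "finite_projective {0 :: nat \<Rightarrow> 'k}" "mod_hom {0} {0} (endo_map X)"
    using finite_projective_subspace_free_on[of "{}" "{0}"] mod_hom_0[OF endo_mod_map(2) subspace_endo_mod, of X]
    by (auto simp: fmod.subspace_single_0 free_on_def mod_hom_def)
  have "W0_class (frag_of (Abs_endo ({0}, endo_map X))) = 0"
    by (rule W0_class_zero_map)
      (simp add: Abs_endo_simps[OF *] mod_hom_0[OF endo_mod_map(2) subspace_endo_mod])
  thus ?case by (simp only: list.map sum_list.Nil)
next
  case (Cons E as v a)
  obtain I where I: "finite I" "endo_mod X \<subseteq> free_on I"
    using finite_projectiveE[OF endo_mod_map(1)] by metis
  have "E \<subseteq> endo_mod X" using Cons.prems subset_adjoin by blast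
  thus ?case
    using W0_class_short_exact[OF short_exact_adjoin[OF endo_mod_map(2) I Cons.hyps Cons.prems]] Cons.IH
    by (simp add: add.commute)
qed

lemma W0_class_endo:
  assumes "flag (endo_map X) (endo_mod X) as"
  shows "W0_class (frag_of X) = (\<Sum>a\<leftarrow>as. W0_class (frag_of (rank_one a)))"
proof -
  have "Abs_endo (endo_mod X, endo_map X) = X"
    by (simp add: endo_mod_def endo_map_def Rep_endo_inverse)
  thus ?thesis using W0_class_flag[OF assms order_refl] by simp
qed

text \<open>The inverse of the divisor on formal sums. Outside the image of \<sigma> its value is an
  arbitrary rank one pair.\<close>

definition lift_divisor :: "('k::field \<Rightarrow> qmodz) \<Rightarrow> group_ring \<Rightarrow> 'k endo \<Rightarrow>\<^sub>0 int" where
  "lift_divisor \<sigma> = frag_extend (\<lambda>\<gamma>. frag_of (rank_one (inv_into (UNIV - {0}) \<sigma> \<gamma>)))"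

context
  fixes \<sigma> :: "'k::alg_closed_field \<Rightarrow> qmodz"
  assumes \<sigma>: "\<And>a b. a \<noteq> 0 \<Longrightarrow> b \<noteq> 0 \<Longrightarrow> \<sigma> (a * b) = \<sigma> a + \<sigma> b"
    and inj: "inj_on \<sigma> (UNIV - {0})"
begin

lemma W0_class_lift_point: "W0_class (lift_divisor \<sigma> (point \<sigma> a)) = W0_class (frag_of (rank_one a))"
  using inv_into_f_f[OF inj, of a] by (simp add: point_def lift_divisor_def W0_class_rank_one_0)

text \<open>The source of injectivity: a class is the sum of the rank one classes along a flag, and
  the non-zero eigenvalues are recovered from the divisor because \<sigma> is injective on them.
  Zero eigenvalues contribute zero on both sides.\<close>

lemma W0_class_lift_divisor: "W0_class (lift_divisor \<sigma> (frag_divisor \<sigma> z)) = W0_class z"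
  using subset_UNIV
proof (induction z rule: frag_induction)
  case (one X)
  obtain as where as: "flag (endo_map X) (endo_mod X) as" using flag_exists by blast
  have "W0_class (lift_divisor \<sigma> (\<Sum>a\<leftarrow>as. point \<sigma> a)) = (\<Sum>a\<leftarrow>as. W0_class (frag_of (rank_one a)))"
  proof (induction as)
    case (Cons a as)
    have "lift_divisor \<sigma> (\<Sum>a\<leftarrow>a # as. point \<sigma> a) =
        lift_divisor \<sigma> (point \<sigma> a) + lift_divisor \<sigma> (\<Sum>a\<leftarrow>as. point \<sigma> a)"
      by (simp add: lift_divisor_def frag_extend_add)
    thus ?case using Cons W0_class_lift_point[of a] by simp
  qed (simp add: lift_divisor_def)
  thus ?case by (simp add: endo_divisor_point[OF as] W0_class_endo[OF as])
qed (simp_all add: lift_divisor_def frag_extend_diff)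

lemma frag_divisor_lift:
  assumes "Poly_Mapping.keys g \<subseteq> \<sigma> ` (UNIV - {0})"
  shows "frag_divisor \<sigma> (lift_divisor \<sigma> g) = g"
  using assms
proof (induction g rule: frag_induction)
  case (one \<gamma>)
  have "inv_into (UNIV - {0}) \<sigma> \<gamma> \<noteq> 0" "\<sigma> (inv_into (UNIV - {0}) \<sigma> \<gamma>) = \<gamma>"
    using one inv_into_into[of \<gamma> \<sigma> "UNIV - {0}"] f_inv_into_f[of \<gamma> \<sigma> "UNIV - {0}"] by auto
  thus ?case by (simp add: lift_divisor_def endo_divisor_rank_one point_def)
qed (simp_all add: lift_divisor_def frag_extend_diff)

lemma keys_frag_divisor: "Poly_Mapping.keys (frag_divisor \<sigma> z) \<subseteq> \<sigma> ` (UNIV - {0})"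
  using subset_UNIV
proof (induction z rule: frag_induction)
  case (one X)
  obtain as where as: "flag (endo_map X) (endo_mod X) as" using flag_exists by blast
  have "Poly_Mapping.keys (\<Sum>a\<leftarrow>as. point \<sigma> a) \<subseteq> \<sigma> ` (UNIV - {0})"
  proof (induction as)
    case (Cons a as)
    thus ?case using Poly_Mapping.keys_add[of "point \<sigma> a" "\<Sum>a\<leftarrow>as. point \<sigma> a"]
      by (auto simp: point_def)
  qed simp
  thus ?case by (simp add: endo_divisor_point[OF as])
next
  case (diff a b)
  thus ?case using keys_diff[of "frag_divisor \<sigma> a" "frag_divisor \<sigma> b"] by auto
qed simp

lemma bij_betw_sigma_tilde:
  "bij_betw (sigma_tilde \<sigma>) UNIV {g. Poly_Mapping.keys g \<subseteq> \<sigma> ` (UNIV - {0})}"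
proof (rule bij_betw_byWitness[where f' = "\<lambda>g. W0_class (lift_divisor \<sigma> g)"])
  show "\<forall>x\<in>UNIV. W0_class (lift_divisor \<sigma> (sigma_tilde \<sigma> x)) = x"
    by (simp add: W0_class_lift_divisor flip: sigma_tilde_rep[OF \<sigma>])
  show "\<forall>g\<in>{g. Poly_Mapping.keys g \<subseteq> \<sigma> ` (UNIV - {0})}. sigma_tilde \<sigma> (W0_class (lift_divisor \<sigma> g)) = g"
    by (simp add: sigma_tilde_class[OF \<sigma>] frag_divisor_lift)
  show "range (sigma_tilde \<sigma>) \<subseteq> {g. Poly_Mapping.keys g \<subseteq> \<sigma> ` (UNIV - {0})}"
    using keys_frag_divisor by (auto simp flip: sigma_tilde_rep[OF \<sigma>])
qed simp

end

section \<open>The prime-to-\<open>p\<close> part of \<open>\<rat>/\<int>\<close>\<close>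

lemma qmodz_scale_simps:
  "qmodz_scale n (x + y) = qmodz_scale n x + qmodz_scale n y"
  "qmodz_scale n (x - y) = qmodz_scale n x - qmodz_scale n y"
  "qmodz_scale n (- x) = - qmodz_scale n x"
  "qmodz_scale (m * n) x = qmodz_scale m (qmodz_scale n x)"
  "qmodz_scale (m + n) x = qmodz_scale m x + qmodz_scale n x"
  "qmodz_scale n 0 = 0" "qmodz_scale 0 x = 0" "qmodz_scale 1 x = x"
  by (transfer; simp add: algebra_simps)+

lemma qmodz_scale_commute: "qmodz_scale m (qmodz_scale n x) = qmodz_scale n (qmodz_scale m x)"
  by (metis qmodz_scale_simps(4) mult.commute)

lemma qmodz_scale_dvd: "qmodz_scale m x = 0 \<Longrightarrow> m dvd n \<Longrightarrow> qmodz_scale n x = 0"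
  by (metis dvd_def mult.commute qmodz_scale_simps(4,6))

lemma qmodz_torsion: "\<exists>m>0. qmodz_scale m \<gamma> = 0"
proof (transfer)
  fix r :: rat
  obtain a b where r: "quotient_of r = (a, b)" by force
  hence "b > 0" "r = of_int a / of_int b" using quotient_of_denom_pos quotient_of_div by blast+
  hence "of_nat (nat b) * r - 0 = of_int a" by simp
  thus "\<exists>m>0. of_nat m * r - 0 \<in> \<int>" using \<open>b > 0\<close> by (intro exI[of _ "nat b"]) simp
qed

text \<open>A rational h with n h - g an integer z is (g + z) / n, and modulo integers only z modulo
  n matters.\<close>

lemma bij_betw_qmodz_roots:
  assumes "n > 0"
  shows "bij_betw (\<lambda>i. abs_qmodz ((g + of_nat i) / of_nat n)) {..<n} {\<eta>. qmodz_scale n \<eta> = abs_qmodz g}"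
  unfolding bij_betw_def
proof (intro conjI inj_onI equalityI subsetI)
  fix i j assume ij: "i \<in> {..<n}" "j \<in> {..<n}"
    "abs_qmodz ((g + of_nat i) / of_nat n) = abs_qmodz ((g + of_nat j) / of_nat n)"
  hence "(g + of_nat i) / of_nat n - (g + of_nat j) / of_nat n \<in> \<int>" by (simp add: qmodz.abs_eq_iff)
  then obtain z where "(g + of_nat i) / of_nat n - (g + of_nat j) / of_nat n = of_int z" by (rule Ints_cases)
  hence "(of_nat i - of_nat j) / of_nat n = (of_int z :: rat)" by (simp flip: diff_divide_distrib)
  hence "of_int (int i - int j) = (of_int (int n * z) :: rat)" using assms by (simp add: field_simps)
  hence z: "int i - int j = int n * z" by (simp only: of_int_eq_iff)
  hence "int n dvd int i - int j" by simp
  hence "int i mod int n = int j mod int n" by (simp add: mod_eq_dvd_iff)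
  thus "i = j" using ij by simp
next
  fix \<eta> assume "\<eta> \<in> (\<lambda>i. abs_qmodz ((g + of_nat i) / of_nat n)) ` {..<n}"
  then obtain i where "\<eta> = abs_qmodz ((g + of_nat i) / of_nat n)" by blast
  thus "\<eta> \<in> {\<eta>. qmodz_scale n \<eta> = abs_qmodz g}"
    using assms by (simp add: qmodz_scale.abs_eq qmodz.abs_eq_iff)
next
  fix \<eta> assume \<eta>: "\<eta> \<in> {\<eta>. qmodz_scale n \<eta> = abs_qmodz g}"
  obtain h where h: "\<eta> = abs_qmodz h" by (metis Quotient3_abs_rep[OF Quotient3_qmodz])
  hence "of_nat n * h - g \<in> \<int>" using \<eta> by (simp add: qmodz_scale.abs_eq qmodz.abs_eq_iff)
  then obtain z where z: "of_nat n * h - g = of_int z" by (rule Ints_cases)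
  define i where "i = nat (z mod int n)"
  have i: "i < n" using assms by (simp add: i_def nat_less_iff)
  have "z = int n * (z div int n) + int i" using assms by (simp add: i_def)
  hence "of_int z = (of_nat n * of_int (z div int n) + of_nat i :: rat)"
    by (metis of_int_add of_int_mult of_int_of_nat_eq)
  hence "of_nat n * h = g + of_nat n * of_int (z div int n) + of_nat i" using z by simp
  hence "h - (g + of_nat i) / of_nat n = of_int (z div int n)"
    using assms by (simp add: field_simps)
  hence "\<eta> = abs_qmodz ((g + of_nat i) / of_nat n)" by (simp add: h qmodz.abs_eq_iff)
  thus "\<eta> \<in> (\<lambda>i. abs_qmodz ((g + of_nat i) / of_nat n)) ` {..<n}" using i by blast
qed

lemma qmodz_roots:
  assumes "n > 0"
  shows "finite {\<eta>. qmodz_scale n \<eta> = \<gamma>}" "card {\<eta>. qmodz_scale n \<eta> = \<gamma>} = n"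
proof -
  obtain g where g: "\<gamma> = abs_qmodz g" by (metis Quotient3_abs_rep[OF Quotient3_qmodz])
  show "finite {\<eta>. qmodz_scale n \<eta> = \<gamma>}" "card {\<eta>. qmodz_scale n \<eta> = \<gamma>} = n"
    using bij_betw_finite[OF bij_betw_qmodz_roots[OF assms, of g]]
      bij_betw_same_card[OF bij_betw_qmodz_roots[OF assms, of g]] by (simp_all add: g)
qed

lemma qmodz_divisible: "n > 0 \<Longrightarrow> \<exists>\<eta>. qmodz_scale n \<eta> = \<gamma>"
  using qmodz_roots(2)[of n \<gamma>] by (metis (mono_tags, lifting) card.empty empty_Collect_eq less_irrefl)

text \<open>Trades denominators for annihilating integers, so that closure and decomposition become
  questions of divisibility and Bezout relations.\<close>

lemma prime_to_iff: "\<gamma> \<in> prime_to p \<longleftrightarrow> (\<exists>b>0. coprime b p \<and> qmodz_scale b \<gamma> = 0)"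
proof
  assume "\<gamma> \<in> prime_to p"
  then obtain a b where ab: "\<gamma> = abs_qmodz (of_int a / of_int b)" "b > 0" "coprime b (int p)"
    by (auto simp: prime_to_def)
  have "qmodz_scale (nat b) \<gamma> = 0"
    using ab(2) by (simp add: ab(1) qmodz_scale.abs_eq zero_qmodz.abs_eq qmodz.abs_eq_iff)
  moreover have "coprime (nat b) p" using ab(2,3) by (metis coprime_int_iff int_nat_eq less_imp_le)
  ultimately show "\<exists>b>0. coprime b p \<and> qmodz_scale b \<gamma> = 0" using ab(2) by (intro exI[of _ "nat b"]) simp
next
  assume "\<exists>b>0. coprime b p \<and> qmodz_scale b \<gamma> = 0"
  then obtain b where b: "b > 0" "coprime b p" "qmodz_scale b \<gamma> = 0" by blast
  obtain h where h: "\<gamma> = abs_qmodz h" by (metis Quotient3_abs_rep[OF Quotient3_qmodz])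
  have "of_nat b * h - 0 \<in> \<int>"
    using b(3) by (simp add: h qmodz_scale.abs_eq zero_qmodz.abs_eq qmodz.abs_eq_iff)
  then obtain a where "of_nat b * h = of_int a" by (auto elim: Ints_cases)
  hence "h = of_int a / of_int (int b)" using b(1) by (simp add: field_simps)
  moreover have "coprime (int b) (int p)" "int b > 0" using b by simp_all
  ultimately show "\<gamma> \<in> prime_to p" using h unfolding prime_to_def by blast
qed

context
  fixes p :: nat
  assumes p: "prime p"
begin

lemma prime_to_closed:
  assumes "x \<in> prime_to p" "y \<in> prime_to p"
  shows "x + y \<in> prime_to p" "x - y \<in> prime_to p"
proof -
  obtain b c where b: "b > 0" "coprime b p" "qmodz_scale b x = 0"
    and c: "c > 0" "coprime c p" "qmodz_scale c y = 0"
    using assms by (auto simp: prime_to_iff)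
  have "qmodz_scale (b * c) x = 0" "qmodz_scale (b * c) y = 0"
    using qmodz_scale_dvd[OF b(3), of "b * c"] qmodz_scale_dvd[OF c(3), of "b * c"] by simp_all
  thus "x + y \<in> prime_to p" "x - y \<in> prime_to p"
    unfolding prime_to_iff using b(1,2) c(1,2)
    by (auto intro!: exI[of _ "b * c"] simp: qmodz_scale_simps(1,2))
qed

lemma primary_part_closed:
  assumes "x \<in> primary_part p" "y \<in> primary_part p"
  shows "x + y \<in> primary_part p" "x - y \<in> primary_part p"
proof -
  obtain k l where kl: "qmodz_scale (p ^ k) x = 0" "qmodz_scale (p ^ l) y = 0"
    using assms by (auto simp: primary_part_def)
  have "qmodz_scale (p ^ (k + l)) x = 0" "qmodz_scale (p ^ (k + l)) y = 0"
    using qmodz_scale_dvd[OF kl(1), of "p ^ (k + l)"] qmodz_scale_dvd[OF kl(2), of "p ^ (k + l)"]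
    by (simp_all add: power_add)
  thus "x + y \<in> primary_part p" "x - y \<in> primary_part p"
    unfolding primary_part_def by (auto intro!: exI[of _ "k + l"] simp: qmodz_scale_simps(1,2))
qed

lemma prime_to_scale: "x \<in> prime_to p \<Longrightarrow> qmodz_scale n x \<in> prime_to p"
  unfolding prime_to_iff by (metis qmodz_scale_commute qmodz_scale_simps(6))

lemma primary_part_scale: "x \<in> primary_part p \<Longrightarrow> qmodz_scale n x \<in> primary_part p"
  unfolding primary_part_def mem_Collect_eq by (metis qmodz_scale_commute qmodz_scale_simps(6))

lemma zero_in_parts: "0 \<in> prime_to p" "0 \<in> primary_part p"
  unfolding prime_to_iff primary_part_def
  by (auto simp: qmodz_scale_simps(6) intro!: exI[of _ "1::nat"])

lemma prime_to_inter_primary_part: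
  assumes "x \<in> prime_to p" "x \<in> primary_part p"
  shows "x = 0"
proof -
  obtain b k where b: "b > 0" "coprime b p" "qmodz_scale b x = 0" and k: "qmodz_scale (p ^ k) x = 0"
    using assms by (auto simp: prime_to_iff primary_part_def)
  have "coprime b (p ^ k)" using b(2) by simp
  then obtain u v where "b * u = p ^ k * v + 1" using bezout_nat[of b "p ^ k"] b(1) by auto
  hence "qmodz_scale (b * u) x = qmodz_scale (p ^ k * v) x + x" by (metis qmodz_scale_simps(5,8))
  moreover have "qmodz_scale (b * u) x = 0" "qmodz_scale (p ^ k * v) x = 0"
    using qmodz_scale_dvd[OF b(3), of "b * u"] qmodz_scale_dvd[OF k, of "p ^ k * v"] by simp_all
  ultimately show ?thesis by simp
qed

text \<open>Write an annihilator as m = q b with q a power of p and b prime to p. A relation b u = q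
  v + 1 gives \<gamma> = (b u) \<gamma> - (q v) \<gamma>, where q kills the first term and b the
  second.\<close>

lemma prime_to_primary_decomposition: "\<exists>\<eta>\<in>prime_to p. \<gamma> - \<eta> \<in> primary_part p"
proof -
  obtain m where m: "m > 0" "qmodz_scale m \<gamma> = 0" using qmodz_torsion by blast
  obtain b where b: "m = p ^ multiplicity p m * b" "\<not> p dvd b"
    by (rule multiplicity_decompose'[of m p]) (use m(1) p in auto)
  let ?q = "p ^ multiplicity p m"
  have b0: "b > 0" using b(2) by (cases b) auto
  have cop: "coprime b p" using prime_imp_coprime[OF p b(2)] by (simp add: coprime_commute)
  hence "coprime b ?q" by simp
  then obtain u v where uv: "b * u = ?q * v + 1" using bezout_nat[of b ?q] b0 by auto
  hence eq: "qmodz_scale (b * u) \<gamma> = qmodz_scale (?q * v) \<gamma> + \<gamma>" by (metis qmodz_scale_simps(5,8))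
  have "qmodz_scale b (qmodz_scale (?q * v) \<gamma>) = 0"
    using qmodz_scale_dvd[OF m(2), of "b * (?q * v)"] b(1)
    by (metis dvd_triv_left mult.assoc mult.commute qmodz_scale_simps(4))
  hence 1: "qmodz_scale (?q * v) \<gamma> \<in> prime_to p" unfolding prime_to_iff using b0 cop by blast
  have "qmodz_scale ?q (qmodz_scale (b * u) \<gamma>) = 0"
    using qmodz_scale_dvd[OF m(2), of "?q * (b * u)"] b(1) by (metis dvd_triv_left mult.assoc qmodz_scale_simps(4))
  hence 2: "qmodz_scale (b * u) \<gamma> \<in> primary_part p" unfolding primary_part_def by blast
  have "0 - qmodz_scale (?q * v) \<gamma> \<in> prime_to p" by (rule prime_to_closed(2)[OF zero_in_parts(1) 1])
  moreover have "\<gamma> - (0 - qmodz_scale (?q * v) \<gamma>) = qmodz_scale (b * u) \<gamma>" using eq by simp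
  ultimately show ?thesis using 2 by metis
qed

lemma proj_prime_to_eqI:
  assumes "\<eta> \<in> prime_to p" "\<gamma> - \<eta> \<in> primary_part p"
  shows "proj_prime_to p \<gamma> = \<eta>"
  unfolding proj_prime_to_def
proof (rule the_equality)
  show "\<eta> \<in> prime_to p \<and> \<gamma> - \<eta> \<in> primary_part p" using assms ..
next
  fix \<eta>' assume \<eta>': "\<eta>' \<in> prime_to p \<and> \<gamma> - \<eta>' \<in> primary_part p"
  have "\<eta>' - \<eta> \<in> prime_to p" using \<eta>' assms by (intro prime_to_closed) auto
  moreover have "(\<gamma> - \<eta>) - (\<gamma> - \<eta>') \<in> primary_part p"
    by (rule primary_part_closed(2)) (use \<eta>' assms in auto)
  ultimately show "\<eta>' = \<eta>" using prime_to_inter_primary_part[of "\<eta>' - \<eta>"] by simp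
qed

lemma proj_prime_to: "proj_prime_to p \<gamma> \<in> prime_to p" "\<gamma> - proj_prime_to p \<gamma> \<in> primary_part p"
proof -
  obtain \<eta> where \<eta>: "\<eta> \<in> prime_to p" "\<gamma> - \<eta> \<in> primary_part p"
    using prime_to_primary_decomposition by blast
  with proj_prime_to_eqI[OF \<eta>]
  show "proj_prime_to p \<gamma> \<in> prime_to p" "\<gamma> - proj_prime_to p \<gamma> \<in> primary_part p" by simp_all
qed

lemma proj_prime_to_id: "\<gamma> \<in> prime_to p \<Longrightarrow> proj_prime_to p \<gamma> = \<gamma>"
  by (rule proj_prime_to_eqI) (simp_all add: zero_in_parts)

lemma proj_prime_to_add: "proj_prime_to p (x + y) = proj_prime_to p x + proj_prime_to p y"
proof (rule proj_prime_to_eqI)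
  have "(x - proj_prime_to p x) + (y - proj_prime_to p y) \<in> primary_part p"
    by (intro primary_part_closed proj_prime_to)
  thus "x + y - (proj_prime_to p x + proj_prime_to p y) \<in> primary_part p"
    by (simp add: algebra_simps)
qed (intro prime_to_closed proj_prime_to)

lemma proj_prime_to_scale: "proj_prime_to p (qmodz_scale n x) = qmodz_scale n (proj_prime_to p x)"
proof (rule proj_prime_to_eqI)
  show "qmodz_scale n x - qmodz_scale n (proj_prime_to p x) \<in> primary_part p"
    unfolding qmodz_scale_simps(2)[symmetric] by (intro primary_part_scale proj_prime_to)
qed (intro prime_to_scale proj_prime_to)

lemma proj_prime_to_primary: "\<gamma> \<in> primary_part p \<Longrightarrow> proj_prime_to p \<gamma> = 0"
  by (rule proj_prime_to_eqI) (simp_all add: zero_in_parts)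

text \<open>Any solution in \<rat>/\<int> may be corrected by its prime-to-p component, which n
  kills because \<delta> has none.\<close>

lemma primary_part_divisible:
  assumes "n > 0" "\<delta> \<in> primary_part p"
  shows "\<exists>\<eta>\<in>primary_part p. qmodz_scale n \<eta> = \<delta>"
proof -
  obtain \<eta> where \<eta>: "qmodz_scale n \<eta> = \<delta>" using qmodz_divisible[OF assms(1)] by blast
  have "qmodz_scale n (proj_prime_to p \<eta>) = 0"
    using proj_prime_to_scale[of n \<eta>] proj_prime_to_primary[OF assms(2)] \<eta> by simp
  hence "qmodz_scale n (\<eta> - proj_prime_to p \<eta>) = \<delta>" using \<eta> by (simp add: qmodz_scale_simps)
  thus ?thesis using proj_prime_to(2) by blast
qed

lemma restrict_rho:
  "restrict_prime_to p (bc_rho n (group_elem \<gamma>)) =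
    (\<Sum>\<eta>\<in>{\<eta>. qmodz_scale n \<eta> = \<gamma>}. group_elem (proj_prime_to p \<eta>))"
  if "n > 0"
  unfolding restrict_prime_to_def bc_rho_def frag_extend_of
  by (subst frag_extend_sum[OF qmodz_roots(1)[OF that]]) (simp add: o_def)

text \<open>All fibres of the projection \<open>{\<eta>. n \<eta> = \<gamma>} \<rightarrow> {\<eta> \<in> prime_to p. n \<eta> = \<gamma>}\<close> are cosets of the same
  group.\<close>

lemma restrict_rho_fibres:
  assumes n: "n > 0" and \<gamma>: "\<gamma> \<in> prime_to p"
  defines "S \<equiv> {\<eta> \<in> prime_to p. qmodz_scale n \<eta> = \<gamma>}"
  obtains c where "restrict_prime_to p (bc_rho n (group_elem \<gamma>)) = (\<Sum>\<eta>\<in>S. of_nat c * group_elem \<eta>)"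
    and "card S * c = n"
proof -
  let ?T = "{\<eta>. qmodz_scale n \<eta> = \<gamma>}" and ?P = "proj_prime_to p"
  \<comment> \<open>The n-torsion of the p-primary part; every fibre over \<open>S\<close> is a
    translate of it, so its size is the common multiplicity.\<close>
  let ?K = "{\<delta>. qmodz_scale n \<delta> = 0 \<and> ?P \<delta> = 0}"
  note fT = qmodz_roots(1)[OF n, of \<gamma>]
  have fS: "finite S" by (rule finite_subset[OF _ fT]) (auto simp: S_def)
  have im: "?P ` ?T \<subseteq> S"
    using proj_prime_to(1) proj_prime_to_id[OF \<gamma>] by (auto simp: S_def simp flip: proj_prime_to_scale)
  have fibre: "card {x \<in> ?T. ?P x = \<eta>} = card ?K" if \<eta>: "\<eta> \<in> S" for \<eta>
  proof -
    have "{x \<in> ?T. ?P x = \<eta>} = (\<lambda>\<delta>. \<eta> + \<delta>) ` ?K"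
    proof (intro equalityI subsetI)
      fix x assume x: "x \<in> {x \<in> ?T. ?P x = \<eta>}"
      have "?P x = ?P \<eta> + ?P (x - \<eta>)" using proj_prime_to_add[of \<eta> "x - \<eta>"] by simp
      moreover have "?P \<eta> = \<eta>" using \<eta> by (auto simp: S_def proj_prime_to_id)
      ultimately have "x - \<eta> \<in> ?K" using x \<eta> by (auto simp: S_def qmodz_scale_simps)
      thus "x \<in> (\<lambda>\<delta>. \<eta> + \<delta>) ` ?K" by (intro image_eqI[of _ _ "x - \<eta>"]) simp_all
    next
      fix x assume "x \<in> (\<lambda>\<delta>. \<eta> + \<delta>) ` ?K"
      thus "x \<in> {x \<in> ?T. ?P x = \<eta>}"
        using \<eta> by (auto simp: S_def proj_prime_to_add proj_prime_to_id qmodz_scale_simps)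
    qed
    thus ?thesis by (simp add: card_image)
  qed
  have "restrict_prime_to p (bc_rho n (group_elem \<gamma>)) = (\<Sum>\<eta>\<in>S. \<Sum>x\<in>{x \<in> ?T. ?P x = \<eta>}. group_elem (?P x))"
    unfolding restrict_rho[OF n] by (rule sum.group[OF fT fS im, symmetric])
  also have "\<dots> = (\<Sum>\<eta>\<in>S. of_nat (card ?K) * group_elem \<eta>)"
    by (rule sum.cong) (simp_all add: fibre[simplified])
  finally have 1: "restrict_prime_to p (bc_rho n (group_elem \<gamma>)) = (\<Sum>\<eta>\<in>S. of_nat (card ?K) * group_elem \<eta>)" .
  have "n = (\<Sum>x\<in>?T. 1)" using qmodz_roots(2)[OF n, of \<gamma>] by simp
  also have "\<dots> = (\<Sum>\<eta>\<in>S. \<Sum>x\<in>{x \<in> ?T. ?P x = \<eta>}. 1)" by (rule sum.group[OF fT fS im, symmetric])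
  also have "\<dots> = card S * card ?K" by (simp add: fibre[simplified])
  finally show ?thesis using 1 that by metis
qed

end

section \<open>Roots in characteristic \<open>p\<close>\<close>

text \<open>Substituting u t for t turns the factor t - u r into u (t - r).\<close>

lemma order_pcompose_scale_le:
  fixes q :: "'k::field poly"
  assumes "u \<noteq> 0" "pcompose q [:0, u:] \<noteq> 0"
  shows "Polynomial.order (u * r) q \<le> Polynomial.order r (pcompose q [:0, u:])"
proof -
  let ?k = "Polynomial.order (u * r) q"
  obtain s where s: "q = [:- (u * r), 1:] ^ ?k * s" using order_1[of "u * r" q] by (auto elim: dvdE)
  have pow: "pcompose (f ^ n) g = pcompose f g ^ n" for f g :: "'k poly" and n
    by (induction n) (auto simp: pcompose_mult pcompose_1)
  have "pcompose q [:0, u:] = pcompose [:- (u * r), 1:] [:0, u:] ^ ?k * pcompose s [:0, u:]"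
    by (subst s) (simp add: pcompose_mult pow)
  also have "pcompose [:- (u * r), 1:] [:0, u:] = Polynomial.smult u [:- r, 1:]"
    by (simp add: pcompose_pCons)
  finally have "pcompose q [:0, u:] = [:- r, 1:] ^ ?k * Polynomial.smult (u ^ ?k) (pcompose s [:0, u:])"
    by (simp only: smult_power mult_smult_left mult_smult_right)
  hence "[:- r, 1:] ^ ?k dvd pcompose q [:0, u:]" by (metis dvd_triv_left)
  thus ?thesis using assms(2) by (simp add: order_divides)
qed

text \<open>For u = r' / r one has u^n = 1, so the substitution of u t for t fixes t^n - a while
  moving the root r' to r. No derivative is involved, so the argument covers exponents divisible by
  p.\<close>

lemma order_monom_minus_const:
  fixes a :: "'k::field"
  assumes "n > 0" "a \<noteq> 0" "r ^ n = a" "r' ^ n = a"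
  shows "Polynomial.order r (Polynomial.monom 1 n - [:a:]) = Polynomial.order r' (Polynomial.monom 1 n - [:a:])"
proof -
  let ?q = "Polynomial.monom 1 n - [:a:]"
  have nz: "?q \<noteq> 0" using degree_monom_minus_const[OF assms(1), of a] assms(1) by auto
  have "Polynomial.order r' ?q \<le> Polynomial.order r ?q" if r: "r ^ n = a" "r' ^ n = a" for r r'
  proof -
    define u where "u = r' / r"
    have r0: "r \<noteq> 0" using r(1) assms(1,2) by (auto simp: power_0_left)
    have u: "u ^ n = 1" "u \<noteq> 0" "u * r = r'"
      using r r0 assms(1,2) by (auto simp: u_def power_divide power_0_left)
    have "pcompose ?q [:0, u:] = ?q"
      by (rule poly_eqI, use u(1) in \<open>auto simp: coeff_pcompose_linear coeff_pCons split: nat.split\<close>)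
    with order_pcompose_scale_le[OF u(2), of ?q r] nz u(3) show ?thesis by simp
  qed
  from this[OF assms(3,4)] this[OF assms(4,3)] show ?thesis by simp
qed

lemma set_root_list:
  assumes "n > 0" shows "set (root_list n a) = {r. r ^ n = a}"
proof -
  have "poly (\<Prod>r\<leftarrow>rs. [:- r, 1:]) x = 0 \<longleftrightarrow> x \<in> set rs" for rs :: "'a list" and x
    by (induction rs) auto
  from this[of "root_list n a"] show ?thesis
    unfolding prod_root_list[OF assms] by (auto simp: poly_monom)
qed

text \<open>Equal orders give the constant c; counting the n entries of the list root by root gives
  the product formula.\<close>

lemma root_list_multiplicity:
  fixes a :: "'k::alg_closed_field"
  assumes "n > 0" "a \<noteq> 0"
  obtains c where "\<And>r. r ^ n = a \<Longrightarrow> count_list (root_list n a) r = c" "card {r. r ^ n = a} * c = n"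
    "finite {r. r ^ n = a}" "card {r. r ^ n = a} > 0"
proof -
  let ?R = "{r. r ^ n = a}"
  have fin: "finite ?R" using set_root_list[OF assms(1), of a] by (metis finite_set)
  have "root_list n a \<noteq> []" using length_root_list[OF assms(1), of a] assms(1) by auto
  hence "?R \<noteq> {}" using set_root_list[OF assms(1), of a] by (metis set_empty)
  then obtain r0 where r0: "r0 ^ n = a" by blast
  have c: "count_list (root_list n a) r = count_list (root_list n a) r0" if "r ^ n = a" for r
    using order_monom_minus_const[OF assms that r0]
    unfolding prod_root_list[OF assms(1), symmetric] order_prod_linear .
  have "n = (\<Sum>r\<in>?R. count_list (root_list n a) r)"
    using sum_count_set[of "root_list n a" ?R] fin length_root_list[OF assms(1), of a]
      set_root_list[OF assms(1), of a] by simp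
  also have "\<dots> = card ?R * count_list (root_list n a) r0" by (simp add: c)
  finally show ?thesis using that[OF c] fin r0 by (auto simp: card_gt_0_iff)
qed

text \<open>All roots of t^n - 1 share one multiplicity, so it is enough that 1 is a simple root;
  the derivative takes the value n there, which is non-zero in the field.\<close>

lemma card_roots_of_unity:
  assumes "n > 0" "\<not> CHAR('k::alg_closed_field) dvd n"
  shows "card {r :: 'k. r ^ n = 1} = n"
proof -
  obtain c where c: "\<And>r::'k. r ^ n = 1 \<Longrightarrow> count_list (root_list n 1) r = c" "card {r::'k. r ^ n = 1} * c = n"
    using root_list_multiplicity[OF assms(1), of "1::'k"] by auto
  let ?q = "Polynomial.monom 1 n - [:1:] :: 'k poly"
  have nz: "?q \<noteq> 0" using degree_monom_minus_const[OF assms(1), of "1::'k"] assms(1) by auto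
  have "Polynomial.order 1 ?q = c"
    using c(1)[of 1] unfolding prod_root_list[OF assms(1), symmetric] order_prod_linear by simp
  moreover have "Polynomial.order 1 ?q < 2"
  proof (rule ccontr)
    assume "\<not> Polynomial.order 1 ?q < 2"
    hence "[:- 1, 1:] ^ 2 dvd ?q" using nz by (simp add: order_divides)
    then obtain s where s: "?q = [:- 1, 1:] ^ 2 * s" by (rule dvdE)
    have "poly (pderiv ?q) 1 = 0"
      unfolding s power2_eq_square by (simp only: pderiv_mult poly_add poly_mult) simp
    hence "of_nat n = (0::'k)" by (simp add: pderiv_diff pderiv_monom poly_monom)
    thus False using assms(2) by (simp add: of_nat_eq_0_iff_char_dvd)
  qed
  moreover have "c \<noteq> 0" using c(2) assms(1) by (metis mult_0_right less_irrefl)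
  ultimately have "c = 1" by simp
  thus ?thesis using c(2) by simp
qed

locale char_p_embedding =
  fixes p :: nat and \<sigma> :: "'k::alg_closed_field \<Rightarrow> qmodz"
  assumes p: "prime p" and char_p: "CHAR('k) = p"
    and \<sigma>_mult: "\<And>a b. a \<noteq> 0 \<Longrightarrow> b \<noteq> 0 \<Longrightarrow> \<sigma> (a * b) = \<sigma> a + \<sigma> b"
    and \<sigma>_inj: "inj_on \<sigma> (UNIV - {0})"
begin

lemma \<sigma>_eq_iff: "a \<noteq> 0 \<Longrightarrow> b \<noteq> 0 \<Longrightarrow> \<sigma> a = \<sigma> b \<longleftrightarrow> a = b"
  using \<sigma>_inj by (auto simp: inj_on_def)

lemma \<sigma>_1: "\<sigma> 1 = 0"
  using \<sigma>_mult[of 1 1] by simp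

lemma \<sigma>_power: "a \<noteq> 0 \<Longrightarrow> \<sigma> (a ^ n) = qmodz_scale n (\<sigma> a)"
proof (induction n)
  case (Suc n)
  have "\<sigma> (a ^ Suc n) = \<sigma> a + \<sigma> (a ^ n)" using \<sigma>_mult[of a "a ^ n"] Suc.prems by simp
  also have "\<dots> = qmodz_scale 1 (\<sigma> a) + qmodz_scale n (\<sigma> a)"
    unfolding Suc.IH[OF Suc.prems] qmodz_scale_simps(8) ..
  also have "\<dots> = qmodz_scale (Suc n) (\<sigma> a)" by (simp flip: qmodz_scale_simps(5))
  finally show ?case .
qed (simp add: \<sigma>_1 qmodz_scale_simps)

text \<open>If m kills \<sigma> x then x^m = 1 by injectivity, and Frobenius removes the p-part of
  m. Conversely, for b prime to p the b-th roots of unity have b distinct images, which exhaust the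
  b elements killed by b.\<close>

lemma \<sigma>_image: "\<sigma> ` (UNIV - {0}) = prime_to p"
proof (intro equalityI subsetI)
  fix \<gamma> assume "\<gamma> \<in> \<sigma> ` (UNIV - {0})"
  then obtain x where x: "\<gamma> = \<sigma> x" "x \<noteq> 0" by auto
  obtain m where m: "m > 0" "qmodz_scale m (\<sigma> x) = 0" using qmodz_torsion by blast
  have xm: "x ^ m = 1" using \<sigma>_power[OF x(2), of m] m(2) \<sigma>_1 \<sigma>_eq_iff[of "x ^ m" 1] x(2) by simp
  obtain b where b: "m = p ^ multiplicity p m * b" "\<not> p dvd b"
    by (rule multiplicity_decompose'[of m p]) (use m(1) p in auto)
  let ?q = "p ^ multiplicity p m"
  have "(x ^ b - 1 + 1) ^ ?q = (x ^ b - 1) ^ ?q + 1 ^ ?q"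
    by (rule freshmans_dream') (simp_all add: char_p p)
  moreover have "(x ^ b) ^ ?q = 1" using xm b(1) by (metis power_mult mult.commute)
  ultimately have "(x ^ b - 1) ^ ?q = 0" by simp
  hence "x ^ b = 1" by simp
  hence "qmodz_scale b (\<sigma> x) = 0" using \<sigma>_power[OF x(2), of b] \<sigma>_1 by simp
  moreover have "b > 0" using b(2) by (cases b) auto
  moreover have "coprime b p" using prime_imp_coprime[OF p b(2)] by (simp add: coprime_commute)
  ultimately show "\<gamma> \<in> prime_to p" unfolding prime_to_iff x(1) by blast
next
  fix \<gamma> assume "\<gamma> \<in> prime_to p"
  then obtain b where b: "b > 0" "coprime b p" "qmodz_scale b \<gamma> = 0" unfolding prime_to_iff by blast
  have "\<not> p dvd b" using b(2) p by (metis coprime_absorb_right coprime_commute not_prime_unit)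
  hence card: "card {r :: 'k. r ^ b = 1} = b" using card_roots_of_unity[OF b(1)] char_p by blast
  have R: "{r :: 'k. r ^ b = 1} \<subseteq> UNIV - {0}" using b(1) by (auto simp: power_0_left)
  have "card (\<sigma> ` {r. r ^ b = 1}) = b"
    using card_image[OF inj_on_subset[OF \<sigma>_inj R]] card by simp
  moreover have "\<sigma> ` {r. r ^ b = 1} \<subseteq> {\<eta>. qmodz_scale b \<eta> = 0}"
  proof
    fix \<eta> assume "\<eta> \<in> \<sigma> ` {r. r ^ b = 1}"
    then obtain r where r: "\<eta> = \<sigma> r" "r ^ b = 1" by blast
    with R have "r \<noteq> 0" by blast
    thus "\<eta> \<in> {\<eta>. qmodz_scale b \<eta> = 0}" using \<sigma>_power[of r b] r \<sigma>_1 by simp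
  qed
  ultimately have "\<sigma> ` {r. r ^ b = 1} = {\<eta>. qmodz_scale b \<eta> = 0}"
    using qmodz_roots[OF b(1), of 0] by (intro card_subset_eq) simp_all
  thus "\<gamma> \<in> \<sigma> ` (UNIV - {0})" using b(3) R by blast
qed

lemma point_power: "n > 0 \<Longrightarrow> point \<sigma> (a ^ n) = bc_sigma n (point \<sigma> a)"
  by (simp add: point_def bc_sigma_def \<sigma>_power)

text \<open>For a = 0 both sides vanish. Otherwise \<sigma> maps the roots of t^n - a onto the n-th
  parts of \<sigma> a in \<open>prime_to p\<close>, with surjectivity from
  \<open>\<sigma>_image\<close>, and the two constant multiplicities are n divided by the same
  cardinality.\<close>

lemma point_root_list:
  assumes n: "n > 0"
  shows "(\<Sum>r\<leftarrow>root_list n a. point \<sigma> r) = restrict_prime_to p (bc_rho n (point \<sigma> a))"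
proof (cases "a = 0")
  case True
  have "r = 0" if "r \<in> set (root_list n a)" for r using that set_root_list[OF n, of a] n True by auto
  hence "(\<Sum>r\<leftarrow>root_list n a. point \<sigma> r) = (\<Sum>r\<leftarrow>root_list n a. 0)"
    by (intro arg_cong[where f = sum_list] map_cong) (auto simp: point_def)
  thus ?thesis by (simp add: True point_def bc_rho_def restrict_prime_to_def)
next
  case False
  define S where "S = {\<eta> \<in> prime_to p. qmodz_scale n \<eta> = \<sigma> a}"
  let ?R = "{r. r ^ n = a}"
  obtain c where c: "\<And>r. r ^ n = a \<Longrightarrow> count_list (root_list n a) r = c" "card ?R * c = n" "card ?R > 0"
    using root_list_multiplicity[OF n False] by metis
  have "\<sigma> a \<in> prime_to p" using \<sigma>_image False by blast
  then obtain c' where c': "restrict_prime_to p (bc_rho n (group_elem (\<sigma> a))) =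
      (\<Sum>\<eta>\<in>S. of_nat c' * group_elem \<eta>)" "card S * c' = n"
    using restrict_rho_fibres[OF p n, of "\<sigma> a"] unfolding S_def by blast
  have R0: "r \<noteq> 0" if "r ^ n = a" for r using that False n by (auto simp: power_0_left)
  have bij: "bij_betw \<sigma> ?R S"
    unfolding bij_betw_def
  proof (intro conjI equalityI subsetI)
    show "inj_on \<sigma> ?R" using R0 by (intro inj_on_subset[OF \<sigma>_inj]) auto
  next
    fix \<eta> assume "\<eta> \<in> \<sigma> ` ?R"
    then obtain r where r: "\<eta> = \<sigma> r" "r ^ n = a" by blast
    thus "\<eta> \<in> S" using \<sigma>_power[OF R0[OF r(2)], of n] \<sigma>_image R0[OF r(2)] unfolding S_def by auto
  next
    fix \<eta> assume \<eta>: "\<eta> \<in> S"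
    hence "\<eta> \<in> \<sigma> ` (UNIV - {0})" using \<sigma>_image by (simp add: S_def)
    then obtain r where r: "\<eta> = \<sigma> r" "r \<noteq> 0" by blast
    have "\<sigma> (r ^ n) = \<sigma> a" using \<eta> r \<sigma>_power[OF r(2), of n] by (simp add: S_def)
    hence "r ^ n = a" using \<sigma>_eq_iff[of "r ^ n" a] r(2) False by simp
    thus "\<eta> \<in> \<sigma> ` ?R" using r(1) by blast
  qed
  have "card S = card ?R" using bij_betw_same_card[OF bij] by simp
  hence "card ?R * c' = card ?R * c" using c'(2) c(2) by simp
  hence cc: "c' = c" using c(3) by simp
  have "(\<Sum>r\<leftarrow>root_list n a. point \<sigma> r) = (\<Sum>r\<in>?R. of_nat (count_list (root_list n a) r) * point \<sigma> r)"
    unfolding set_root_list[OF n, symmetric] by (rule sum_count_list[symmetric])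
  also have "\<dots> = (\<Sum>r\<in>?R. of_nat c * group_elem (\<sigma> r))"
    using R0 by (intro sum.cong) (simp_all add: c(1) point_def)
  also have "\<dots> = (\<Sum>\<eta>\<in>S. of_nat c * group_elem \<eta>)" by (rule sum.reindex_bij_betw[OF bij])
  finally show ?thesis using c'(1) cc False by (simp add: point_def)
qed

lemma endo_divisor_power:
  assumes "n > 0"
  shows "endo_divisor \<sigma> (endo_power n X) = bc_sigma n (endo_divisor \<sigma> X)"
proof -
  obtain as where as: "flag (endo_map X) (endo_mod X) as" using flag_exists by blast
  have "flag (endo_map (endo_power n X)) (endo_mod (endo_power n X)) (map (\<lambda>a. a ^ n) as)"
    unfolding endo_power_simps by (rule flag_power[OF as endo_mod_map(2) order_refl])
  from endo_divisor_point[OF this, of \<sigma>]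
  have "endo_divisor \<sigma> (endo_power n X) = (\<Sum>a\<leftarrow>as. bc_sigma n (point \<sigma> a))"
    by (simp add: o_def point_power[OF assms])
  also have "\<dots> = bc_sigma n (\<Sum>a\<leftarrow>as. point \<sigma> a)"
    by (induction as) (simp_all add: bc_sigma_def frag_extend_add)
  finally show ?thesis by (simp add: endo_divisor_point[OF as])
qed

lemma endo_divisor_shift:
  assumes "n > 0"
  shows "endo_divisor \<sigma> (endo_shift n X) = restrict_prime_to p (bc_rho n (endo_divisor \<sigma> X))"
proof -
  obtain as where as: "flag (endo_map X) (endo_mod X) as" using flag_exists by blast
  have "flag (endo_map (endo_shift n X)) (endo_mod (endo_shift n X)) (concat (map (root_list n) as))"
    unfolding endo_shift_simps
    by (rule flag_shift[OF as endo_mod_map(2) subspace_endo_mod order_refl assms])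
  from endo_divisor_point[OF this, of \<sigma>]
  have "endo_divisor \<sigma> (endo_shift n X) = (\<Sum>a\<leftarrow>as. restrict_prime_to p (bc_rho n (point \<sigma> a)))"
    by (simp add: sum_list_concat_map point_root_list[OF assms])
  also have "\<dots> = restrict_prime_to p (bc_rho n (\<Sum>a\<leftarrow>as. point \<sigma> a))"
    by (induction as) (simp_all add: bc_rho_def restrict_prime_to_def frag_extend_add)
  finally show ?thesis by (simp add: endo_divisor_point[OF as])
qed

end

section \<open>Operators on the group ring\<close>

text \<open>Reduction to basis elements; the set \<open>S\<close> serves identities that hold only
  for elements supported on \<open>prime_to p\<close>.\<close>

lemma frag_additive_eqI:
  fixes x y :: "'a \<Rightarrow>\<^sub>0 int" and f g :: "('a \<Rightarrow>\<^sub>0 int) \<Rightarrow> 'b::ab_group_add"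
  assumes "Poly_Mapping.keys x \<subseteq> S" "Modules.additive f" "Modules.additive g"
    and "\<And>s. s \<in> S \<Longrightarrow> f (frag_of s) = g (frag_of s)"
  shows "f x = g x"
  using assms(1)
  by (induction x rule: frag_induction)
    (simp_all add: assms(4) additive.zero[OF assms(2)] additive.zero[OF assms(3)]
      additive.diff[OF assms(2)] additive.diff[OF assms(3)])

lemma additive_intros:
  fixes c :: "'b::comm_ring_1"
  shows "Modules.additive (\<lambda>x :: 'a::ab_group_add. x)"
    "Modules.additive f \<Longrightarrow> Modules.additive (\<lambda>x. f x * c)"
    "Modules.additive f \<Longrightarrow> Modules.additive (\<lambda>x. c * f x)"
    "Modules.additive g \<Longrightarrow> Modules.additive (\<lambda>x. restrict_prime_to p (g x))"
    "Modules.additive g \<Longrightarrow> Modules.additive (\<lambda>x. bc_rho n (g x))"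
    "Modules.additive g \<Longrightarrow> Modules.additive (\<lambda>x. bc_sigma n (g x))"
  by (simp_all add: additive_def algebra_simps restrict_prime_to_def bc_rho_def bc_sigma_def frag_extend_add)

lemma bc_sigma_elem [simp]: "bc_sigma n (group_elem \<gamma>) = group_elem (qmodz_scale n \<gamma>)"
  by (simp add: bc_sigma_def)

lemma restrict_elem [simp]: "restrict_prime_to p (group_elem \<gamma>) = group_elem (proj_prime_to p \<gamma>)"
  by (simp add: restrict_prime_to_def)

lemma bc_rho_elem: "bc_rho n (group_elem \<gamma>) = (\<Sum>\<eta>\<in>{\<eta>. qmodz_scale n \<eta> = \<gamma>}. group_elem \<eta>)"
  by (simp add: bc_rho_def)

lemma group_elem_mult: "group_elem x * group_elem y = group_elem (x + y)"
  by (simp add: mult_single)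

context
  fixes p :: nat
  assumes p: "prime p"
begin

lemma keys_restrict: "Poly_Mapping.keys (restrict_prime_to p x) \<subseteq> prime_to p"
proof -
  have "Poly_Mapping.keys (restrict_prime_to p x) \<subseteq>
      (\<Union>\<gamma>\<in>Poly_Mapping.keys x. Poly_Mapping.keys (group_elem (proj_prime_to p \<gamma>)))"
    unfolding restrict_prime_to_def by (rule keys_frag_extend)
  thus ?thesis using proj_prime_to(1)[OF p] by auto
qed

lemma restrict_id: "Poly_Mapping.keys g \<subseteq> prime_to p \<Longrightarrow> restrict_prime_to p g = g"
  by (rule frag_additive_eqI) (auto simp: proj_prime_to_id[OF p] intro!: additive_intros)

lemma restrict_mult: "restrict_prime_to p (x * y) = restrict_prime_to p x * restrict_prime_to p y"
proof (rule frag_additive_eqI[of x UNIV])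
  fix \<gamma>
  show "restrict_prime_to p (group_elem \<gamma> * y) = restrict_prime_to p (group_elem \<gamma>) * restrict_prime_to p y"
  proof (rule frag_additive_eqI[of y UNIV])
    fix \<delta>
    show "restrict_prime_to p (group_elem \<gamma> * group_elem \<delta>) =
        restrict_prime_to p (group_elem \<gamma>) * restrict_prime_to p (group_elem \<delta>)"
      by (simp add: group_elem_mult proj_prime_to_add[OF p])
  qed (auto intro!: additive_intros)
qed (auto intro!: additive_intros)

lemma restrict_one: "restrict_prime_to p 1 = 1"
  using restrict_elem[of p 0] proj_prime_to_id[OF p zero_in_parts(1)[OF p]] by (simp only: single_one)

text \<open>The operator that \<open>W0_V\<close> becomes on the group ring of
  \<open>prime_to p\<close>.\<close>

definition trace_rho :: "nat \<Rightarrow> group_ring \<Rightarrow> group_ring" where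
  "trace_rho n g = restrict_prime_to p (bc_rho n g)"

lemma additive_trace_rho: "Modules.additive g \<Longrightarrow> Modules.additive (\<lambda>x. trace_rho n (g x))"
  unfolding trace_rho_def by (intro additive_intros)

lemma trace_rho_elem:
  "n > 0 \<Longrightarrow> trace_rho n (group_elem \<gamma>) =
    (\<Sum>\<eta>\<in>{\<eta>. qmodz_scale n \<eta> = \<gamma>}. group_elem (proj_prime_to p \<eta>))"
  by (simp add: trace_rho_def restrict_rho[OF p])

text \<open>Take \<delta> primary with n \<delta> = \<gamma> - P \<gamma>, where P is the
  projection. Translation by \<delta> matches the n-th parts of P \<gamma> with those of \<gamma>,
  and P does not see \<delta>.\<close>

lemma trace_rho_restrict:
  assumes "n > 0"
  shows "trace_rho n (restrict_prime_to p x) = trace_rho n x"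
proof (rule frag_additive_eqI[of x UNIV])
  fix \<gamma>
  let ?P = "proj_prime_to p"
  obtain \<delta> where \<delta>: "\<delta> \<in> primary_part p" "qmodz_scale n \<delta> = \<gamma> - ?P \<gamma>"
    using primary_part_divisible[OF p assms proj_prime_to(2)[OF p]] by metis
  have bij: "bij_betw (\<lambda>\<eta>. \<eta> + \<delta>) {\<eta>. qmodz_scale n \<eta> = ?P \<gamma>} {\<eta>. qmodz_scale n \<eta> = \<gamma>}"
    by (rule bij_betw_byWitness[where f' = "\<lambda>\<eta>. \<eta> - \<delta>"]) (auto simp: qmodz_scale_simps \<delta>(2))
  have "(\<Sum>\<eta>\<in>{\<eta>. qmodz_scale n \<eta> = \<gamma>}. group_elem (?P \<eta>)) =
      (\<Sum>\<eta>\<in>{\<eta>. qmodz_scale n \<eta> = ?P \<gamma>}. group_elem (?P (\<eta> + \<delta>)))"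
    by (rule sum.reindex_bij_betw[OF bij, symmetric])
  thus "trace_rho n (restrict_prime_to p (group_elem \<gamma>)) = trace_rho n (group_elem \<gamma>)"
    by (simp add: trace_rho_elem[OF assms] proj_prime_to_add[OF p] proj_prime_to_primary[OF p \<delta>(1)])
qed (intro additive_intros additive_trace_rho subset_UNIV)+

text \<open>The solutions of n m \<eta> = \<gamma> are grouped by n \<eta>, which runs over the m-th
  parts of \<gamma>.\<close>

lemma bc_rho_mult:
  assumes "n > 0" "m > 0"
  shows "bc_rho (n * m) x = bc_rho n (bc_rho m x)"
proof (rule frag_additive_eqI[of x UNIV])
  fix \<gamma>
  let ?T = "\<lambda>n \<gamma>. {\<eta>. qmodz_scale n \<eta> = \<gamma>}"
  have "(\<Sum>\<eta>\<in>?T (n * m) \<gamma>. group_elem \<eta>) =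
      (\<Sum>\<delta>\<in>?T m \<gamma>. \<Sum>\<eta>\<in>{\<eta> \<in> ?T (n * m) \<gamma>. qmodz_scale n \<eta> = \<delta>}. group_elem \<eta>)"
    using assms
    by (intro sum.group[symmetric] qmodz_roots) (auto simp: mult.commute[of n m] qmodz_scale_simps(4))
  also have "\<dots> = (\<Sum>\<delta>\<in>?T m \<gamma>. \<Sum>\<eta>\<in>?T n \<delta>. group_elem \<eta>)"
    by (intro sum.cong) (auto simp: mult.commute[of n m] qmodz_scale_simps(4))
  also have "\<dots> = bc_rho n (\<Sum>\<delta>\<in>?T m \<gamma>. group_elem \<delta>)"
    unfolding bc_rho_def by (subst frag_extend_sum) (simp_all add: qmodz_roots assms o_def)
  finally show "bc_rho (n * m) (group_elem \<gamma>) = bc_rho n (bc_rho m (group_elem \<gamma>))"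
    by (simp add: bc_rho_elem)
qed (intro additive_intros subset_UNIV)+

lemma trace_rho_mult:
  "n > 0 \<Longrightarrow> m > 0 \<Longrightarrow> trace_rho (n * m) x = trace_rho n (trace_rho m x)"
  using trace_rho_restrict[of n "bc_rho m x"] by (simp add: trace_rho_def bc_rho_mult)

lemma bc_sigma_mult: "bc_sigma n (x * y) = bc_sigma n x * bc_sigma n y"
proof (rule frag_additive_eqI[of x UNIV])
  fix \<gamma>
  show "bc_sigma n (group_elem \<gamma> * y) = bc_sigma n (group_elem \<gamma>) * bc_sigma n y"
    by (rule frag_additive_eqI[of y UNIV])
      (auto intro!: additive_intros additive_trace_rho simp: group_elem_mult qmodz_scale_simps)
qed (auto intro!: additive_intros additive_trace_rho)

lemma bc_sigma_compose: "bc_sigma (n * m) x = bc_sigma n (bc_sigma m x)"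
  by (rule frag_additive_eqI[of x UNIV])
    (auto intro!: additive_intros additive_trace_rho simp: qmodz_scale_simps)

lemma restrict_sigma: "restrict_prime_to p (bc_sigma n x) = bc_sigma n (restrict_prime_to p x)"
  by (rule frag_additive_eqI[of x UNIV])
    (auto intro!: additive_intros additive_trace_rho
      simp: proj_prime_to_scale[OF p])

text \<open>Each of the n points contributes e(\<gamma>): projection commutes with multiplication by
  n and fixes \<gamma>, by the condition on the support.\<close>

lemma sigma_trace_rho:
  assumes "n > 0" "Poly_Mapping.keys g \<subseteq> prime_to p"
  shows "bc_sigma n (trace_rho n g) = of_nat n * g"
proof (rule frag_additive_eqI[OF assms(2)])
  fix \<gamma> assume \<gamma>: "\<gamma> \<in> prime_to p"
  have "bc_sigma n (trace_rho n (group_elem \<gamma>)) =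
      (\<Sum>\<eta>\<in>{\<eta>. qmodz_scale n \<eta> = \<gamma>}. group_elem (qmodz_scale n (proj_prime_to p \<eta>)))"
    unfolding trace_rho_elem[OF assms(1)] bc_sigma_def
    by (subst frag_extend_sum[OF qmodz_roots(1)[OF assms(1)]]) (simp add: o_def)
  also have "\<dots> = (\<Sum>\<eta>\<in>{\<eta>. qmodz_scale n \<eta> = \<gamma>}. group_elem \<gamma>)"
    by (intro sum.cong) (auto simp: proj_prime_to_id[OF p \<gamma>] simp flip: proj_prime_to_scale[OF p])
  also have "\<dots> = of_nat n * group_elem \<gamma>" by (simp add: qmodz_roots(2)[OF assms(1)])
  finally show "bc_sigma n (trace_rho n (group_elem \<gamma>)) = of_nat n * group_elem \<gamma>" .
qed (auto intro!: additive_intros additive_trace_rho)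

text \<open>Differences of n-th parts are killed by n, so by Bezout multiplication by m is injective
  on them. It therefore maps the n-th parts of \<gamma> onto those of m \<gamma>, there being n of
  each.\<close>

lemma trace_rho_sigma_coprime:
  assumes "n > 0" "m > 0" "coprime n m"
  shows "trace_rho n (bc_sigma m x) = bc_sigma m (trace_rho n x)"
proof (rule frag_additive_eqI[of x UNIV])
  fix \<gamma>
  let ?T = "\<lambda>\<gamma>. {\<eta>. qmodz_scale n \<eta> = \<gamma>}" and ?P = "proj_prime_to p"
  have inj: "inj_on (qmodz_scale m) (?T \<gamma>)"
  proof (rule inj_onI)
    fix \<eta> \<eta>' assume \<eta>: "\<eta> \<in> ?T \<gamma>" "\<eta>' \<in> ?T \<gamma>" "qmodz_scale m \<eta> = qmodz_scale m \<eta>'"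
    hence 0: "qmodz_scale n (\<eta> - \<eta>') = 0" "qmodz_scale m (\<eta> - \<eta>') = 0" by (simp_all add: qmodz_scale_simps)
    obtain u v where "n * u = m * v + 1" using bezout_nat[of n m] assms by auto
    hence "qmodz_scale (n * u) (\<eta> - \<eta>') = qmodz_scale (m * v) (\<eta> - \<eta>') + (\<eta> - \<eta>')"
      by (metis qmodz_scale_simps(5,8))
    thus "\<eta> = \<eta>'"
      using qmodz_scale_dvd[OF 0(1), of "n * u"] qmodz_scale_dvd[OF 0(2), of "m * v"] by simp
  qed
  moreover have "qmodz_scale m ` ?T \<gamma> \<subseteq> ?T (qmodz_scale m \<gamma>)"
    using qmodz_scale_commute by auto
  ultimately have "qmodz_scale m ` ?T \<gamma> = ?T (qmodz_scale m \<gamma>)"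
    using qmodz_roots[OF assms(1)] by (intro card_subset_eq) (simp_all add: card_image)
  with inj have bij: "bij_betw (qmodz_scale m) (?T \<gamma>) (?T (qmodz_scale m \<gamma>))" by (simp add: bij_betw_def)
  have "trace_rho n (group_elem (qmodz_scale m \<gamma>)) = (\<Sum>\<eta>\<in>?T \<gamma>. group_elem (?P (qmodz_scale m \<eta>)))"
    unfolding trace_rho_elem[OF assms(1)] by (rule sum.reindex_bij_betw[OF bij, symmetric])
  also have "\<dots> = bc_sigma m (trace_rho n (group_elem \<gamma>))"
    unfolding trace_rho_elem[OF assms(1)] bc_sigma_def
    by (subst frag_extend_sum[OF qmodz_roots(1)[OF assms(1)]]) (simp add: o_def proj_prime_to_scale[OF p])
  finally show "trace_rho n (bc_sigma m (group_elem \<gamma>)) = bc_sigma m (trace_rho n (group_elem \<gamma>))" by simp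
qed (auto intro!: additive_intros additive_trace_rho)

text \<open>A projection formula, as for transfer maps: translation by \<delta> carries the n-th
  parts of \<gamma> to those of n \<delta> + \<gamma>. It is behind the relation
  \<open>inj_mu\<close> and, in the variant that follows, \<open>mu_inj_mus\<close>.\<close>

lemma trace_rho_projection:
  assumes "n > 0"
  shows "trace_rho n (bc_sigma n x * y) = restrict_prime_to p x * trace_rho n y"
proof (rule frag_additive_eqI[of x UNIV])
  fix \<delta>
  show "trace_rho n (bc_sigma n (group_elem \<delta>) * y) = restrict_prime_to p (group_elem \<delta>) * trace_rho n y"
  proof (rule frag_additive_eqI[of y UNIV])
    fix \<gamma>
    let ?T = "\<lambda>\<gamma>. {\<eta>. qmodz_scale n \<eta> = \<gamma>}" and ?P = "proj_prime_to p"
    have bij: "bij_betw (\<lambda>\<eta>. \<delta> + \<eta>) (?T \<gamma>) (?T (qmodz_scale n \<delta> + \<gamma>))"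
      by (rule bij_betw_byWitness[where f' = "\<lambda>\<eta>. \<eta> - \<delta>"]) (auto simp: qmodz_scale_simps)
    have "trace_rho n (bc_sigma n (group_elem \<delta>) * group_elem \<gamma>) =
        (\<Sum>\<eta>\<in>?T \<gamma>. group_elem (?P (\<delta> + \<eta>)))"
      unfolding bc_sigma_elem group_elem_mult trace_rho_elem[OF assms]
      by (rule sum.reindex_bij_betw[OF bij, symmetric])
    also have "\<dots> = group_elem (?P \<delta>) * (\<Sum>\<eta>\<in>?T \<gamma>. group_elem (?P \<eta>))"
      by (simp add: proj_prime_to_add[OF p] sum_distrib_left group_elem_mult)
    finally show "trace_rho n (bc_sigma n (group_elem \<delta>) * group_elem \<gamma>) =
        restrict_prime_to p (group_elem \<delta>) * trace_rho n (group_elem \<gamma>)"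
      by (simp add: trace_rho_elem[OF assms])
  qed (auto intro!: additive_intros additive_trace_rho)
qed (auto intro!: additive_intros additive_trace_rho)

lemma trace_rho_projection':
  assumes "n > 0" "Poly_Mapping.keys g \<subseteq> prime_to p"
  shows "trace_rho n (restrict_prime_to p x * bc_sigma n g) = restrict_prime_to p (bc_rho n x) * g"
proof -
  have "trace_rho n (restrict_prime_to p x * bc_sigma n g) =
      restrict_prime_to p g * trace_rho n (restrict_prime_to p x)"
    using trace_rho_projection[OF assms(1), of g "restrict_prime_to p x"] by (simp add: mult.commute)
  also have "\<dots> = g * trace_rho n x" by (simp only: restrict_id[OF assms(2)] trace_rho_restrict[OF assms(1)])
  finally show ?thesis by (simp add: trace_rho_def mult.commute)
qed

end

section \<open>The representation\<close>

context char_p_embedding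
begin

lemma bij_sigma_tilde:
  "bij_betw (sigma_tilde \<sigma>) UNIV {g. Poly_Mapping.keys g \<subseteq> prime_to p}"
  using bij_betw_sigma_tilde[OF \<sigma>_mult \<sigma>_inj] unfolding \<sigma>_image .

lemma sigma_tilde_eqI: "sigma_tilde \<sigma> x = sigma_tilde \<sigma> y \<Longrightarrow> x = y"
  using bij_betw_imp_inj_on[OF bij_sigma_tilde] by (auto dest: injD)

lemma keys_sigma_tilde: "Poly_Mapping.keys (sigma_tilde \<sigma> x) \<subseteq> prime_to p"
  using bij_betwE[OF bij_sigma_tilde] by auto

lemma sigma_tilde_inv:
  "sigma_tilde \<sigma> (inv_into UNIV (sigma_tilde \<sigma>) (restrict_prime_to p x)) = restrict_prime_to p x"
  using bij_betw_inv_into_right[OF bij_sigma_tilde] keys_restrict[OF p, of x] by simp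

lemma sigma_tilde_F: "n > 0 \<Longrightarrow> sigma_tilde \<sigma> (W0_F n x) = bc_sigma n (sigma_tilde \<sigma> x)"
  unfolding W0_F_def
  by (rule sigma_tilde_extend[where \<psi> = "bc_sigma n", OF \<sigma>_mult endo_divisor_power])
    (auto intro: additive_intros)

lemma sigma_tilde_V: "n > 0 \<Longrightarrow> sigma_tilde \<sigma> (W0_V n x) = trace_rho p n (sigma_tilde \<sigma> x)"
  unfolding W0_V_def trace_rho_def[OF p]
  by (rule sigma_tilde_extend[where \<psi> = "\<lambda>g. restrict_prime_to p (bc_rho n g)", OF \<sigma>_mult endo_divisor_shift])
    (assumption | intro additive_intros)+

lemmas sigma_tilde_simps = sigma_tilde_add[OF \<sigma>_mult] sigma_tilde_mult[OF \<sigma>_mult]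
  sigma_tilde_inv sigma_tilde_F sigma_tilde_V

lemma sigma_tilde_0: "sigma_tilde \<sigma> 0 = 0"
  using sigma_tilde_diff[OF \<sigma>_mult, of 0 0] by simp

text \<open>Defined on raw expressions, of which the algebra is a quotient. Index 0 acts as zero to
  agree with the relations \<open>mu_0\<close> and \<open>mus_0\<close>.\<close>

primrec bc_action :: "bc_expr \<Rightarrow> 'k W0 \<Rightarrow> 'k W0" where
  "bc_action (BC_Inj x) \<xi> = inv_into UNIV (sigma_tilde \<sigma>) (restrict_prime_to p x) * \<xi>"
| "bc_action (BC_Mu n) \<xi> = (if n = 0 then 0 else W0_V n \<xi>)"
| "bc_action (BC_Mus n) \<xi> = (if n = 0 then 0 else W0_F n \<xi>)"
| "bc_action (BC_Add a b) \<xi> = bc_action a \<xi> + bc_action b \<xi>"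
| "bc_action (BC_Neg a) \<xi> = - bc_action a \<xi>"
| "bc_action (BC_Mul a b) \<xi> = bc_action a (bc_action b \<xi>)"

text \<open>The usable form of the action of \<int>[\<rat>/\<int>], free of \<open>inv_into\<close>;
  the defining equation leaves the simplifier just below so that this form applies.\<close>

lemma sigma_tilde_action_inj:
  "sigma_tilde \<sigma> (bc_action (BC_Inj x) \<xi>) = restrict_prime_to p x * sigma_tilde \<sigma> \<xi>"
  by (simp add: sigma_tilde_simps)

declare bc_action.simps(1) [simp del]

text \<open>Distributivity in \<open>W0\<close> is itself read off from the group ring. The lemma
  also yields the relation \<open>distrib_left\<close>.\<close>

lemma bc_action_add: "bc_action e (\<xi> + \<eta>) = bc_action e \<xi> + bc_action e \<eta>"
proof (induction e arbitrary: \<xi> \<eta>)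
  case (BC_Inj x)
  show ?case by (rule sigma_tilde_eqI) (simp add: sigma_tilde_action_inj sigma_tilde_simps algebra_simps)
next
  case (BC_Mu n)
  show ?case
    by (rule sigma_tilde_eqI)
      (simp add: sigma_tilde_simps sigma_tilde_0 trace_rho_def[OF p] bc_rho_def restrict_prime_to_def frag_extend_add)
next
  case (BC_Mus n)
  show ?case
    by (rule sigma_tilde_eqI)
      (simp add: sigma_tilde_simps sigma_tilde_0 bc_sigma_def frag_extend_add)
qed (simp_all add: algebra_simps)

text \<open>Under the injective \<open>sigma_tilde\<close> each relation turns into an identity
  between r, \<sigma>_n and \<open>trace_rho\<close>.\<close>

lemma bc_action_cong: "bc_eq a b \<Longrightarrow> bc_action a \<xi> = bc_action b \<xi>"
proof (induction arbitrary: \<xi> rule: bc_eq.induct)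
  case (add_zero a)
  have "bc_action (BC_Inj 0) \<xi> = 0"
    by (rule sigma_tilde_eqI) (simp add: sigma_tilde_action_inj sigma_tilde_simps sigma_tilde_0 restrict_prime_to_def)
  thus ?case by simp
next
  case (add_neg a)
  have "bc_action (BC_Inj 0) \<xi> = 0"
    by (rule sigma_tilde_eqI) (simp add: sigma_tilde_action_inj sigma_tilde_simps sigma_tilde_0 restrict_prime_to_def)
  thus ?case by simp
next
  case (mul_one_left a)
  show ?case by (rule sigma_tilde_eqI) (simp add: sigma_tilde_action_inj sigma_tilde_simps restrict_one[OF p])
next
  case (mul_one_right a)
  have "bc_action (BC_Inj 1) \<xi> = \<xi>"
    by (rule sigma_tilde_eqI) (simp add: sigma_tilde_action_inj sigma_tilde_simps restrict_one[OF p])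
  thus ?case by simp
next
  case (inj_add x y)
  show ?case
    by (rule sigma_tilde_eqI) (simp add: sigma_tilde_action_inj sigma_tilde_simps restrict_prime_to_def frag_extend_add algebra_simps)
next
  case (inj_mul x y)
  show ?case by (rule sigma_tilde_eqI) (simp add: sigma_tilde_action_inj sigma_tilde_simps restrict_mult[OF p] algebra_simps)
next
  case mu_0
  show ?case by (rule sigma_tilde_eqI) (simp add: sigma_tilde_action_inj sigma_tilde_simps sigma_tilde_0 restrict_prime_to_def)
next
  case mus_0
  show ?case by (rule sigma_tilde_eqI) (simp add: sigma_tilde_action_inj sigma_tilde_simps sigma_tilde_0 restrict_prime_to_def)
next
  case (mu_inj_mus n x)
  thus ?case
    by (intro sigma_tilde_eqI)
      (simp add: sigma_tilde_action_inj sigma_tilde_simps trace_rho_projection'[OF p _ keys_sigma_tilde])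
next
  case (mus_inj n x)
  thus ?case
    by (intro sigma_tilde_eqI) (simp add: sigma_tilde_action_inj sigma_tilde_simps bc_sigma_mult[OF p] restrict_sigma[OF p])
next
  case (inj_mu n x)
  \<comment> \<open>The projection formula is applied to r x in place of x; r commutes with
    \<sigma>_n and is idempotent.\<close>
  have "bc_sigma n (restrict_prime_to p x) = restrict_prime_to p (bc_sigma n x)"
    by (rule restrict_sigma[OF p, symmetric])
  moreover have "restrict_prime_to p (restrict_prime_to p x) = restrict_prime_to p x"
    by (rule restrict_id[OF p keys_restrict[OF p]])
  ultimately have "trace_rho p n (restrict_prime_to p (bc_sigma n x) * g) = restrict_prime_to p x * trace_rho p n g" for g
    using trace_rho_projection[OF p inj_mu, of "restrict_prime_to p x" g] by simp
  with inj_mu show ?case by (intro sigma_tilde_eqI) (simp add: sigma_tilde_action_inj sigma_tilde_simps)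
next
  case (mu_mult n m)
  thus ?case by (intro sigma_tilde_eqI) (simp add: sigma_tilde_action_inj sigma_tilde_simps trace_rho_mult[OF p])
next
  case (mus_mult n m)
  thus ?case by (intro sigma_tilde_eqI) (simp add: sigma_tilde_action_inj sigma_tilde_simps bc_sigma_compose[OF p])
next
  case (mus_mu n)
  have "restrict_prime_to p (of_nat n) = of_nat n"
    by (induction n) (simp_all add: restrict_prime_to_def frag_extend_add restrict_one[OF p, unfolded restrict_prime_to_def])
  with mus_mu show ?case
    by (intro sigma_tilde_eqI) (simp add: sigma_tilde_action_inj sigma_tilde_simps sigma_trace_rho[OF p _ keys_sigma_tilde])
next
  case (mu_mus_commute n m)
  thus ?case
    by (intro sigma_tilde_eqI) (simp add: sigma_tilde_action_inj sigma_tilde_simps trace_rho_sigma_coprime[OF p] coprime_iff_gcd_eq_1)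
qed (simp_all add: bc_action_add algebra_simps)

definition bc_rep :: "bc_algebra \<Rightarrow> 'k W0 \<Rightarrow> 'k W0" where
  "bc_rep h = bc_action (rep_bc_algebra h)"

lemma bc_rep_abs: "bc_rep (abs_bc_algebra e) = bc_action e"
proof
  fix \<xi>
  have "bc_eq (rep_bc_algebra (abs_bc_algebra e)) e"
    by (rule Quotient3_rep_abs[OF Quotient3_bc_algebra bc_eq.refl])
  thus "bc_rep (abs_bc_algebra e) \<xi> = bc_action e \<xi>" unfolding bc_rep_def by (rule bc_action_cong)
qed

lemma abs_bc_algebra_cases: "\<exists>e. h = abs_bc_algebra e"
  by (metis Quotient3_abs_rep[OF Quotient3_bc_algebra])

lemma bc_rep_generators:
  "bc_rep (bc_inj x) \<xi> = inv_into UNIV (sigma_tilde \<sigma>) (restrict_prime_to p x) * \<xi>"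
  "n > 0 \<Longrightarrow> bc_rep (bc_mus n) = W0_F n"
  "n > 0 \<Longrightarrow> bc_rep (bc_mu n) = W0_V n"
  by (simp_all add: bc_action.simps(1) bc_inj.abs_eq bc_mu.abs_eq bc_mus.abs_eq bc_rep_abs fun_eq_iff)

lemma bc_representation_bc_rep: "bc_representation bc_rep"
  unfolding bc_representation_def
proof (intro conjI allI)
  show "Modules.additive (bc_rep h)" for h
    by (simp add: additive_def bc_rep_def bc_action_add)
  fix g h
  obtain a b where ab: "g = abs_bc_algebra a" "h = abs_bc_algebra b" using abs_bc_algebra_cases by metis
  show "bc_rep (g + h) = (\<lambda>\<xi>. bc_rep g \<xi> + bc_rep h \<xi>)"
    by (simp add: ab plus_bc_algebra.abs_eq bc_rep_abs fun_eq_iff)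
  show "bc_rep (g * h) = bc_rep g \<circ> bc_rep h"
    by (simp add: ab times_bc_algebra.abs_eq bc_rep_abs fun_eq_iff)
next
  show "bc_rep 1 = id"
    using bc_action_cong[OF bc_eq.mul_one_left, of "BC_Inj 1"]
    by (intro ext sigma_tilde_eqI)
      (simp add: one_bc_algebra.abs_eq bc_rep_abs sigma_tilde_action_inj restrict_one[OF p])
qed

text \<open>Every element is the class of an expression in the generators, so \<pi> is forced by
  induction on expressions. Generators of index 0 are zero by relation, and \<pi> sends zero to zero
  by additivity.\<close>

lemma bc_rep_unique:
  assumes rep: "bc_representation \<pi>"
    and inj: "\<And>x \<xi>. \<pi> (bc_inj x) \<xi> = inv_into UNIV (sigma_tilde \<sigma>) (restrict_prime_to p x) * \<xi>"
    and mus: "\<And>n. n > 0 \<Longrightarrow> \<pi> (bc_mus n) = W0_F n"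
    and mu: "\<And>n. n > 0 \<Longrightarrow> \<pi> (bc_mu n) = W0_V n"
  shows "\<pi> = bc_rep"
proof -
  have add: "\<pi> (g + h) \<xi> = \<pi> g \<xi> + \<pi> h \<xi>" and mult: "\<pi> (g * h) \<xi> = \<pi> g (\<pi> h \<xi>)" for g h \<xi>
    using rep by (auto simp: bc_representation_def)
  have zero: "\<pi> 0 \<xi> = 0" for \<xi> using add[of 0 0 \<xi>] by simp
  have neg: "\<pi> (- h) \<xi> = - \<pi> h \<xi>" for h \<xi>
    using add[of "- h" h \<xi>] zero[of \<xi>] by (simp add: eq_neg_iff_add_eq_0)
  have "\<pi> (abs_bc_algebra e) \<xi> = bc_action e \<xi>" for e \<xi>
  proof (induction e arbitrary: \<xi>)
    case (BC_Inj x)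
    show ?case using inj[of x \<xi>] by (simp add: bc_inj.abs_eq bc_action.simps(1))
  next
    case (BC_Mu n)
    have "bc_mu 0 = 0" by (transfer; rule bc_eq.mu_0)
    thus ?case using mu[of n] zero by (cases "n = 0") (simp_all flip: bc_mu.abs_eq)
  next
    case (BC_Mus n)
    have "bc_mus 0 = 0" by (transfer; rule bc_eq.mus_0)
    thus ?case using mus[of n] zero by (cases "n = 0") (simp_all flip: bc_mus.abs_eq)
  next
    case (BC_Add a b)
    thus ?case using add by (simp flip: plus_bc_algebra.abs_eq)
  next
    case (BC_Neg a)
    thus ?case using neg by (simp flip: uminus_bc_algebra.abs_eq)
  next
    case (BC_Mul a b)
    thus ?case using mult by (simp flip: times_bc_algebra.abs_eq)
  qed
  hence "\<pi> (abs_bc_algebra e) = bc_rep (abs_bc_algebra e)" for e by (simp add: bc_rep_abs fun_eq_iff)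
  thus ?thesis using abs_bc_algebra_cases by (metis ext)
qed

end

theorem theorem4p5:
  fixes p :: nat and \<sigma> :: "'k::alg_closed_field \<Rightarrow> qmodz"
  assumes "prime p"
    and "is_alg_closure_Fp p TYPE('k)"
    and "\<And>a b. a \<noteq> 0 \<Longrightarrow> b \<noteq> 0 \<Longrightarrow> \<sigma> (a * b) = \<sigma> a + \<sigma> b"
    and "inj_on \<sigma> (UNIV - {0})"
  shows "\<exists>!\<pi> :: bc_algebra \<Rightarrow> 'k W0 \<Rightarrow> 'k W0.
    bc_representation \<pi> \<and>
    (\<forall>x \<xi>. \<pi> (bc_inj x) \<xi> = inv_into UNIV (sigma_tilde \<sigma>) (restrict_prime_to p x) * \<xi>) \<and>
    (\<forall>n>0. \<pi> (bc_mus n) = W0_F n) \<and>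
    (\<forall>n>0. \<pi> (bc_mu n) = W0_V n)"
proof -
  interpret char_p_embedding p \<sigma>
    using assms by unfold_locales (auto simp: is_alg_closure_Fp_def)
  show ?thesis
    by (rule ex1I[of _ bc_rep])
      (use bc_representation_bc_rep bc_rep_generators bc_rep_unique in blast)+
qed

end
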